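(* There exists a constant $K>0$, independent of the cutoff $\Lambda$, of $n$ and of the graph, such that for every connected vacuum BFL graph $G$ of order $n$ (as defined in the context) its amplitude at cutoff $\Lambda$ satisfies $$|\mathcal{A}^{BFL}_G|\le K^n\,\Lambda^{6+3n}.$$
   Context: Let $\mathrm{SU}(2)$ carry its normalized Haar measure and let $D^j(g)$ denote the spin-$j$ matrix representation. Let $C_\phi$ be the orthogonal projector on $L^2(\mathrm{SU}(2)^3)$ given by $(C_\phi\phi)(g_1,g_2,g_3)=\frac13\sum_{c}\int dh\,\phi(g_{c(1)}h,g_{c(2)}h,g_{c(3)}h)$, the sum running over the three cyclic permutations $c$ of $\{1,2,3\}$. For a cutoff $\Lambda$, let $\mathcal{H}^{(\Lambda)}\subset L^2(\mathrm{SU}(2)^3)$ be the span of the functions $(g_1,g_2,g_3)\mapsto D^{j_1}(g_1)_{m_1n_1}D^{j_2}(g_2)_{m_2n_2}D^{j_3}(g_3)_{m_3n_3}$ with all spins $j_1,j_2,j_3\le\Lambda$, let $\mathcal{H}^{(\Lambda)}_0=\mathcal{H}^{(\Lambda)}\cap\mathrm{Im}\,C_\phi$, and let $C(x,y)$ ($x,y\in\mathrm{SU}(2)^3$) be the integral kernel of the orthogonal projector onto $\mathcal{H}^{(\Lambda)}_0$. A vertex carries six variables $g_1,\dots,g_6\in\mathrm{SU}(2)$ and four slots with triples $X_1,\dots,X_4$. For a tetrahedral vertex: $X_1=(g_1,g_2,g_3)$, $X_2=(g_3,g_4,g_5)$, $X_3=(g_5,g_2,g_6)$, $X_4=(g_6,g_4,g_1)$.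 For a pillow vertex: $X_1=(g_1,g_2,g_3)$, $X_2=(g_3,g_4,g_5)$, $X_3=(g_5,g_4,g_6)$, $X_4=(g_6,g_2,g_1)$. (These are the vertices of the Boulatov–Freidel–Louapre interaction $P[\phi]+\delta T[\phi]$, $|\delta|\le1$.) A vacuum BFL graph $G$ of order $n$ consists of $n$ vertices $v$, each of tetrahedral or pillow type (with variables $g^v=(g^v_1,\dots,g^v_6)$), together with a perfect matching of the $4n$ slots into lines (a line may join two slots of the same vertex); $G$ is connected if the underlying multigraph on the vertices is connected. Its amplitude is $$\mathcal{A}^{BFL}_G=\int\prod_{v}\prod_{i=1}^6dg^v_i\prod_{\text{lines }\{(v,a),(w,b)\}}C\big(X_a(g^v),X_b(g^w)\big).$$
   Formalization: The bound is proved for cutoffs Λ ≥ 1 and orders n ≥ 1; at Λ = 0 the claim fails, since every amplitude equals 1 while the bound is 0, and no uniform K works as Λ tends to 0. *)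

theory Defs
  imports "HOL-Probability.Probability" "HOL-Computational_Algebra.Polynomial"
begin

type_synonym cc = "complex \<times> complex"
type_synonym triple = "cc \<times> cc \<times> cc"

text \<open>SU(2) realised as pairs (a,b) with |a|^2+|b|^2=1, standing for the
 matrix [[a, b], [-cnj b, cnj a]].\<close>
definition SU2 :: "cc set" where
  "SU2 = {(a, b). (cmod a)^2 + (cmod b)^2 = 1}"

definition su2_mult :: "cc \<Rightarrow> cc \<Rightarrow> cc" where
  "su2_mult g h = (case g of (a, b) \<Rightarrow> case h of (c, d) \<Rightarrow>
      (a * c - b * cnj d, a * d + b * cnj c))"

definition haar :: "cc measure" where
  "haar = (THE \<mu>. prob_space \<mu> \<and> sets \<mu> = sets (restrict_space borel SU2)
      \<and> (\<forall>g\<in>SU2. distr \<mu> \<mu> (su2_mult g) = \<mu>))"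

definition haar3 :: "triple measure" where
  "haar3 = haar \<Otimes>\<^sub>M haar \<Otimes>\<^sub>M haar"

text \<open>Spin j = k/2 representation matrix, realised on binary forms of degree k
 (dehomogenised at y = 1), (g.P)(x,y) = P((x,y) g), basis x^q y^(k-q);
 entry (p,q) with p,q in 0..k.\<close>
definition wigD :: "nat \<Rightarrow> nat \<Rightarrow> nat \<Rightarrow> cc \<Rightarrow> complex" where
  "wigD k p q g = (case g of (a, b) \<Rightarrow>
      coeff ([:- cnj b, a:] ^ q * [:cnj a, b:] ^ (k - q)) p)"

definition Hcut :: "real \<Rightarrow> (triple \<Rightarrow> complex) set" where
  "Hcut \<Lambda> = {f. \<exists>(N::nat) (c::nat \<Rightarrow> complex) (k::nat \<Rightarrow> nat \<Rightarrow> nat)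
      (p::nat \<Rightarrow> nat \<Rightarrow> nat) (q::nat \<Rightarrow> nat \<Rightarrow> nat).
      (\<forall>i<N. \<forall>j<3. real (k i j) / 2 \<le> \<Lambda> \<and> p i j \<le> k i j \<and> q i j \<le> k i j) \<and>
      f = (\<lambda>(x1, x2, x3). \<Sum>i<N. c i * wigD (k i 0) (p i 0) (q i 0) x1
               * wigD (k i 1) (p i 1) (q i 1) x2 * wigD (k i 2) (p i 2) (q i 2) x3)}"

definition Cphi :: "(triple \<Rightarrow> complex) \<Rightarrow> triple \<Rightarrow> complex" where
  "Cphi \<phi> = (\<lambda>(x1, x2, x3). (1/3) *
      ((\<integral>h. \<phi> (su2_mult x1 h, su2_mult x2 h, su2_mult x3 h) \<partial>haar)
     + (\<integral>h. \<phi> (su2_mult x2 h, su2_mult x3 h, su2_mult x1 h) \<partial>haar)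
     + (\<integral>h. \<phi> (su2_mult x3 h, su2_mult x1 h, su2_mult x2 h) \<partial>haar)))"

definition ImCphi :: "(triple \<Rightarrow> complex) set" where
  "ImCphi = {f. \<exists>\<phi>. \<phi> \<in> borel_measurable haar3 \<and> integrable haar3 (\<lambda>x. (cmod (\<phi> x))^2)
      \<and> (AE x in haar3. f x = Cphi \<phi> x)}"

definition H0 :: "real \<Rightarrow> (triple \<Rightarrow> complex) set" where
  "H0 \<Lambda> = Hcut \<Lambda> \<inter> ImCphi"

definition is_onb_H0 :: "real \<Rightarrow> nat \<Rightarrow> (nat \<Rightarrow> triple \<Rightarrow> complex) \<Rightarrow> bool" where
  "is_onb_H0 \<Lambda> m e \<longleftrightarrow> (\<forall>i<m. e i \<in> H0 \<Lambda>)
     \<and> (\<forall>i<m. \<forall>j<m. (\<integral>x. e i x * cnj (e j x) \<partial>haar3) = (if i = j then 1 else 0))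
     \<and> (\<forall>f\<in>H0 \<Lambda>. \<exists>c::nat \<Rightarrow> complex.
           \<forall>x\<in>SU2 \<times> SU2 \<times> SU2. f x = (\<Sum>i<m. c i * e i x))"

text \<open>Integral kernel of the orthogonal projector onto H0, built from an ONB.\<close>
definition Ckern :: "nat \<Rightarrow> (nat \<Rightarrow> triple \<Rightarrow> complex) \<Rightarrow> triple \<Rightarrow> triple \<Rightarrow> complex" where
  "Ckern m e x y = (\<Sum>i<m. e i x * cnj (e i y))"

text \<open>BFL graphs: vertices 0..n-1, slot a (0..3) of vertex v is the number 4v+a;
 the lines form a fixed-point-free involution sigma of the slots.
 ty v = True: tetrahedral vertex, False: pillow vertex.\<close>
definition bfl_matching :: "nat \<Rightarrow> (nat \<Rightarrow> nat) \<Rightarrow> bool" where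
  "bfl_matching n \<sigma> \<longleftrightarrow> (\<forall>s<4*n. \<sigma> s < 4*n \<and> \<sigma> s \<noteq> s \<and> \<sigma> (\<sigma> s) = s)"

definition bfl_adj :: "(nat \<Rightarrow> nat) \<Rightarrow> nat \<Rightarrow> nat \<Rightarrow> bool" where
  "bfl_adj \<sigma> u w \<longleftrightarrow> (\<exists>i<4. \<exists>j<4. \<sigma> (4 * u + i) = 4 * w + j)"

definition bfl_connected :: "nat \<Rightarrow> (nat \<Rightarrow> nat) \<Rightarrow> bool" where
  "bfl_connected n \<sigma> \<longleftrightarrow> (\<forall>v<n. \<forall>w<n. (bfl_adj \<sigma>)\<^sup>*\<^sup>* v w)"

text \<open>Triples X_1..X_4 (here indexed 0..3), variables g_1..g_6 indexed 0..5.\<close>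
definition slotX :: "bool \<Rightarrow> nat \<Rightarrow> (nat \<Rightarrow> cc) \<Rightarrow> triple" where
  "slotX tet a g =
     (if a = 0 then (g 0, g 1, g 2)
      else if a = 1 then (g 2, g 3, g 4)
      else if a = 2 then (if tet then (g 4, g 1, g 5) else (g 4, g 3, g 5))
      else (if tet then (g 5, g 3, g 0) else (g 5, g 1, g 0)))"

definition bfl_amp :: "(triple \<Rightarrow> triple \<Rightarrow> complex) \<Rightarrow> nat \<Rightarrow> (nat \<Rightarrow> bool) \<Rightarrow> (nat \<Rightarrow> nat) \<Rightarrow> complex" where
  "bfl_amp C n ty \<sigma> =
     (\<integral>g. (\<Prod>s\<in>{s. s < 4*n \<and> s < \<sigma> s}.
            C (slotX (ty (s div 4)) (s mod 4) (\<lambda>i. g (s div 4, i)))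
              (slotX (ty (\<sigma> s div 4)) (\<sigma> s mod 4) (\<lambda>i. g (\<sigma> s div 4, i))))
      \<partial>(PiM ({..<n} \<times> {..<6}) (\<lambda>_. haar)))"

end

theory Submission
  imports Defs
begin

text \<open>Let \<open>D\<close> bound the dimension of the matrix coefficients of spin at most \<open>\<Lambda>\<close>, so \<open>D = O(\<Lambda>\<^sup>3)\<close>.
  Expanding every propagator in the orthonormal basis turns the amplitude into a contraction of vertex
  tensors along the lines. Elements of the cut-off space are right-invariant: fixing one of the three
  variables does not change the \<open>L\<^sup>2\<close> norm, and fixing a second one costs at most a factor \<open>D\<close>, because
  a translation-invariant function space of dimension at most \<open>D\<close> has evaluation norm at most \<open>\<surd>D\<close>.
  Hence, by Cauchy-Schwarz, a vertex tensor has operator norm at most \<open>D\<close> from any nonempty proper set of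
  its legs to the complementary set, and contracting two of its legs with a matrix of operator norm
  \<open>c\<close> leaves a matrix of operator norm at most \<open>D c\<close>. Now cut one line. A connected network
  with one incoming and one outgoing leg is composed of such steps: remove a vertex at an incoming leg,
  together with the part of the network that this separates from the outgoing legs. That part has
  exactly two legs by parity, since all vertices have degree 4, so the matrix bound applies to it.
  The opened network therefore has norm at most \<open>D\<^sup>n\<close>, and closing the line is a trace over a
  space of dimension at most \<open>D\<^sup>2\<close>.\<close>

section \<open>Haar measure on SU(2)\<close>

text \<open>The vertex estimates give nothing when all four legs of a vertex lie on one side: every
  group variable occurs in two slots, so the last slot brings no fresh variable to integrate over.
  The order in which vertices are removed must therefore leave each vertex an incoming and an
  outgoing leg. Self-loops and subnetworks attached to two legs of one vertex obstruct such an
  order. They are absorbed as a matrix on these two legs, and what enters is its operator norm;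
  treating the matrix as a vector would bring in its Hilbert-Schmidt norm, which can be larger by a
  power of the dimension. Parity of the degrees rules out a part that hangs on a single leg. Two
  notions are given only indirectly. \<open>haar\<close> is a definite description demanding left
  invariance, so existence and uniqueness come before any estimate, and right invariance is read off
  the explicit model. Membership in the image of \<open>Cphi\<close> is an almost-everywhere
  statement, which has to become a pointwise one because slots are evaluated at frozen group
  variables.\<close>

text \<open>Multiplication by an element of SU(2) with nonzero off-diagonal entry is a product of three
  shears, and a shear preserves Lebesgue measure by Fubini.\<close>

definition shear1 :: "(complex \<Rightarrow> complex) \<Rightarrow> cc \<Rightarrow> cc" where
  "shear1 t = (\<lambda>(c, d). (c + t d, d))"

definition shear2 :: "(complex \<Rightarrow> complex) \<Rightarrow> cc \<Rightarrow> cc" where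
  "shear2 t = (\<lambda>(c, d). (c, d + t c))"

lemma distr_shear1:
  assumes [measurable]: "t \<in> borel_measurable borel"
  shows "distr lborel borel (shear1 t) = (lborel :: cc measure)"
proof (rule measure_eqI)
  show "sets (distr lborel borel (shear1 t)) = sets (lborel :: cc measure)" by simp
  have m[measurable]: "shear1 t \<in> borel \<rightarrow>\<^sub>M borel"
    unfolding shear1_def borel_prod[symmetric] by measurable
  fix A assume "A \<in> sets (distr lborel borel (shear1 t))"
  then have A[measurable]: "A \<in> sets borel" by simp
  have A2[measurable]: "A \<in> sets (borel \<Otimes>\<^sub>M borel)" by (subst borel_prod) (rule A)
  have "emeasure (distr lborel borel (shear1 t)) A = (\<integral>\<^sup>+z. indicator A (shear1 t z) \<partial>lborel)"
    using nn_integral_distr[of "shear1 t" lborel borel "indicator A"] by simp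
  also have "\<dots> = (\<integral>\<^sup>+z. indicator A (shear1 t z) \<partial>(lborel \<Otimes>\<^sub>M lborel))"
    by (simp add: lborel_prod)
  also have "\<dots> = (\<integral>\<^sup>+d. \<integral>\<^sup>+c. indicator A (c + t d, d) \<partial>lborel \<partial>lborel)"
    unfolding shear1_def by (subst lborel_pair.nn_integral_snd[symmetric]) auto
  also have "\<dots> = (\<integral>\<^sup>+d. \<integral>\<^sup>+c. indicator A (c, d) \<partial>lborel \<partial>lborel)"
  proof (rule nn_integral_cong)
    fix d :: complex
    have "(\<integral>\<^sup>+c. indicator A (c, d) \<partial>lborel) = (\<integral>\<^sup>+c. indicator A (c, d) \<partial>distr lborel borel ((+) (t d)))"
      by (simp add: lborel_distr_plus)
    also have "\<dots> = (\<integral>\<^sup>+c. indicator A (t d + c, d) \<partial>lborel)"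
      by (subst nn_integral_distr) auto
    finally show "(\<integral>\<^sup>+c. indicator A (c + t d, d) \<partial>lborel) = (\<integral>\<^sup>+c. indicator A (c, d) \<partial>lborel)"
      by (simp add: add.commute)
  qed
  also have "\<dots> = (\<integral>\<^sup>+z. indicator A z \<partial>(lborel \<Otimes>\<^sub>M lborel))"
    by (subst lborel_pair.nn_integral_snd[symmetric]) auto
  also have "\<dots> = emeasure lborel A" by (simp add: lborel_prod)
  finally show "emeasure (distr lborel borel (shear1 t)) A = emeasure lborel A" .
qed

lemma distr_shear2:
  assumes [measurable]: "t \<in> borel_measurable borel"
  shows "distr lborel borel (shear2 t) = (lborel :: cc measure)"
proof (rule measure_eqI)
  show "sets (distr lborel borel (shear2 t)) = sets (lborel :: cc measure)" by simp
  have m[measurable]: "shear2 t \<in> borel \<rightarrow>\<^sub>M borel"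
    unfolding shear2_def borel_prod[symmetric] by measurable
  fix A assume "A \<in> sets (distr lborel borel (shear2 t))"
  then have A[measurable]: "A \<in> sets borel" by simp
  have A2[measurable]: "A \<in> sets (borel \<Otimes>\<^sub>M borel)" by (subst borel_prod) (rule A)
  have "emeasure (distr lborel borel (shear2 t)) A = (\<integral>\<^sup>+z. indicator A (shear2 t z) \<partial>lborel)"
    using nn_integral_distr[of "shear2 t" lborel borel "indicator A"] by simp
  also have "\<dots> = (\<integral>\<^sup>+z. indicator A (shear2 t z) \<partial>(lborel \<Otimes>\<^sub>M lborel))"
    by (simp add: lborel_prod)
  also have "\<dots> = (\<integral>\<^sup>+c. \<integral>\<^sup>+d. indicator A (c, d + t c) \<partial>lborel \<partial>lborel)"
    unfolding shear2_def by (subst lborel.nn_integral_fst[symmetric]) auto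
  also have "\<dots> = (\<integral>\<^sup>+c. \<integral>\<^sup>+d. indicator A (c, d) \<partial>lborel \<partial>lborel)"
  proof (rule nn_integral_cong)
    fix c :: complex
    have "(\<integral>\<^sup>+d. indicator A (c, d) \<partial>lborel) = (\<integral>\<^sup>+d. indicator A (c, d) \<partial>distr lborel borel ((+) (t c)))"
      by (simp add: lborel_distr_plus)
    also have "\<dots> = (\<integral>\<^sup>+d. indicator A (c, t c + d) \<partial>lborel)"
      by (subst nn_integral_distr) auto
    finally show "(\<integral>\<^sup>+d. indicator A (c, d + t c) \<partial>lborel) = (\<integral>\<^sup>+d. indicator A (c, d) \<partial>lborel)"
      by (simp add: add.commute)
  qed
  also have "\<dots> = (\<integral>\<^sup>+z. indicator A z \<partial>(lborel \<Otimes>\<^sub>M lborel))"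
    by (subst lborel.nn_integral_fst[symmetric]) auto
  also have "\<dots> = emeasure lborel A" by (simp add: lborel_prod)
  finally show "emeasure (distr lborel borel (shear2 t)) A = emeasure lborel A" .
qed

lemma shear_measurable[measurable]:
  assumes [measurable]: "t \<in> borel_measurable borel"
  shows "shear1 t \<in> borel \<rightarrow>\<^sub>M borel" "shear2 t \<in> borel \<rightarrow>\<^sub>M borel"
  unfolding shear1_def shear2_def borel_prod[symmetric] by measurable

lemma distr_shears:
  assumes [measurable]: "t \<in> borel_measurable borel" "s \<in> borel_measurable borel" "r \<in> borel_measurable borel"
  shows "distr lborel borel (\<lambda>z. shear1 t (shear2 s (shear1 r z))) = (lborel :: cc measure)"
proof -
  have "distr lborel borel (\<lambda>z. shear1 t (shear2 s (shear1 r z)))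
     = distr (distr (distr lborel borel (shear1 r)) borel (shear2 s)) borel (shear1 t)"
    by (simp add: distr_distr comp_def)
  then show ?thesis by (simp add: distr_shear1 distr_shear2)
qed

section \<open>Quaternion algebra on pairs of complex numbers\<close>

lemma su2_mult_assoc: "su2_mult (su2_mult x y) z = su2_mult x (su2_mult y z)"
  by (auto simp: su2_mult_def split_def algebra_simps)

lemma SU2_iff: "g \<in> SU2 \<longleftrightarrow> fst g * cnj (fst g) + snd g * cnj (snd g) = 1"
proof -
  have "fst g * cnj (fst g) + snd g * cnj (snd g) = complex_of_real ((cmod (fst g))^2 + (cmod (snd g))^2)"
    by (simp add: complex_norm_square[symmetric])
  then show ?thesis unfolding SU2_def
    by (auto simp: split_def simp del: of_real_add of_real_power)
qed

lemma SU2_norm: "g \<in> SU2 \<longleftrightarrow> norm g = 1"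
  by (cases g) (auto simp: SU2_def norm_Pair)

lemma SU2_sphere: "SU2 = sphere 0 1"
  by (auto simp: SU2_norm)

lemma su2_mult_closed: "g \<in> SU2 \<Longrightarrow> h \<in> SU2 \<Longrightarrow> su2_mult g h \<in> SU2"
proof -
  assume "g \<in> SU2" "h \<in> SU2"
  obtain a b c d where [simp]: "g = (a,b)" "h = (c,d)" by (metis surj_pair)
  have "fst (su2_mult g h) * cnj (fst (su2_mult g h)) + snd (su2_mult g h) * cnj (snd (su2_mult g h))
     = (a * cnj a + b * cnj b) * (c * cnj c + d * cnj d)"
    by (simp add: su2_mult_def algebra_simps)
  then show ?thesis using \<open>g \<in> SU2\<close> \<open>h \<in> SU2\<close> by (simp add: SU2_iff)
qed

text \<open>Multiplicativity of the quaternion norm on the whole four-dimensional space, not just on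
  \<open>SU2\<close>: the invariance argument moves Lebesgue measure on the full unit ball.\<close>

lemma norm_su2_mult: "norm (su2_mult g h) = norm g * norm h"
proof -
  obtain a b c d where [simp]: "g = (a,b)" "h = (c,d)" by (metis surj_pair)
  have "complex_of_real ((cmod (fst (su2_mult g h)))^2 + (cmod (snd (su2_mult g h)))^2)
     = (a * cnj a + b * cnj b) * (c * cnj c + d * cnj d)"
    by (simp add: su2_mult_def complex_norm_square algebra_simps del: of_real_power)
  also have "\<dots> = complex_of_real (((cmod a)^2 + (cmod b)^2) * ((cmod c)^2 + (cmod d)^2))"
    by (simp add: complex_norm_square algebra_simps del: of_real_power)
  finally have "(cmod (fst (su2_mult g h)))^2 + (cmod (snd (su2_mult g h)))^2
     = ((cmod a)^2 + (cmod b)^2) * ((cmod c)^2 + (cmod d)^2)"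
    using of_real_eq_iff by blast
  then show ?thesis
    by (simp add: norm_prod_def real_sqrt_mult)
qed

definition su2_inv :: "cc \<Rightarrow> cc" where "su2_inv g = (cnj (fst g), - snd g)"

lemma su2_inv_SU2: "g \<in> SU2 \<Longrightarrow> su2_inv g \<in> SU2"
  by (simp add: su2_inv_def SU2_iff mult.commute)

lemma su2_one: "su2_mult (1,0) g = g" "su2_mult g (1,0) = g" "(1,0) \<in> SU2"
  by (auto simp: su2_mult_def split_def SU2_def)

lemma su2_inv_mult: "g \<in> SU2 \<Longrightarrow> su2_mult g (su2_inv g) = (1,0)" "g \<in> SU2 \<Longrightarrow> su2_mult (su2_inv g) g = (1,0)"
  by (auto simp: su2_inv_def su2_mult_def split_def SU2_iff algebra_simps)

lemma su2_mult_scale: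
  "su2_mult g (r *\<^sub>R h) = r *\<^sub>R su2_mult g h" "su2_mult (r *\<^sub>R g) h = r *\<^sub>R su2_mult g h"
  by (auto simp: su2_mult_def split_def algebra_simps)

lemma continuous_su2_mult[continuous_intros]:
  "continuous_on A f \<Longrightarrow> continuous_on A g \<Longrightarrow> continuous_on A (\<lambda>x. su2_mult (f x) (g x))"
  unfolding su2_mult_def split_def by (intro continuous_intros)

lemma measurable_su2_mult_left[measurable]: "su2_mult g \<in> borel \<rightarrow>\<^sub>M borel"
  by (intro borel_measurable_continuous_onI continuous_intros)

lemma measurable_su2_mult_right[measurable]: "(\<lambda>h. su2_mult h g) \<in> borel \<rightarrow>\<^sub>M borel"
  by (intro borel_measurable_continuous_onI continuous_intros)

lemma lborel_su2_left_aux: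
  assumes "g \<in> SU2" "snd g \<noteq> 0"
  shows "distr lborel borel (su2_mult g) = lborel"
proof -
  obtain a b where g: "g = (a,b)" by (metis surj_pair)
  have b: "b \<noteq> 0" using assms g by simp
  have n: "a * cnj a + b * cnj b = 1" using assms g by (simp add: SU2_iff)
  \<comment> \<open>The diagonal entries determine \<open>x\<close> and \<open>z\<close>: both
    \<open>1 + x * cnj b\<close> and \<open>1 + b * cnj z\<close> have to equal \<open>a\<close>.
    The remaining entry, computed in \<open>e\<close>, then comes out as \<open>- b\<close> by the
    norm condition \<open>n\<close>.\<close>
  define x where "x = (a - 1) / cnj b"
  define z where "z = (cnj a - 1) / cnj b"
  have "su2_mult g = (\<lambda>w. shear1 (\<lambda>d. x * cnj d) (shear2 (\<lambda>c. b * cnj c) (shear1 (\<lambda>d. z * cnj d) w)))"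
  proof
    fix w :: cc
    obtain c d where w: "w = (c,d)" by (metis surj_pair)
    have xb: "x * cnj b = a - 1" using b by (simp add: x_def)
    have zb: "z * cnj b = cnj a - 1" using b by (simp add: z_def)
    have zb': "b * cnj z = a - 1" using arg_cong[OF zb, of cnj] by (simp add: mult.commute)
    have e: "(z + x + x * cnj b * z) = - b"
    proof -
      have "(z + x + x * cnj b * z) * cnj b = (z * cnj b) + x * cnj b + x * cnj b * (z * cnj b)"
        by (simp add: algebra_simps)
      also have "\<dots> = (cnj a - 1) + (a - 1) + (a-1)*(cnj a - 1)" by (simp add: xb zb)
      also have "\<dots> = - b * cnj b" using n by (simp add: algebra_simps)
      finally have "(z + x + x * cnj b * z) * cnj b = (- b) * cnj b" .
      then show ?thesis using b by (simp only: mult_cancel_right) simp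
    qed
    have 1: "c + z * cnj d + x * cnj (d + b * cnj (c + z * cnj d)) = a * c - b * cnj d"
    proof -
      have "c + z * cnj d + x * cnj (d + b * cnj (c + z * cnj d))
         = (1 + x * cnj b) * c + (z + x + x * cnj b * z) * cnj d"
        by (simp add: algebra_simps)
      also have "\<dots> = (1 + (a - 1)) * c + (- b) * cnj d" by (subst e, subst xb) (rule refl)
      finally show ?thesis by simp
    qed
    have 2: "d + b * cnj (c + z * cnj d) = a * d + b * cnj c"
    proof -
      have "d + b * cnj (c + z * cnj d) = (1 + b * cnj z) * d + b * cnj c" by (simp add: algebra_simps)
      then show ?thesis unfolding zb' by (simp add: algebra_simps)
    qed
    show "su2_mult g w = shear1 (\<lambda>d. x * cnj d) (shear2 (\<lambda>c. b * cnj c) (shear1 (\<lambda>d. z * cnj d) w))"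
      unfolding g w su2_mult_def shear1_def shear2_def by (simp add: 1[symmetric] 2[symmetric])
  qed
  then show ?thesis by (simp add: distr_shears borel_measurable_continuous_onI continuous_intros)
qed

text \<open>Right multiplication is complex linear, so the same factorisation goes through with
  shears free of conjugates.\<close>

lemma lborel_su2_right_aux:
  assumes "g \<in> SU2" "snd g \<noteq> 0"
  shows "distr lborel borel (\<lambda>h. su2_mult h g) = lborel"
proof -
  obtain c d where g: "g = (c,d)" by (metis surj_pair)
  have d: "d \<noteq> 0" using assms g by simp
  have n: "c * cnj c + d * cnj d = 1" using assms g by (simp add: SU2_iff)
  define x where "x = (c - 1) / d"
  define z where "z = (cnj c - 1) / d"
  have "(\<lambda>h. su2_mult h g) = (\<lambda>w. shear1 (\<lambda>b. x * b) (shear2 (\<lambda>a. d * a) (shear1 (\<lambda>b. z * b) w)))"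
  proof
    fix w :: cc
    obtain a b where w: "w = (a,b)" by (metis surj_pair)
    have xd: "x * d = c - 1" using d by (simp add: x_def)
    have zd: "z * d = cnj c - 1" using d by (simp add: z_def)
    have e: "(z + x + x * d * z) = - cnj d"
    proof -
      have "(z + x + x * d * z) * d = (z * d) + x * d + x * d * (z * d)"
        by (simp add: algebra_simps)
      also have "\<dots> = (cnj c - 1) + (c - 1) + (c-1)*(cnj c - 1)" by (simp add: xd zd)
      also have "\<dots> = - cnj d * d" using n by (simp add: algebra_simps)
      finally have "(z + x + x * d * z) * d = (- cnj d) * d" .
      then show ?thesis using d by (simp only: mult_cancel_right) simp
    qed
    have 1: "a + z * b + x * (b + d * (a + z * b)) = a * c - b * cnj d"
    proof -
      have "a + z * b + x * (b + d * (a + z * b))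
         = (1 + x * d) * a + (z + x + x * d * z) * b"
        by (simp add: algebra_simps)
      also have "\<dots> = (1 + (c - 1)) * a + (- cnj d) * b" by (subst e, subst xd) (rule refl)
      finally show ?thesis by simp
    qed
    have 2: "b + d * (a + z * b) = a * d + b * cnj c"
    proof -
      have "b + d * (a + z * b) = (1 + z * d) * b + a * d" by (simp add: algebra_simps)
      then show ?thesis unfolding zd by (simp add: algebra_simps)
    qed
    show "su2_mult w g = shear1 (\<lambda>b. x * b) (shear2 (\<lambda>a. d * a) (shear1 (\<lambda>b. z * b) w))"
      unfolding g w su2_mult_def shear1_def shear2_def by (simp add: 1[symmetric] 2[symmetric])
  qed
  then show ?thesis by (simp add: distr_shears borel_measurable_continuous_onI continuous_intros)
qed

text \<open>The shear factorisation divides by the off-diagonal entry. Multiplying by a suitable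
  element and by its inverse writes every group element as a product of two for which this entry is
  nonzero.\<close>

lemma SU2_offdiag_factor:
  assumes "g \<in> SU2"
  obtains h k where "h \<in> SU2" "k \<in> SU2" "snd h \<noteq> 0" "snd k \<noteq> 0" "g = su2_mult h k"
proof (cases "snd g = 0")
  case False
  \<comment> \<open>Two test elements built from the triple 3, 4, 5. If both products had a
    vanishing off-diagonal entry, adding the two equations would give \<open>b = 0\<close>.\<close>
  define k :: cc where "k = (3/5, 4/5)"
  define k' :: cc where "k' = (3/5, -4/5)"
  have "k \<in> SU2" "k' \<in> SU2" by (auto simp: k_def k'_def SU2_iff)
  obtain a b where g: "g = (a,b)" by (metis surj_pair)
  show thesis
  proof (cases "snd (su2_mult g k) = 0")
    case True
    then have e1: "a * 4/5 + b * 3/5 = 0" by (simp add: g k_def su2_mult_def)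
    have "snd (su2_mult g k') \<noteq> 0"
    proof
      assume "snd (su2_mult g k') = 0"
      then have "- (a * 4/5) + b * 3/5 = 0" by (simp add: g k'_def su2_mult_def)
      then have "b = 0" using e1 by algebra
      then show False using False g by simp
    qed
    then show thesis
      by (intro that[of "su2_mult g k'" "su2_inv k'"])
         (use \<open>k' \<in> SU2\<close> assms in \<open>auto simp: su2_mult_closed su2_inv_SU2 su2_mult_assoc su2_inv_mult su2_one\<close>,
          simp add: k'_def su2_inv_def)
  next
    case F: False
    then show thesis
      by (intro that[of "su2_mult g k" "su2_inv k"])
         (use \<open>k \<in> SU2\<close> assms in \<open>auto simp: su2_mult_closed su2_inv_SU2 su2_mult_assoc su2_inv_mult su2_one\<close>,
          simp add: k_def su2_inv_def)
  qed
next
  case True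
  define k :: cc where "k = (0, 1)"
  have "k \<in> SU2" by (auto simp: k_def SU2_iff)
  have "snd (su2_mult g k) \<noteq> 0" using True assms by (cases g) (auto simp: k_def su2_mult_def SU2_iff)
  then show thesis
    by (intro that[of "su2_mult g k" "su2_inv k"])
       (use \<open>k \<in> SU2\<close> assms in \<open>auto simp: su2_mult_closed su2_inv_SU2 su2_mult_assoc su2_inv_mult su2_one\<close>,
        simp add: k_def su2_inv_def)
qed

lemma lborel_su2_left: 
  assumes "g \<in> SU2" shows "distr lborel borel (su2_mult g) = lborel"
proof -
  obtain h k where "h \<in> SU2" "k \<in> SU2" "snd h \<noteq> 0" "snd k \<noteq> 0" "g = su2_mult h k"
    using SU2_offdiag_factor[OF assms] .
  then have "su2_mult g = su2_mult h \<circ> su2_mult k" by (auto simp: su2_mult_assoc)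
  then have "distr lborel borel (su2_mult g) = distr (distr lborel borel (su2_mult k)) borel (su2_mult h)"
    by (simp add: distr_distr)
  then show ?thesis
    by (simp add: lborel_su2_left_aux \<open>h \<in> SU2\<close> \<open>k \<in> SU2\<close> \<open>snd h \<noteq> 0\<close> \<open>snd k \<noteq> 0\<close>)
qed

lemma lborel_su2_right: 
  assumes "g \<in> SU2" shows "distr lborel borel (\<lambda>x. su2_mult x g) = lborel"
proof -
  obtain h k where "h \<in> SU2" "k \<in> SU2" "snd h \<noteq> 0" "snd k \<noteq> 0" "g = su2_mult h k"
    using SU2_offdiag_factor[OF assms] .
  then have "(\<lambda>x. su2_mult x g) = (\<lambda>x. su2_mult x k) \<circ> (\<lambda>x. su2_mult x h)" by (auto simp: su2_mult_assoc)
  then have "distr lborel borel (\<lambda>x. su2_mult x g) = distr (distr lborel borel (\<lambda>x. su2_mult x h)) borel (\<lambda>x. su2_mult x k)"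
    by (simp add: distr_distr)
  then show ?thesis
    by (simp add: lborel_su2_right_aux \<open>h \<in> SU2\<close> \<open>k \<in> SU2\<close> \<open>snd h \<noteq> 0\<close> \<open>snd k \<noteq> 0\<close>)
qed

section \<open>The cone measure as a model of Haar measure\<close>

definition sphere_proj :: "cc \<Rightarrow> cc" where
  "sphere_proj x = (if x = 0 then (1, 0) else x /\<^sub>R norm x)"

definition ball_measure :: "cc measure" where
  "ball_measure = uniform_measure lborel (ball 0 1)"

text \<open>Radial image of the uniform distribution on the unit ball. It takes the place of a
  surface measure on the sphere and inherits both invariances from Lebesgue measure. The value of
  \<open>sphere_proj\<close> at the origin is harmless, since a point is a null set.\<close>

definition cone_measure :: "cc measure" where
  "cone_measure = distr ball_measure (restrict_space borel SU2) sphere_proj"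

lemma emeasure_unit_ball: "emeasure lborel (ball 0 1 :: cc set) \<noteq> 0" "emeasure lborel (ball 0 1 :: cc set) \<noteq> \<infinity>"
proof -
  show "emeasure lborel (ball 0 1 :: cc set) \<noteq> 0" 
    using content_ball_pos[of 1 "0::cc"] by (auto simp: measure_def)
  show "emeasure lborel (ball 0 1 :: cc set) \<noteq> \<infinity>"
    using emeasure_bounded_finite[of "ball 0 1 :: cc set"] by auto
qed

lemma prob_space_ball_measure: "prob_space ball_measure"
  unfolding ball_measure_def using emeasure_unit_ball by (intro prob_space_uniform_measure) auto

lemma sets_ball_measure[simp]: "sets ball_measure = sets borel" "space ball_measure = UNIV"
  by (simp_all add: ball_measure_def)

lemma sphere_proj_SU2: "sphere_proj x \<in> SU2"
proof (cases "x = 0")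
  case True
  then show ?thesis by (simp add: sphere_proj_def su2_one)
next
  case False
  then have "norm (x /\<^sub>R norm x) = 1" by (simp only: norm_scaleR) simp
  then show ?thesis using False by (simp add: sphere_proj_def SU2_norm)
qed

lemma sphere_proj_measurable: "sphere_proj \<in> ball_measure \<rightarrow>\<^sub>M restrict_space borel SU2"
proof -
  have "sphere_proj \<in> borel \<rightarrow>\<^sub>M borel" unfolding sphere_proj_def[abs_def] by measurable
  then show ?thesis
    by (intro measurable_restrict_space2) (auto simp: sphere_proj_SU2 measurable_cong_sets[OF sets_ball_measure(1) refl])
qed

lemma prob_space_cone_measure: "prob_space cone_measure"
  unfolding cone_measure_def
  by (rule prob_space.prob_space_distr[OF prob_space_ball_measure sphere_proj_measurable])

lemma sets_cone_measure[simp]: "sets cone_measure = sets (restrict_space borel SU2)"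
  by (simp add: cone_measure_def)

lemma ball_measure_invariant:
  assumes [measurable]: "L \<in> borel \<rightarrow>\<^sub>M borel" and "distr lborel borel L = lborel" "\<And>x. norm (L x) = norm x"
  shows "distr ball_measure borel L = ball_measure"
proof (rule measure_eqI)
  fix A assume "A \<in> sets (distr ball_measure borel L)"
  then have A[measurable]: "A \<in> sets borel" by simp
  have L: "L \<in> measurable ball_measure borel" by (simp add: measurable_cong_sets[OF sets_ball_measure(1) refl])
  have "emeasure (distr ball_measure borel L) A = emeasure ball_measure (L -` A)"
    using L by (subst emeasure_distr) auto
  also have "\<dots> = emeasure lborel (ball 0 1 \<inter> L -` A) / emeasure lborel (ball 0 1 :: cc set)"
    unfolding ball_measure_def using measurable_sets_borel[OF assms(1) A] by (subst emeasure_uniform_measure) auto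
  also have "ball 0 1 \<inter> L -` A = L -` (ball 0 1 \<inter> A)" 
  proof (intro set_eqI)
    fix x show "x \<in> ball 0 1 \<inter> L -` A \<longleftrightarrow> x \<in> L -` (ball 0 1 \<inter> A)" using assms(3)[of x] by auto
  qed
  also have "emeasure lborel (L -` (ball 0 1 \<inter> A)) = emeasure (distr lborel borel L) (ball 0 1 \<inter> A)"
    by (subst emeasure_distr) auto
  finally show "emeasure (distr ball_measure borel L) A = emeasure ball_measure A"
    unfolding assms(2) ball_measure_def by (subst emeasure_uniform_measure) auto
qed simp

text \<open>A norm-preserving map that commutes with scaling commutes with the radial projection
  away from the origin, so invariance on the ball descends to the sphere.\<close>

lemma cone_measure_invariant:
  assumes L[measurable]: "L \<in> borel \<rightarrow>\<^sub>M borel" and "distr lborel borel L = lborel" "\<And>x. norm (L x) = norm x"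
    and scale: "\<And>r x. L (r *\<^sub>R x) = r *\<^sub>R L x"
  shows "distr cone_measure cone_measure L = cone_measure"
proof -
  have LS: "x \<in> SU2 \<Longrightarrow> L x \<in> SU2" for x using assms(3) by (simp add: SU2_norm)
  have LR: "L \<in> restrict_space borel SU2 \<rightarrow>\<^sub>M restrict_space borel SU2"
    by (intro measurable_restrict_space3 L) (auto simp: LS)
  have LB: "L \<in> ball_measure \<rightarrow>\<^sub>M ball_measure"
    using L by (simp cong: measurable_cong_sets)
  have "AE x in lborel. x \<noteq> (0::cc)" by (rule AE_lborel_singleton)
  then have AE0: "AE x in ball_measure. x \<noteq> 0"
    unfolding ball_measure_def by (intro AE_uniform_measureI) auto
  have "distr cone_measure cone_measure L = distr cone_measure (restrict_space borel SU2) L"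
    by (rule distr_cong) auto
  also have "\<dots> = distr ball_measure (restrict_space borel SU2) (L \<circ> sphere_proj)"
    unfolding cone_measure_def by (rule distr_distr[OF LR sphere_proj_measurable])
  also have "\<dots> = distr ball_measure (restrict_space borel SU2) (sphere_proj \<circ> L)"
  proof (rule distr_cong_AE)
    show "AE x in ball_measure. (L \<circ> sphere_proj) x = (sphere_proj \<circ> L) x"
      using AE0
    proof eventually_elim
      case (elim x)
      then have "L x \<noteq> 0" using assms(3)[of x] by (metis norm_eq_zero)
      then show ?case using elim by (simp add: sphere_proj_def assms(3) scale comp_def)
    qed
  qed (rule measurable_comp[OF sphere_proj_measurable LR] measurable_comp[OF LB sphere_proj_measurable] refl)+
  also have "\<dots> = distr (distr ball_measure ball_measure L) (restrict_space borel SU2) sphere_proj"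
    by (rule distr_distr[symmetric, OF sphere_proj_measurable LB])
  also have "distr ball_measure ball_measure L = distr ball_measure borel L"
    by (rule distr_cong) auto
  also have "\<dots> = ball_measure" by (rule ball_measure_invariant[OF assms(1-3)])
  finally show ?thesis by (simp add: cone_measure_def)
qed

lemma cone_measure_left: "g \<in> SU2 \<Longrightarrow> distr cone_measure cone_measure (su2_mult g) = cone_measure"
  by (rule cone_measure_invariant[OF measurable_su2_mult_left lborel_su2_left])
     (simp_all only: norm_su2_mult SU2_norm su2_mult_scale mult_1)

lemma cone_measure_right: "g \<in> SU2 \<Longrightarrow> distr cone_measure cone_measure (\<lambda>x. su2_mult x g) = cone_measure"
  by (rule cone_measure_invariant[OF measurable_su2_mult_right lborel_su2_right])
     (simp_all only: norm_su2_mult SU2_norm su2_mult_scale mult_1_right)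

lemma measurable_su2_mult_pair:
  "(\<lambda>(x,y). su2_mult x y) \<in> restrict_space borel SU2 \<Otimes>\<^sub>M restrict_space borel SU2 \<rightarrow>\<^sub>M restrict_space borel SU2"
proof (rule measurable_restrict_space2)
  show "(\<lambda>(x, y). su2_mult x y) \<in> space (restrict_space borel SU2 \<Otimes>\<^sub>M restrict_space borel SU2) \<rightarrow> SU2"
    by (auto simp: space_pair_measure space_restrict_space su2_mult_closed)
  have 1: "(\<lambda>z::cc \<times> cc. su2_mult (fst z) (snd z)) \<in> borel_measurable borel"
    by (intro borel_measurable_continuous_onI continuous_intros)
  have id: "(\<lambda>x. x) \<in> restrict_space borel SU2 \<rightarrow>\<^sub>M borel" by (rule measurable_restrict_space1) simp
  have "(\<lambda>z. (fst z, snd z)) \<in> restrict_space borel SU2 \<Otimes>\<^sub>M restrict_space borel SU2 \<rightarrow>\<^sub>M borel \<Otimes>\<^sub>M (borel :: cc measure)"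
    by (intro measurable_Pair measurable_compose[OF measurable_fst id] measurable_compose[OF measurable_snd id])
  then have "(\<lambda>z. z) \<in> restrict_space borel SU2 \<Otimes>\<^sub>M restrict_space borel SU2 \<rightarrow>\<^sub>M (borel :: (cc \<times> cc) measure)"
    by (simp add: borel_prod)
  from measurable_compose[OF this 1]
  show "(\<lambda>(x, y). su2_mult x y) \<in> restrict_space borel SU2 \<Otimes>\<^sub>M restrict_space borel SU2 \<rightarrow>\<^sub>M borel"
    by (simp add: split_def)
qed

text \<open>Both measures of a set equal the average of its translates over the product measure: one by left
  invariance of \<open>\<mu>\<close>, the other by right invariance of the cone measure.\<close>

lemma haar_unique:
  assumes "prob_space \<mu>" "sets \<mu> = sets (restrict_space borel SU2)"
    and left: "\<And>g. g \<in> SU2 \<Longrightarrow> distr \<mu> \<mu> (su2_mult g) = \<mu>"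
  shows "\<mu> = cone_measure"
proof (rule measure_eqI)
  show s: "sets \<mu> = sets cone_measure" using assms(2) by (simp only: sets_cone_measure)
  fix A assume A: "A \<in> sets \<mu>"
  interpret M: prob_space \<mu> by fact
  interpret N: prob_space cone_measure by (rule prob_space_cone_measure)
  interpret P: pair_sigma_finite cone_measure \<mu> by unfold_locales
  have sp: "space \<mu> = SU2" "space cone_measure = SU2"
    using sets_eq_imp_space_eq[OF assms(2)] sets_eq_imp_space_eq[OF sets_cone_measure]
    by (simp_all add: space_restrict_space)
  have mp: "(\<lambda>(x,y). su2_mult x y) \<in> cone_measure \<Otimes>\<^sub>M \<mu> \<rightarrow>\<^sub>M \<mu>"
    using measurable_su2_mult_pair assms(2) by (simp cong: measurable_cong_sets sets_pair_measure_cong)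
  have ml: "su2_mult g \<in> \<mu> \<rightarrow>\<^sub>M \<mu>" if "g \<in> SU2" for g
    using measurable_compose[OF measurable_Pair1' mp, of g] that sp by simp
  have mr: "(\<lambda>x. su2_mult x g) \<in> cone_measure \<rightarrow>\<^sub>M cone_measure" if "g \<in> SU2" for g
    using measurable_compose[OF measurable_Pair2' mp, of g] that sp s by (simp cong: measurable_cong_sets)
  have ind: "indicator A \<in> borel_measurable \<mu>" "indicator A \<in> borel_measurable cone_measure" 
    using A A[unfolded s] by (simp_all only: borel_measurable_indicator)
  have f: "(\<lambda>(x,y). indicator A (su2_mult x y) :: ennreal) \<in> borel_measurable (cone_measure \<Otimes>\<^sub>M \<mu>)"
    using measurable_compose[OF mp, of "indicator A :: cc \<Rightarrow> ennreal" borel] A by (simp add: split_def)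
  have "emeasure \<mu> A = (\<integral>\<^sup>+x. emeasure \<mu> A \<partial>cone_measure)"
    by (simp add: N.emeasure_space_1)
  also have "\<dots> = (\<integral>\<^sup>+x. \<integral>\<^sup>+y. indicator A (su2_mult x y) \<partial>\<mu> \<partial>cone_measure)"
  proof (rule nn_integral_cong)
    fix x assume "x \<in> space cone_measure"
    then have x: "x \<in> SU2" by (simp add: sp)
    have "emeasure \<mu> A = (\<integral>\<^sup>+y. indicator A y \<partial>distr \<mu> \<mu> (su2_mult x))" using A by (simp add: left x)
    also have "\<dots> = (\<integral>\<^sup>+y. indicator A (su2_mult x y) \<partial>\<mu>)" using ind ml x by (subst nn_integral_distr) auto
    finally show "emeasure \<mu> A = (\<integral>\<^sup>+y. indicator A (su2_mult x y) \<partial>\<mu>)" .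
  qed
  also have "\<dots> = (\<integral>\<^sup>+y. \<integral>\<^sup>+x. indicator A (su2_mult x y) \<partial>cone_measure \<partial>\<mu>)"
    using P.Fubini[OF f] by simp
  also have "\<dots> = (\<integral>\<^sup>+y. emeasure cone_measure A \<partial>\<mu>)"
  proof (rule nn_integral_cong)
    fix y assume "y \<in> space \<mu>"
    then have y: "y \<in> SU2" by (simp add: sp)
    have "emeasure cone_measure A = (\<integral>\<^sup>+x. indicator A x \<partial>distr cone_measure cone_measure (\<lambda>x. su2_mult x y))" 
      using A s by (simp add: cone_measure_right y)
    also have "\<dots> = (\<integral>\<^sup>+x. indicator A (su2_mult x y) \<partial>cone_measure)" using ind mr y by (subst nn_integral_distr) auto
    finally show "(\<integral>\<^sup>+x. indicator A (su2_mult x y) \<partial>cone_measure) = emeasure cone_measure A" by simp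
  qed
  also have "\<dots> = emeasure cone_measure A" by (simp add: M.emeasure_space_1)
  finally show "emeasure \<mu> A = emeasure cone_measure A" .
qed

text \<open>Existence and uniqueness together evaluate the definite description. From here on right
  invariance, which the definition of \<open>haar\<close> does not mention, is available as
  well.\<close>

lemma haar_eq: "haar = cone_measure"
  unfolding haar_def
proof (rule the_equality)
  show "prob_space cone_measure \<and> sets cone_measure = sets (restrict_space borel SU2)
    \<and> (\<forall>g\<in>SU2. distr cone_measure cone_measure (su2_mult g) = cone_measure)"
    using prob_space_cone_measure cone_measure_left by auto
qed (auto intro: haar_unique)

lemma prob_space_haar: "prob_space haar"
  by (simp add: haar_eq prob_space_cone_measure)

interpretation haar: prob_space haar by (rule prob_space_haar)

lemma sets_haar: "sets haar = sets (restrict_space borel SU2)"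
  by (simp add: haar_eq)

lemma space_haar[simp]: "space haar = SU2"
  using sets_eq_imp_space_eq[OF sets_haar] by (simp add: space_restrict_space)

lemma haar_left: "g \<in> SU2 \<Longrightarrow> distr haar haar (su2_mult g) = haar"
  by (simp add: haar_eq cone_measure_left)

lemma haar_right: "g \<in> SU2 \<Longrightarrow> distr haar haar (\<lambda>x. su2_mult x g) = haar"
  by (simp add: haar_eq cone_measure_right)

lemma measurable_su2_haar:
  assumes "g \<in> SU2" 
  shows "su2_mult g \<in> haar \<rightarrow>\<^sub>M haar" "(\<lambda>x. su2_mult x g) \<in> haar \<rightarrow>\<^sub>M haar"
proof -
  have mp: "(\<lambda>(x,y). su2_mult x y) \<in> haar \<Otimes>\<^sub>M haar \<rightarrow>\<^sub>M haar"
    using measurable_su2_mult_pair sets_haar by (simp cong: measurable_cong_sets sets_pair_measure_cong)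
  show "su2_mult g \<in> haar \<rightarrow>\<^sub>M haar"
    using measurable_compose[OF measurable_Pair1' mp, of g] assms by simp
  show "(\<lambda>x. su2_mult x g) \<in> haar \<rightarrow>\<^sub>M haar"
    using measurable_compose[OF measurable_Pair2' mp, of g] assms by simp
qed

lemma haar_measurable_continuous:
  fixes f :: "cc \<Rightarrow> 'b::topological_space"
  assumes "continuous_on SU2 f"
  shows "f \<in> borel_measurable haar"
  using borel_measurable_continuous_on_restrict[OF assms] by (simp add: measurable_cong_sets[OF sets_haar refl])

text \<open>A nonempty relatively open part of the sphere has positive measure, because the cone
  over it has interior in the ball. Gram-Schmidt relies on this: a continuous vector of norm zero
  has to vanish at every group element, not only almost everywhere.\<close>

lemma haar_zero_continuous:
  fixes f :: "cc \<Rightarrow> real"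
  assumes cont: "continuous_on SU2 f" and nn: "\<And>x. x \<in> SU2 \<Longrightarrow> 0 \<le> f x"
    and int: "(\<integral>x. f x \<partial>haar) = 0" and x: "x \<in> SU2"
  shows "f x = 0"
proof (rule ccontr)
  assume "f x \<noteq> 0"
  then have fx: "f x > 0" using nn[OF x] by simp
  have comp: "compact SU2" by (simp add: SU2_sphere)
  have [measurable]: "f \<in> borel_measurable haar" by (rule haar_measurable_continuous[OF cont])
  have "bounded (f ` SU2)" using comp cont by (intro compact_imp_bounded compact_continuous_image)
  then obtain B where B: "\<And>y. y \<in> SU2 \<Longrightarrow> norm (f y) \<le> B" unfolding bounded_iff by auto
  have intf: "integrable haar f" 
    by (rule haar.integrable_const_bound[of _ B]) (auto intro!: AE_I2 B[unfolded real_norm_def])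
  have "AE y in haar. 0 \<le> f y" by (rule AE_I2) (simp add: nn)
  then have AE: "AE y in haar. f y = 0"
    using integral_nonneg_eq_0_iff_AE[OF intf] int by simp
  obtain U where U: "open U" "U \<inter> SU2 = {y \<in> SU2. f y > 0}"
  proof -
    have "openin (top_of_set SU2) (SU2 \<inter> f -` {0<..})"
      using cont by (intro continuous_openin_preimage_gen) auto
    then show thesis using that unfolding openin_open by auto
  qed
  have cs: "continuous_on (- {0}) (\<lambda>x::cc. x /\<^sub>R norm x)" by (intro continuous_intros) auto
  \<comment> \<open>The open cone over \<open>U\<close> inside the ball, without the origin because
    the radial projection is continuous only off it. The point \<open>x\<close> lies on the boundary
    of the ball, hence half of it is used below.\<close>
  define V where "V = ball 0 1 \<inter> ((\<lambda>x::cc. x /\<^sub>R norm x) -` U \<inter> (-{0}))"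
  have oV: "open V" unfolding V_def
    using cs U(1) continuous_on_open_vimage[of "- {0::cc}" "\<lambda>x. x /\<^sub>R norm x"]
    by (intro open_Int[OF open_ball]) auto
  have "x /\<^sub>R 2 \<in> V"
  proof -
    have n: "norm x = 1" "x \<noteq> 0" using x by (auto simp: SU2_norm)
    have "x \<in> U" using x U(2) fx by auto
    then show ?thesis using n by (simp add: V_def)
  qed
  then have "emeasure lborel V \<noteq> 0" 
  proof -
    assume "x /\<^sub>R 2 \<in> V"
    then obtain a b where ab: "x /\<^sub>R 2 \<in> box a b" "box a b \<subseteq> V"
      using oV open_contains_box by (metis subset_iff)
    then have "\<forall>i\<in>Basis. a \<bullet> i < b \<bullet> i" by (metis box_ne_empty(2) empty_iff)
    then have "emeasure lborel (box a b) > 0"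
      by (subst emeasure_lborel_box) (auto simp: inner_diff_left less_imp_le intro!: prod_pos)
    also have "\<dots> \<le> emeasure lborel V" using ab(2) oV by (intro emeasure_mono) auto
    finally show ?thesis by simp
  qed
  moreover have "emeasure haar (U \<inter> SU2) = 0"
  proof -
    have "AE y in haar. y \<notin> U \<inter> SU2" using AE U(2) by (auto elim!: eventually_mono)
    moreover have "U \<inter> SU2 \<in> sets haar" using U(1) by (auto simp: sets_haar sets_restrict_space)
    ultimately show ?thesis using AE_iff_measurable[of "U \<inter> SU2" haar "\<lambda>y. y \<notin> U \<inter> SU2"] by auto
  qed
  moreover have "emeasure haar (U \<inter> SU2) = emeasure lborel (ball 0 1 \<inter> sphere_proj -` (U \<inter> SU2)) / emeasure lborel (ball 0 1 :: cc set)"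
  proof -
    have US: "U \<inter> SU2 \<in> sets (restrict_space borel SU2)" using U(1) by (auto simp: sets_restrict_space)
    have pm: "sphere_proj -` (U \<inter> SU2) \<in> sets borel"
      using measurable_sets[OF sphere_proj_measurable US] by simp
    show ?thesis unfolding haar_eq cone_measure_def
      using US pm by (subst emeasure_distr[OF sphere_proj_measurable US]) (simp add: ball_measure_def)
  qed
  moreover have "emeasure lborel V \<le> emeasure lborel (ball 0 1 \<inter> sphere_proj -` (U \<inter> SU2))"
  proof (rule emeasure_mono)
    show "V \<subseteq> ball 0 1 \<inter> sphere_proj -` (U \<inter> SU2)"
    proof
      fix x assume "x \<in> V"
      then show "x \<in> ball 0 1 \<inter> sphere_proj -` (U \<inter> SU2)"
        using sphere_proj_SU2[of x] by (simp add: V_def sphere_proj_def)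
    qed
    have US: "U \<inter> SU2 \<in> sets (restrict_space borel SU2)" using U(1) by (auto simp: sets_restrict_space)
    then have "sphere_proj -` (U \<inter> SU2) \<in> sets borel"
      using measurable_sets[OF sphere_proj_measurable US] by simp
    then show "ball 0 1 \<inter> sphere_proj -` (U \<inter> SU2) \<in> sets lborel" by auto
  qed
  ultimately show False
    using emeasure_unit_ball by (auto simp: ennreal_divide_eq_0_iff)
qed

section \<open>Labelled tensors and their operator norms\<close>

text \<open>Partial contraction. Labellings remain total functions on all edges, so tensors of every
  shape have one type and sums over disjoint edge sets can be nested by
  \<open>sumE_Un\<close>.\<close>

definition sumE :: "nat \<Rightarrow> nat set \<Rightarrow> ((nat \<Rightarrow> nat) \<Rightarrow> 'a::comm_monoid_add) \<Rightarrow> (nat \<Rightarrow> nat) \<Rightarrow> 'a" where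
  "sumE m A f l = (\<Sum>p\<in>PiE A (\<lambda>_. {..<m}). f (override_on l p A))"

text \<open>Records which legs a tensor lacks; a factor lacking the summed legs can be pulled out of
  the sum.\<close>

definition indep :: "((nat \<Rightarrow> nat) \<Rightarrow> 'a) \<Rightarrow> nat set \<Rightarrow> bool" where
  "indep f A \<longleftrightarrow> (\<forall>l l'. (\<forall>x. x \<notin> A \<longrightarrow> l x = l' x) \<longrightarrow> f l = f l')"

lemma indepD: "indep f A \<Longrightarrow> (\<And>x. x \<notin> A \<Longrightarrow> l x = l' x) \<Longrightarrow> f l = f l'"
  unfolding indep_def by blast

lemma indep_mono: "indep f A \<Longrightarrow> B \<subseteq> A \<Longrightarrow> indep f B"
  unfolding indep_def by blast

lemma indep_Un: 
  assumes "indep f A" "indep f B" shows "indep f (A \<union> B)"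
  unfolding indep_def
proof (intro allI impI)
  fix l l' :: "nat \<Rightarrow> nat" assume *: "\<forall>x. x \<notin> A \<union> B \<longrightarrow> l x = l' x"
  have "f l = f (override_on l l' A)" using assms(1) by (rule indepD) (auto simp: override_on_def)
  also have "\<dots> = f l'" using assms(2) by (rule indepD) (use * in \<open>auto simp: override_on_def\<close>)
  finally show "f l = f l'" .
qed

lemma indep_fun2: "indep f A \<Longrightarrow> indep g A \<Longrightarrow> indep (\<lambda>l. h (f l) (g l)) A"
  unfolding indep_def by metis

lemma indep_fun1: "indep f A \<Longrightarrow> indep (\<lambda>l. h (f l)) A"
  unfolding indep_def by metis

lemma sumE_empty[simp]: "sumE m {} f = f"
  by (rule ext) (simp add: sumE_def override_on_def)

lemma sumE_insert:
  assumes "a \<notin> A"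
  shows "sumE m (insert a A) f l = (\<Sum>k<m. sumE m A f (l(a := k)))"
proof -
  have "sumE m (insert a A) f l = (\<Sum>z\<in>{..<m} \<times> PiE A (\<lambda>_. {..<m}). f (override_on l ((snd z)(a := fst z)) (insert a A)))"
    unfolding sumE_def PiE_insert_eq
    using inj_combinator[OF assms, of "\<lambda>_. {..<m}"] by (subst sum.reindex) (simp_all add: split_def)
  also have "\<dots> = (\<Sum>z\<in>{..<m} \<times> PiE A (\<lambda>_. {..<m}). f (override_on (l(a := fst z)) (snd z) A))"
    by (intro sum.cong refl arg_cong[where f = f]) (use assms in \<open>auto simp: override_on_def fun_eq_iff\<close>)
  also have "\<dots> = (\<Sum>k<m. sumE m A f (l(a := k)))"
    by (simp add: sumE_def sum.cartesian_product split_def)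
  finally show ?thesis .
qed

lemma sumE_Un:
  assumes "finite A" "A \<inter> B = {}"
  shows "sumE m (A \<union> B) f l = sumE m A (sumE m B f) l"
  using assms
proof (induction A arbitrary: l)
  case (insert a A)
  then show ?case by (simp add: sumE_insert)
qed simp

lemma sumE_cong:
  assumes "\<And>l'. (\<And>x. x \<notin> A \<Longrightarrow> l' x = l x) \<Longrightarrow> f l' = g l'"
  shows "sumE m A f l = sumE m A g l"
  unfolding sumE_def by (intro sum.cong refl assms) (auto simp: override_on_def)

lemma sumE_mult_left:
  fixes f :: "(nat \<Rightarrow> nat) \<Rightarrow> 'a::semiring_0"
  assumes "indep c A"
  shows "sumE m A (\<lambda>l. c l * f l) l = c l * sumE m A f l"
proof -
  have "c (override_on l p A) = c l" for p using assms by (rule indepD) auto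
  then show ?thesis by (simp add: sumE_def sum_distrib_left)
qed

lemma sumE_cmult:
  fixes f :: "(nat \<Rightarrow> nat) \<Rightarrow> 'a::semiring_0"
  shows "sumE m A (\<lambda>l. c * f l) l = c * sumE m A f l"
  by (simp add: sumE_def sum_distrib_left)

lemma indep_sumE_self: "indep (sumE m A f) A"
  unfolding indep_def
proof (intro allI impI)
  fix l l' :: "nat \<Rightarrow> nat" assume *: "\<forall>x. x \<notin> A \<longrightarrow> l x = l' x"
  have "override_on l p A = override_on l' p A" for p using * by (auto simp: override_on_def)
  then show "sumE m A f l = sumE m A f l'" by (simp add: sumE_def)
qed

lemma indep_sumE: 
  assumes "indep f B" shows "indep (sumE m A f) B"
  unfolding indep_def
proof (intro allI impI)
  fix l l' :: "nat \<Rightarrow> nat" assume *: "\<forall>x. x \<notin> B \<longrightarrow> l x = l' x"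
  have "f (override_on l p A) = f (override_on l' p A)" for p 
    using assms by (rule indepD) (use * in \<open>auto simp: override_on_def\<close>)
  then show "sumE m A f l = sumE m A f l'" by (simp add: sumE_def)
qed

lemma sumE_mono:
  fixes f :: "(nat \<Rightarrow> nat) \<Rightarrow> real"
  assumes "\<And>l. f l \<le> g l" shows "sumE m A f l \<le> sumE m A g l"
  unfolding sumE_def by (intro sum_mono assms)

lemma sumE_nonneg:
  fixes f :: "(nat \<Rightarrow> nat) \<Rightarrow> real"
  assumes "\<And>l. 0 \<le> f l" shows "0 \<le> sumE m A f l"
  unfolding sumE_def by (intro sum_nonneg assms)

lemma of_real_sumE: "of_real (sumE m A f l) = sumE m A (\<lambda>l. of_real (f l)) l"
  by (simp add: sumE_def)

text \<open>A tensor is a function of a labelling of all edges. Labels outside \<open>A \<union> B\<close> are parameters: the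
  vector \<open>F\<close> may depend on them, but not on the output labels \<open>B\<close>.\<close>

definition op_bound :: "nat \<Rightarrow> nat set \<Rightarrow> nat set \<Rightarrow> ((nat \<Rightarrow> nat) \<Rightarrow> complex) \<Rightarrow> real \<Rightarrow> bool" where
  "op_bound m A B t c \<longleftrightarrow> (\<forall>F l. indep F B \<longrightarrow>
     sumE m B (\<lambda>l. (cmod (sumE m A (\<lambda>l. F l * t l) l))\<^sup>2) l \<le> c\<^sup>2 * sumE m A (\<lambda>l. (cmod (F l))\<^sup>2) l)"

text \<open>First \<open>t\<close> acts with the inputs \<open>I2\<close> as spectators, then
  \<open>t'\<close> acts with the outputs \<open>O1\<close> as spectators; \<open>J\<close> consists
  of the edges joining them. Spectators cost nothing because the vector in \<open>op_bound\<close>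
  may depend on further labels as parameters.\<close>

lemma op_bound_compose:
  assumes fin: "finite A" "finite J" "finite O1" "finite I2" "finite B"
    and dis: "A \<inter> J = {}" "A \<inter> O1 = {}" "A \<inter> I2 = {}" "A \<inter> B = {}" "J \<inter> O1 = {}" "J \<inter> I2 = {}" "J \<inter> B = {}"
       "O1 \<inter> I2 = {}" "O1 \<inter> B = {}" "I2 \<inter> B = {}"
    and t: "op_bound m A (J \<union> O1) t c" and t': "op_bound m (J \<union> I2) B t' c'"
    and it: "indep t (I2 \<union> B)" and it': "indep t' (A \<union> O1)"
  shows "op_bound m (A \<union> I2) (O1 \<union> B) (sumE m J (\<lambda>l. t l * t' l)) (c * c')"
  unfolding op_bound_def
proof (intro allI impI)
  fix F :: "(nat \<Rightarrow> nat) \<Rightarrow> complex" and l0 :: "nat \<Rightarrow> nat"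
  assume "indep F (O1 \<union> B)"
  have J: "x \<notin> A \<union> I2" "x \<notin> O1 \<union> B" if "x \<in> J" for x using dis that by auto
  \<comment> \<open>The vector may depend on the outer values of the labels \<open>J\<close>, which
    would clash with the summation over \<open>J\<close> inside. Freezing these labels at
    \<open>l0\<close> changes nothing at the labellings that agree with \<open>l0\<close> on
    \<open>J\<close>.\<close>
  define F' where "F' = (\<lambda>l. F (override_on l l0 J))"
  have iF': "indep F' (O1 \<union> B)" unfolding F'_def indep_def
    by (intro allI impI indepD[OF \<open>indep F (O1 \<union> B)\<close>]) (auto simp: override_on_def)
  have iFJ: "indep F' J" unfolding F'_def indep_def
    by (intro allI impI arg_cong[where f = F]) (auto simp: override_on_def fun_eq_iff)
  have F'eq: "F l = F' l" if "\<And>x. x \<in> J \<Longrightarrow> l x = l0 x" for l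
    unfolding F'_def by (intro arg_cong[where f = F] ext) (use that in \<open>simp add: override_on_def\<close>)
  define G where "G = sumE m A (\<lambda>l. F' l * t l)"
  have iG: "indep G B"
    unfolding G_def by (rule indep_sumE, rule indep_fun2) (rule indep_mono[OF iF'] indep_mono[OF it], blast)+
  have inner: "sumE m (A \<union> I2) (\<lambda>l. F l * sumE m J (\<lambda>l. t l * t' l) l) l = sumE m (J \<union> I2) (\<lambda>l. G l * t' l) l"
    if l: "\<And>x. x \<in> J \<Longrightarrow> l x = l0 x" for l
  proof -
    have "sumE m (A \<union> I2) (\<lambda>l. F l * sumE m J (\<lambda>l. t l * t' l) l) l
        = sumE m (A \<union> I2) (sumE m J (\<lambda>l. F' l * (t l * t' l))) l"
    proof (rule sumE_cong)
      fix l' assume *: "\<And>x. x \<notin> A \<union> I2 \<Longrightarrow> l' x = l x"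
      have "F l' = F' l'" by (intro F'eq) (simp add: *[OF J(1)] l)
      then show "F l' * sumE m J (\<lambda>l. t l * t' l) l' = sumE m J (\<lambda>l. F' l * (t l * t' l)) l'"
        by (simp add: sumE_mult_left[OF iFJ])
    qed
    also have "\<dots> = sumE m ((J \<union> I2) \<union> A) (\<lambda>l. F' l * (t l * t' l)) l"
      by (subst sumE_Un[symmetric]) (use fin dis in \<open>auto simp: Un_ac\<close>)
    also have "\<dots> = sumE m (J \<union> I2) (sumE m A (\<lambda>l. t' l * (F' l * t l))) l"
      by (subst sumE_Un) (use fin dis in \<open>auto simp: mult_ac\<close>)
    also have "sumE m A (\<lambda>l. t' l * (F' l * t l)) = (\<lambda>l. G l * t' l)"
    proof
      fix l have "indep t' A" by (rule indep_mono[OF it']) simp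
      then show "sumE m A (\<lambda>l. t' l * (F' l * t l)) l = G l * t' l"
        by (simp add: sumE_mult_left G_def mult.commute)
    qed
    finally show ?thesis .
  qed
  have "sumE m (O1 \<union> B) (\<lambda>l. (cmod (sumE m (A \<union> I2) (\<lambda>l. F l * sumE m J (\<lambda>l. t l * t' l) l) l))\<^sup>2) l0
     = sumE m (O1 \<union> B) (\<lambda>l. (cmod (sumE m (J \<union> I2) (\<lambda>l. G l * t' l) l))\<^sup>2) l0"
    by (intro sumE_cong) (subst inner, use J(2) in auto)
  also have "\<dots> = sumE m O1 (sumE m B (\<lambda>l. (cmod (sumE m (J \<union> I2) (\<lambda>l. G l * t' l) l))\<^sup>2)) l0"
    by (rule sumE_Un) (use fin dis in auto)
  also have "\<dots> \<le> sumE m O1 (\<lambda>l. c'\<^sup>2 * sumE m (J \<union> I2) (\<lambda>l. (cmod (G l))\<^sup>2) l) l0"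
    by (intro sumE_mono) (use t' iG in \<open>auto simp: op_bound_def\<close>)
  also have "\<dots> = c'\<^sup>2 * sumE m (I2 \<union> (J \<union> O1)) (\<lambda>l. (cmod (G l))\<^sup>2) l0"
    unfolding sumE_cmult by (subst sumE_Un[symmetric]) (use fin dis in \<open>auto simp: Un_ac\<close>)
  also have "\<dots> = c'\<^sup>2 * sumE m I2 (sumE m (J \<union> O1) (\<lambda>l. (cmod (G l))\<^sup>2)) l0"
    by (subst sumE_Un) (use fin dis in auto)
  also have "\<dots> \<le> c'\<^sup>2 * sumE m I2 (\<lambda>l. c\<^sup>2 * sumE m A (\<lambda>l. (cmod (F' l))\<^sup>2) l) l0"
  proof (intro mult_left_mono sumE_mono)
    fix l
    have "indep F' (J \<union> O1)" by (intro indep_Un iFJ indep_mono[OF iF']) auto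
    then show "sumE m (J \<union> O1) (\<lambda>l. (cmod (G l))\<^sup>2) l \<le> c\<^sup>2 * sumE m A (\<lambda>l. (cmod (F' l))\<^sup>2) l"
      using t unfolding op_bound_def G_def by blast
  qed simp
  also have "\<dots> = (c * c')\<^sup>2 * sumE m (A \<union> I2) (\<lambda>l. (cmod (F' l))\<^sup>2) l0"
    unfolding sumE_cmult using fin dis sumE_Un[of I2 A m "\<lambda>l. (cmod (F' l))\<^sup>2" l0]
    by (simp add: power_mult_distrib Un_commute Int_commute)
  also have "sumE m (A \<union> I2) (\<lambda>l. (cmod (F' l))\<^sup>2) l0 = sumE m (A \<union> I2) (\<lambda>l. (cmod (F l))\<^sup>2) l0"
    by (intro sumE_cong arg_cong[where f = "\<lambda>z. (cmod z)\<^sup>2"] F'eq[symmetric]) (use J(1) in auto)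
  finally show "sumE m (O1 \<union> B) (\<lambda>l. (cmod (sumE m (A \<union> I2) (\<lambda>l. F l * sumE m J (\<lambda>l. t l * t' l) l) l))\<^sup>2) l0
     \<le> (c * c')\<^sup>2 * sumE m (A \<union> I2) (\<lambda>l. (cmod (F l))\<^sup>2) l0" .
qed

text \<open>The closing step of a duality argument, in which a squared norm has been estimated by
  its own square root.\<close>

lemma square_le_of_le_sqrt:
  fixes S c n :: real
  assumes "S \<le> c * sqrt n * sqrt S" "0 \<le> S" "0 \<le> n" "0 \<le> c"
  shows "S \<le> c\<^sup>2 * n"
proof (cases "S = 0")
  case False
  then have "sqrt S > 0" using assms by simp
  moreover have "sqrt S * sqrt S \<le> c * sqrt n * sqrt S" using assms by simp
  ultimately have "sqrt S \<le> c * sqrt n" by (simp only: mult_le_cancel_right)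
  then have "(sqrt S)\<^sup>2 \<le> (c * sqrt n)\<^sup>2" using assms by (intro power_mono) auto
  then show ?thesis using assms by (simp add: power_mult_distrib)
qed (use assms in auto)

text \<open>Duality: the bilinear form is tested against the conjugate of the output
  \<open>Y\<close> itself. The left side is then the squared norm of \<open>Y\<close>, of which one
  square root cancels.\<close>

lemma op_bound_bilinearI:
  assumes "0 \<le> c" "finite A" "finite B" "A \<inter> B = {}"
    and bil: "\<And>F H l. indep F B \<Longrightarrow> indep H A \<Longrightarrow> 
      cmod (sumE m (B \<union> A) (\<lambda>l. H l * (F l * t l)) l) \<le> c * sqrt (sumE m A (\<lambda>l. (cmod (F l))\<^sup>2) l) * sqrt (sumE m B (\<lambda>l. (cmod (H l))\<^sup>2) l)"
  shows "op_bound m A B t c"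
  unfolding op_bound_def
proof (intro allI impI)
  fix F :: "(nat \<Rightarrow> nat) \<Rightarrow> complex" and l assume F: "indep F B"
  define Y where "Y = sumE m A (\<lambda>l. F l * t l)"
  have iY: "indep (\<lambda>l. cnj (Y l)) A" unfolding Y_def by (rule indep_fun1, rule indep_sumE_self)
  let ?S = "sumE m B (\<lambda>l. (cmod (Y l))\<^sup>2) l"
  have S0: "0 \<le> ?S" by (intro sumE_nonneg) simp
  have "complex_of_real ?S = sumE m B (\<lambda>l. cnj (Y l) * Y l) l"
    unfolding of_real_sumE by (intro sumE_cong) (simp add: complex_norm_square[symmetric] mult.commute)
  also have "\<dots> = sumE m (B \<union> A) (\<lambda>l. cnj (Y l) * (F l * t l)) l"
    by (subst sumE_Un) (use assms in \<open>auto intro!: sumE_cong simp: sumE_mult_left[OF iY], simp add: Y_def\<close>)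
  finally have "?S = cmod (sumE m (B \<union> A) (\<lambda>l. cnj (Y l) * (F l * t l)) l)"
    using S0 by (metis norm_of_real abs_of_nonneg)
  also have "\<dots> \<le> c * sqrt (sumE m A (\<lambda>l. (cmod (F l))\<^sup>2) l) * sqrt (sumE m B (\<lambda>l. (cmod (cnj (Y l)))\<^sup>2) l)"
    by (rule bil[OF F iY])
  finally have "?S \<le> c * sqrt (sumE m A (\<lambda>l. (cmod (F l))\<^sup>2) l) * sqrt ?S" by simp
  then have "?S \<le> c\<^sup>2 * sumE m A (\<lambda>l. (cmod (F l))\<^sup>2) l"
    by (rule square_le_of_le_sqrt) (use S0 assms in \<open>auto intro: sumE_nonneg\<close>)
  then show "sumE m B (\<lambda>l. (cmod (sumE m A (\<lambda>l. F l * t l) l))\<^sup>2) l \<le> c\<^sup>2 * sumE m A (\<lambda>l. (cmod (F l))\<^sup>2) l"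
    by (simp add: Y_def)
qed

lemma sumE_single: "sumE m {a} f l = (\<Sum>k<m. f (l(a := k)))"
  by (simp add: sumE_insert)

text \<open>Operator norm of a tensor with two legs, written as a bilinear bound without conjugates.
  In this form it is symmetric under transposition and can be applied pointwise under an
  integral.\<close>

definition mat_bound :: "nat \<Rightarrow> (nat \<Rightarrow> nat \<Rightarrow> complex) \<Rightarrow> real \<Rightarrow> bool" where
  "mat_bound m M c \<longleftrightarrow> (\<forall>r s. cmod (\<Sum>k<m. \<Sum>j<m. M k j * r k * s j) \<le>
      c * sqrt (\<Sum>k<m. (cmod (r k))\<^sup>2) * sqrt (\<Sum>j<m. (cmod (s j))\<^sup>2))"

lemma norm_sum_mult_le_sqrt:
  fixes f g :: "'a \<Rightarrow> complex"
  shows "cmod (\<Sum>i\<in>A. f i * g i) \<le> sqrt (\<Sum>i\<in>A. (cmod (f i))\<^sup>2) * sqrt (\<Sum>i\<in>A. (cmod (g i))\<^sup>2)"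
proof -
  have "cmod (\<Sum>i\<in>A. f i * g i) \<le> (\<Sum>i\<in>A. \<bar>cmod (f i)\<bar> * \<bar>cmod (g i)\<bar>)"
    by (rule order_trans[OF norm_sum]) (simp add: norm_mult)
  also have "\<dots> \<le> L2_set (\<lambda>i. cmod (f i)) A * L2_set (\<lambda>i. cmod (g i)) A"
    by (rule L2_set_mult_ineq)
  finally show ?thesis by (simp add: L2_set_def)
qed

lemma op_bound_imp_mat_bound:
  assumes "op_bound m {a} {b} t c" "a \<noteq> b" "0 \<le> c"
  shows "mat_bound m (\<lambda>k j. t (l(a := k, b := j))) c"
  unfolding mat_bound_def
proof (intro allI)
  fix r s :: "nat \<Rightarrow> complex"
  define Y where "Y j = (\<Sum>k<m. r k * t (l(a := k, b := j)))" for j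
  have "indep (\<lambda>l. r (l a)) {b}" using assms(2) by (auto simp: indep_def)
  with assms(1) have "sumE m {b} (\<lambda>l. (cmod (sumE m {a} (\<lambda>l. r (l a) * t l) l))\<^sup>2) l
     \<le> c\<^sup>2 * sumE m {a} (\<lambda>l. (cmod (r (l a)))\<^sup>2) l" unfolding op_bound_def by blast
  then have Y: "(\<Sum>j<m. (cmod (Y j))\<^sup>2) \<le> c\<^sup>2 * (\<Sum>k<m. (cmod (r k))\<^sup>2)"
    using assms(2) by (simp add: sumE_single Y_def fun_upd_twist)
  have "(\<Sum>k<m. \<Sum>j<m. t (l(a := k, b := j)) * r k * s j) = (\<Sum>j<m. Y j * s j)"
    unfolding Y_def sum_distrib_right by (subst sum.swap) (simp add: mult_ac)
  also have "cmod \<dots> \<le> sqrt (\<Sum>j<m. (cmod (Y j))\<^sup>2) * sqrt (\<Sum>j<m. (cmod (s j))\<^sup>2)"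
    by (rule norm_sum_mult_le_sqrt)
  also have "\<dots> \<le> (c * sqrt (\<Sum>k<m. (cmod (r k))\<^sup>2)) * sqrt (\<Sum>j<m. (cmod (s j))\<^sup>2)"
    using real_sqrt_le_mono[OF Y] assms(3)
    by (intro mult_right_mono) (auto simp: real_sqrt_mult sum_nonneg)
  finally show "cmod (\<Sum>k<m. \<Sum>j<m. t (l(a := k, b := j)) * r k * s j)
     \<le> c * sqrt (\<Sum>k<m. (cmod (r k))\<^sup>2) * sqrt (\<Sum>j<m. (cmod (s j))\<^sup>2)" .
qed

lemma mat_bound_diag: "mat_bound m (\<lambda>k j. if k = j then 1 else 0) 1"
  unfolding mat_bound_def
proof (intro allI)
  fix r s :: "nat \<Rightarrow> complex"
  have "(if k = j then 1 else 0) * r k * s j = (if k = j then r k * s j else 0)" for k j by simp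
  then have "(\<Sum>k<m. \<Sum>j<m. (if k = j then 1 else 0) * r k * s j) = (\<Sum>k<m. r k * s k)"
    by simp
  then show "cmod (\<Sum>k<m. \<Sum>j<m. (if k = j then 1 else 0) * r k * s j)
     \<le> 1 * sqrt (\<Sum>k<m. (cmod (r k))\<^sup>2) * sqrt (\<Sum>j<m. (cmod (s j))\<^sup>2)"
    using norm_sum_mult_le_sqrt[of r s "{..<m}"] by simp
qed

text \<open>Testing with unit vectors bounds each diagonal entry by the operator norm, so a trace
  costs the dimension \<open>m\<close>.\<close>

lemma op_bound_trace_bound:
  assumes "op_bound m {a} {b} t c" "a \<noteq> b" "0 \<le> c"
  shows "cmod (\<Sum>k<m. t (l(a := k, b := k))) \<le> m * c"
proof -
  have 1: "cmod (t (l(a := k, b := k))) \<le> c" if "k < m" for k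
  proof -
    have "t (l(a := k', b := j)) * (if k' = k then 1 else 0) * (if j = k then 1 else 0)
       = (if j = k then if k' = k then t (l(a := k', b := j)) else 0 else 0)" for k' j by simp
    then have "(\<Sum>k'<m. \<Sum>j<m. t (l(a := k', b := j)) * (if k' = k then 1 else 0) * (if j = k then 1 else 0)) = t (l(a := k, b := k))"
      using that by simp
    moreover have "(cmod (if k' = k then 1 else 0))\<^sup>2 = (if k' = k then 1 else 0)" for k' by simp
    then have "(\<Sum>k'<m. (cmod (if k' = k then 1 else 0))\<^sup>2) = 1"
      using that by simp
    ultimately show ?thesis
      using op_bound_imp_mat_bound[OF assms, of l, unfolded mat_bound_def, rule_format, of "\<lambda>k'. if k' = k then 1 else 0" "\<lambda>k'. if k' = k then 1 else 0"] by simp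
  qed
  have "cmod (\<Sum>k<m. t (l(a := k, b := k))) \<le> (\<Sum>k<m. cmod (t (l(a := k, b := k))))" by (rule norm_sum)
  also have "\<dots> \<le> (\<Sum>k<m. c)" using 1 by (intro sum_mono) auto
  finally show ?thesis by simp
qed

text \<open>\<open>\<Phi>\<close> overlays an edge labelling \<open>l\<close> with a leg labelling
  \<open>p\<close>, read along the injection \<open>h\<close>. It converts a sum over edges into a
  sum over legs.\<close>

lemma sumE_transport:
  assumes "inj_on h U" "A \<subseteq> U" "finite A"
  defines "\<Phi> \<equiv> \<lambda>l p e. if e \<in> h ` U then p (inv_into U h e) else l e"
  shows "sumE m (h ` A) f (\<Phi> l p) = sumE m A (\<lambda>p. f (\<Phi> l p)) p"
  using assms(3,2)
proof (induction A arbitrary: p)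
  case (insert a A)
  then have "a \<in> U" "A \<subseteq> U" by auto
  have "(\<Phi> l p)(h a := k) = \<Phi> l (p(a := k))" for k
    using assms(1) \<open>a \<in> U\<close> by (auto simp: \<Phi>_def fun_eq_iff inv_into_into inv_into_f_f f_inv_into_f)
  moreover have "h a \<notin> h ` A" using assms(1) \<open>a \<in> U\<close> \<open>A \<subseteq> U\<close> insert(2) by (auto simp: inj_on_def)
  ultimately show ?case using insert \<open>A \<subseteq> U\<close> by (simp add: sumE_insert)
qed simp

text \<open>Vertex tensors live on the legs 0 to 3, networks on edges. Naming legs by edges keeps
  the norm as long as distinct legs get distinct edges, that is, in the absence of
  self-loops.\<close>

lemma op_bound_transport:
  assumes inj: "inj_on h (A \<union> B)" and fin: "finite A" "finite B"
    and t: "op_bound m A B t c" and it: "indep t (- (A \<union> B))"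
  shows "op_bound m (h ` A) (h ` B) (\<lambda>l. t (\<lambda>x. l (h x))) c"
  unfolding op_bound_def
proof (intro allI impI)
  fix F :: "(nat \<Rightarrow> nat) \<Rightarrow> complex" and l assume F: "indep F (h ` B)"
  define \<Phi> where "\<Phi> = (\<lambda>l p e. if e \<in> h ` (A \<union> B) then p (inv_into (A \<union> B) h e) else l e :: nat)"
  have l: "l = \<Phi> l (\<lambda>x. l (h x))"
    by (rule ext) (simp add: \<Phi>_def f_inv_into_f)
  have A: "sumE m (h ` A) f (\<Phi> l p) = sumE m A (\<lambda>p. f (\<Phi> l p)) p" for f :: "(nat \<Rightarrow> nat) \<Rightarrow> 'b::comm_monoid_add" and p
    unfolding \<Phi>_def by (rule sumE_transport[OF inj]) (use fin in auto)
  have B: "sumE m (h ` B) f (\<Phi> l p) = sumE m B (\<lambda>p. f (\<Phi> l p)) p" for f :: "(nat \<Rightarrow> nat) \<Rightarrow> 'b::comm_monoid_add" and p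
    unfolding \<Phi>_def by (rule sumE_transport[OF inj]) (use fin in auto)
  have t': "t (\<lambda>x. \<Phi> l p (h x)) = t p" for p
    by (rule indepD[OF it]) (use inj in \<open>simp add: \<Phi>_def\<close>)
  have iF: "indep (\<lambda>p. F (\<Phi> l p)) B"
    unfolding indep_def
  proof (intro allI impI, rule indepD[OF F])
    fix p p' :: "nat \<Rightarrow> nat" and e assume p: "\<forall>x. x \<notin> B \<longrightarrow> p x = p' x" and e: "e \<notin> h ` B"
    show "\<Phi> l p e = \<Phi> l p' e"
    proof (cases "e \<in> h ` (A \<union> B)")
      case True
      then have "inv_into (A \<union> B) h e \<notin> B" using e by (metis f_inv_into_f image_eqI)
      then show ?thesis using p by (simp add: \<Phi>_def)
    next
      case False
      then show ?thesis by (simp add: \<Phi>_def)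
    qed
  qed
  have "sumE m B (\<lambda>p. (cmod (sumE m A (\<lambda>p. F (\<Phi> l p) * t p) p))\<^sup>2) (\<lambda>x. l (h x))
     \<le> c\<^sup>2 * sumE m A (\<lambda>p. (cmod (F (\<Phi> l p)))\<^sup>2) (\<lambda>x. l (h x))"
    using t iF unfolding op_bound_def by blast
  then show "sumE m (h ` B) (\<lambda>l. (cmod (sumE m (h ` A) (\<lambda>l. F l * t (\<lambda>x. l (h x))) l))\<^sup>2) l
     \<le> c\<^sup>2 * sumE m (h ` A) (\<lambda>l. (cmod (F l))\<^sup>2) l"
    by (subst (1 2) l) (simp add: A B t')
qed

section \<open>Tensor networks\<close>

text \<open>Connection to the edges \<open>X\<close> along paths that stay inside \<open>V\<close>.
  The vertex set is an argument, so deleting a vertex of the graph is a change of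
  \<open>V\<close>.\<close>

inductive_set reach :: "(nat \<Rightarrow> nat \<Rightarrow> nat) \<Rightarrow> nat set \<Rightarrow> nat set \<Rightarrow> nat set" for \<eta> V X where
  base: "v \<in> V \<Longrightarrow> a < 4 \<Longrightarrow> \<eta> v a \<in> X \<Longrightarrow> v \<in> reach \<eta> V X"
| step: "v \<in> reach \<eta> V X \<Longrightarrow> w \<in> V \<Longrightarrow> a < 4 \<Longrightarrow> b < 4 \<Longrightarrow> \<eta> v a = \<eta> w b \<Longrightarrow> w \<in> reach \<eta> V X"

lemma reach_subset: "v \<in> reach \<eta> V X \<Longrightarrow> v \<in> V"
  by (induction rule: reach.induct) auto

lemma reach_sub: "reach \<eta> V X \<subseteq> V"
  using reach_subset by auto

lemma reach_ex: "v \<in> reach \<eta> V X \<Longrightarrow> \<exists>u\<in>V. \<exists>a<4. \<eta> u a \<in> X"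
  by (induction rule: reach.induct) auto

text \<open>Collects what the network argument uses of the vertices. \<open>\<tau>_contract\<close>
  is a separate hypothesis from \<open>\<tau>_split\<close>: counting the matrix \<open>M\<close> as
  part of an input vector would bring in its Hilbert-Schmidt norm in place of
  \<open>C\<close>.\<close>

locale tensor_net =
  fixes m :: nat and V0 :: "nat set" and \<eta> :: "nat \<Rightarrow> nat \<Rightarrow> nat" and \<tau> :: "nat \<Rightarrow> (nat \<Rightarrow> nat) \<Rightarrow> complex" and D :: real
  assumes finV0: "finite V0" and D0: "0 \<le> D"
    and deg_le: "card {s \<in> V0 \<times> {..<4}. \<eta> (fst s) (snd s) = e} \<le> 2"
    and \<tau>_indep: "v \<in> V0 \<Longrightarrow> indep (\<tau> v) (- {..<4})"
    and \<tau>_split: "v \<in> V0 \<Longrightarrow> A \<subseteq> {..<4} \<Longrightarrow> A \<noteq> {} \<Longrightarrow> A \<noteq> {..<4} \<Longrightarrow> op_bound m A ({..<4} - A) (\<tau> v) D"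
    and \<tau>_contract: "v \<in> V0 \<Longrightarrow> {a, b, c, d} = {..<4} \<Longrightarrow> mat_bound m M C \<Longrightarrow> 0 \<le> C \<Longrightarrow>
        op_bound m {a} {b} (\<lambda>p. \<Sum>k<m. \<Sum>j<m. M k j * \<tau> v (p(c := k, d := j))) (D * C)"
begin

section \<open>Edge degrees, open legs and partial networks\<close>

definition hits :: "nat set \<Rightarrow> nat \<Rightarrow> (nat \<times> nat) set" where
  "hits V e = {s \<in> V \<times> {..<4}. \<eta> (fst s) (snd s) = e}"

definition deg :: "nat set \<Rightarrow> nat \<Rightarrow> nat" where "deg V e = card (hits V e)"

definition outer :: "nat set \<Rightarrow> nat set" where "outer V = {e. deg V e = 1}"
definition inner :: "nat set \<Rightarrow> nat set" where "inner V = {e. deg V e = 2}"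

definition T :: "nat \<Rightarrow> (nat \<Rightarrow> nat) \<Rightarrow> complex" where "T v l = \<tau> v (\<lambda>x. l (\<eta> v x))"

definition net_tensor :: "nat set \<Rightarrow> (nat \<Rightarrow> nat) \<Rightarrow> complex" where
  "net_tensor V = sumE m (inner V) (\<lambda>l. \<Prod>v\<in>V. T v l)"

definition net_bound :: "nat set \<Rightarrow> nat set \<Rightarrow> real \<Rightarrow> bool" where
  "net_bound V I c \<longleftrightarrow> op_bound m I (outer V - I) (net_tensor V) c"

lemma finV: "V \<subseteq> V0 \<Longrightarrow> finite V" using finV0 finite_subset by blast

lemma fin_hits: "V \<subseteq> V0 \<Longrightarrow> finite (hits V e)"
  unfolding hits_def using finV[of V] by auto

lemma hitsI: "v \<in> V \<Longrightarrow> a < 4 \<Longrightarrow> (v, a) \<in> hits V (\<eta> v a)"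
  by (simp add: hits_def)

lemma deg_le2: "V \<subseteq> V0 \<Longrightarrow> deg V e \<le> 2"
proof -
  assume "V \<subseteq> V0"
  then have "hits V e \<subseteq> hits V0 e" by (auto simp: hits_def)
  then have "deg V e \<le> deg V0 e" unfolding deg_def by (intro card_mono fin_hits) auto
  then show ?thesis using deg_le[of e] by (simp add: deg_def hits_def)
qed

lemma deg_pos: "V \<subseteq> V0 \<Longrightarrow> v \<in> V \<Longrightarrow> a < 4 \<Longrightarrow> deg V (\<eta> v a) \<ge> 1"
  unfolding deg_def using hitsI[of v V a] fin_hits[of V "\<eta> v a"] by (metis Suc_leI card_gt_0_iff empty_iff One_nat_def)

lemma deg_posD: "deg V e \<ge> 1 \<Longrightarrow> \<exists>v\<in>V. \<exists>a<4. \<eta> v a = e"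
proof -
  assume "deg V e \<ge> 1"
  then have "hits V e \<noteq> {}" by (auto simp: deg_def)
  then show ?thesis by (auto simp: hits_def)
qed

lemma deg_Un: 
  assumes "U \<union> V \<subseteq> V0" "U \<inter> V = {}" shows "deg (U \<union> V) e = deg U e + deg V e"
proof -
  have "hits (U \<union> V) e = hits U e \<union> hits V e" by (auto simp: hits_def)
  moreover have "hits U e \<inter> hits V e = {}" using assms by (auto simp: hits_def)
  ultimately show ?thesis unfolding deg_def using assms by (simp add: card_Un_disjoint fin_hits)
qed

lemma deg2_slots: "V \<subseteq> V0 \<Longrightarrow> v \<in> V \<Longrightarrow> w \<in> V \<Longrightarrow> a < 4 \<Longrightarrow> b < 4 \<Longrightarrow> (v, a) \<noteq> (w, b) \<Longrightarrow> \<eta> v a = \<eta> w b \<Longrightarrow> deg V (\<eta> v a) = 2"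
proof -
  assume *: "V \<subseteq> V0" "v \<in> V" "w \<in> V" "a < 4" "b < 4" "(v, a) \<noteq> (w, b)" "\<eta> v a = \<eta> w b"
  then have "{(v,a), (w,b)} \<subseteq> hits V (\<eta> v a)" by (auto simp: hits_def)
  then have "card {(v,a), (w,b)} \<le> deg V (\<eta> v a)" unfolding deg_def using * by (intro card_mono fin_hits) auto
  then show ?thesis using deg_le2[OF *(1), of "\<eta> v a"] *(6) by simp
qed

lemma fin_edges: "V \<subseteq> V0 \<Longrightarrow> finite {e. deg V e \<ge> 1}"
proof -
  assume "V \<subseteq> V0"
  then have "{e. deg V e \<ge> 1} \<subseteq> (\<lambda>s. \<eta> (fst s) (snd s)) ` (V \<times> {..<4})"
    by (force dest!: deg_posD)
  then show ?thesis using finV[OF \<open>V \<subseteq> V0\<close>] finite_subset by blast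
qed

lemma fin_ext: "V \<subseteq> V0 \<Longrightarrow> finite (outer V)" and fin_int: "V \<subseteq> V0 \<Longrightarrow> finite (inner V)"
  by (rule finite_subset[OF _ fin_edges[of V]]; force simp: outer_def inner_def)+

text \<open>Counting the four slots of every vertex by edges gives
  \<open>4 * card V = card (outer V) + 2 * card (inner V)\<close>.\<close>

lemma even_ext: 
  assumes "V \<subseteq> V0" shows "even (card (outer V))"
proof -
  let ?f = "\<lambda>s. \<eta> (fst s) (snd s)"
  have f: "finite (V \<times> {..<4::nat})" using finV[OF assms] by simp
  have "card (V \<times> {..<4::nat}) = (\<Sum>e\<in>?f ` (V \<times> {..<4}). deg V e)"
    using sum.image_gen[OF f, of "\<lambda>_. 1::nat" ?f] by (simp add: deg_def hits_def)
  also have "?f ` (V \<times> {..<4}) = outer V \<union> inner V"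
  proof safe
    fix v a assume "v \<in> V" "a < (4::nat)" "\<eta> (fst (v, a)) (snd (v, a)) \<notin> inner V"
    then show "\<eta> (fst (v, a)) (snd (v, a)) \<in> outer V"
      using deg_pos[OF assms, of v a] deg_le2[OF assms, of "\<eta> v a"] by (auto simp: outer_def inner_def)
  next
    fix e assume "e \<in> outer V"
    then have "deg V e \<ge> 1" by (simp add: outer_def)
    then show "e \<in> ?f ` (V \<times> {..<4})" by (force dest!: deg_posD)
  next
    fix e assume "e \<in> inner V"
    then have "deg V e \<ge> 1" by (simp add: inner_def)
    then show "e \<in> ?f ` (V \<times> {..<4})" by (force dest!: deg_posD)
  qed
  also have "(\<Sum>e\<in>outer V \<union> inner V. deg V e) = (\<Sum>e\<in>outer V. deg V e) + (\<Sum>e\<in>inner V. deg V e)"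
    by (rule sum.union_disjoint) (use fin_ext[OF assms] fin_int[OF assms] in \<open>auto simp: outer_def inner_def\<close>)
  also have "(\<Sum>e\<in>outer V. deg V e) = card (outer V)" by (simp add: outer_def)
  also have "(\<Sum>e\<in>inner V. deg V e) = 2 * card (inner V)" by (simp add: inner_def)
  finally have "4 * card V = card (outer V) + 2 * card (inner V)" by (simp add: card_cartesian_product)
  then have "card (outer V) = 2 * (2 * card V - card (inner V))" by simp
  then show ?thesis by simp
qed

lemma indep_T: "v \<in> V \<Longrightarrow> V \<subseteq> V0 \<Longrightarrow> indep (T v) {e. deg V e = 0}"
  unfolding indep_def T_def
proof (intro allI impI)
  fix l l' :: "nat \<Rightarrow> nat" assume v: "v \<in> V" "V \<subseteq> V0" and *: "\<forall>x. x \<notin> {e. deg V e = 0} \<longrightarrow> l x = l' x"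
  have "indep (\<tau> v) (- {..<4})" using v \<tau>_indep by auto
  then show "\<tau> v (\<lambda>x. l (\<eta> v x)) = \<tau> v (\<lambda>x. l' (\<eta> v x))"
  proof (rule indepD)
    fix x :: nat assume "x \<notin> - {..<4}"
    then show "l (\<eta> v x) = l' (\<eta> v x)" using * deg_pos[OF v(2) v(1), of x] by auto
  qed
qed

lemma indep_prodT: "V \<subseteq> V0 \<Longrightarrow> indep (\<lambda>l. \<Prod>v\<in>V. T v l) {e. deg V e = 0}"
  unfolding indep_def
proof (intro allI impI prod.cong refl)
  fix l l' :: "nat \<Rightarrow> nat" and v assume "V \<subseteq> V0" "\<forall>x. x \<notin> {e. deg V e = 0} \<longrightarrow> l x = l' x" "v \<in> V"
  then show "T v l = T v l'" using indep_T[of v V] by (auto simp: indep_def)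
qed

lemma indep_tens: "V \<subseteq> V0 \<Longrightarrow> indep (net_tensor V) (- outer V)"
proof -
  assume V: "V \<subseteq> V0"
  have "- outer V = {e. deg V e = 0} \<union> inner V"
    using deg_le2[OF V] by (auto simp: outer_def inner_def le_Suc_eq numeral_2_eq_2)
  moreover have "indep (net_tensor V) {e. deg V e = 0}"
    unfolding net_tensor_def by (rule indep_sumE[OF indep_prodT[OF V]])
  moreover have "indep (net_tensor V) (inner V)"
    unfolding net_tensor_def by (rule indep_sumE_self)
  ultimately show ?thesis by (simp add: indep_Un)
qed

lemma int_Un:
  assumes "U \<union> V \<subseteq> V0" "U \<inter> V = {}"
  shows "inner (U \<union> V) = (outer U \<inter> outer V) \<union> (inner U \<union> inner V)"
proof -
  have d: "deg (U \<union> V) e = deg U e + deg V e" "deg (U \<union> V) e \<le> 2" for e 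
    by (rule deg_Un[OF assms], rule deg_le2[OF assms(1)])
  have "e \<in> inner (U \<union> V) \<longleftrightarrow> e \<in> (outer U \<inter> outer V) \<union> (inner U \<union> inner V)" for e
    using d[of e] unfolding outer_def inner_def mem_Collect_eq Un_iff Int_iff by arith
  then show ?thesis by blast
qed

lemma ext_Un:
  assumes "U \<union> V \<subseteq> V0" "U \<inter> V = {}"
  shows "outer (U \<union> V) = (outer U - outer V) \<union> (outer V - outer U)"
proof -
  have d: "deg (U \<union> V) e = deg U e + deg V e" "deg (U \<union> V) e \<le> 2" for e 
    by (rule deg_Un[OF assms], rule deg_le2[OF assms(1)])
  have "e \<in> outer (U \<union> V) \<longleftrightarrow> e \<in> (outer U - outer V) \<union> (outer V - outer U)" for e
    using d[of e] unfolding outer_def mem_Collect_eq Un_iff Diff_iff by arith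
  then show ?thesis by blast
qed

text \<open>No label occurs more than twice, so an inner edge of one part cannot touch the other.
  Each factor can therefore be pulled out of the inner sum of the other, and only the shared edges
  remain to be summed.\<close>

lemma net_tensor_Un:
  assumes "U \<union> V \<subseteq> V0" "U \<inter> V = {}"
  shows "net_tensor (U \<union> V) = sumE m (outer U \<inter> outer V) (\<lambda>l. net_tensor U l * net_tensor V l)"
proof
  fix l
  have U: "U \<subseteq> V0" and V: "V \<subseteq> V0" using assms by auto
  have d: "deg (U \<union> V) e = deg U e + deg V e" "deg (U \<union> V) e \<le> 2" for e 
    by (rule deg_Un[OF assms], rule deg_le2[OF assms(1)])
  have dj: "inner U \<inter> inner V = {}" "(outer U \<inter> outer V) \<inter> (inner U \<union> inner V) = {}"
    using d by (auto simp: inner_def outer_def) (metis add_le_same_cancel1 le_zero_eq zero_neq_numeral)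
  have "deg V e = 0" if "e \<in> inner U" for e using d[of e] that by (simp add: inner_def)
  then have iV: "indep (\<lambda>l. \<Prod>v\<in>V. T v l) (inner U)" by (intro indep_mono[OF indep_prodT[OF V]]) auto
  have "deg U e = 0" if "e \<in> inner V" for e using d[of e] that by (simp add: inner_def)
  then have iU: "indep (\<lambda>l. \<Prod>v\<in>U. T v l) (inner V)" by (intro indep_mono[OF indep_prodT[OF U]]) auto
  have iV': "indep (net_tensor V) (inner U)" unfolding net_tensor_def by (rule indep_sumE[OF iV])
  have "net_tensor (U \<union> V) l = sumE m (outer U \<inter> outer V) (sumE m (inner U \<union> inner V) (\<lambda>l. \<Prod>v\<in>U\<union>V. T v l)) l"
    unfolding net_tensor_def int_Un[OF assms] using dj fin_ext[OF U] by (subst sumE_Un) auto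
  also have "sumE m (inner U \<union> inner V) (\<lambda>l. \<Prod>v\<in>U\<union>V. T v l) = (\<lambda>l. net_tensor U l * net_tensor V l)"
  proof
    fix l
    have "sumE m (inner U \<union> inner V) (\<lambda>l. \<Prod>v\<in>U\<union>V. T v l) l
        = sumE m (inner U) (sumE m (inner V) (\<lambda>l. (\<Prod>v\<in>U. T v l) * (\<Prod>v\<in>V. T v l))) l"
      using dj fin_int[OF U] finV[OF U] finV[OF V] assms by (subst sumE_Un) (auto simp: prod.union_disjoint)
    also have "\<dots> = sumE m (inner U) (\<lambda>l. net_tensor V l * (\<Prod>v\<in>U. T v l)) l"
      by (intro sumE_cong) (simp add: sumE_mult_left[OF iU] net_tensor_def[of V] mult.commute)
    also have "\<dots> = net_tensor V l * net_tensor U l"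
      by (subst sumE_mult_left[OF iV']) (simp add: net_tensor_def[of U])
    finally show "sumE m (inner U \<union> inner V) (\<lambda>l. \<Prod>v\<in>U\<union>V. T v l) l = net_tensor U l * net_tensor V l"
      by (simp add: mult.commute)
  qed
  finally show "net_tensor (U \<union> V) l = sumE m (outer U \<inter> outer V) (\<lambda>l. net_tensor U l * net_tensor V l) l" .
qed

text \<open>\<open>U\<close> acts first: the edges it shares with \<open>V\<close> are outputs of
  \<open>U\<close> and become inputs of \<open>V\<close>, next to the part of \<open>I\<close> that
  meets \<open>V\<close> directly.\<close>

lemma net_bound_compose:
  assumes UV: "U \<union> V \<subseteq> V0" "U \<inter> V = {}" and I: "I \<subseteq> outer (U \<union> V)"
    and BU: "net_bound U (I \<inter> outer U) c" and BV: "net_bound V (outer V \<inter> (I \<union> outer U)) c'"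
  shows "net_bound (U \<union> V) I (c * c')"
proof -
  have U: "U \<subseteq> V0" and V: "V \<subseteq> V0" using UV by auto
  note fin = fin_ext[OF U] fin_ext[OF V]
  define J where "J = outer U \<inter> outer V"
  define A where "A = I \<inter> outer U"
  define O1 where "O1 = outer U - J - A"
  define I2 where "I2 = I \<inter> outer V"
  define B where "B = outer V - J - I2"
  note defs = J_def A_def O1_def I2_def B_def
  have E: "outer (U \<union> V) = (outer U - outer V) \<union> (outer V - outer U)" by (rule ext_Un[OF UV])
  have eqs: "I = A \<union> I2" "outer (U \<union> V) - I = O1 \<union> B" "outer U - A = J \<union> O1" "outer V \<inter> (I \<union> outer U) = J \<union> I2" "outer V - (J \<union> I2) = B"
    using I unfolding E defs by auto
  have "op_bound m (A \<union> I2) (O1 \<union> B) (sumE m J (\<lambda>l. net_tensor U l * net_tensor V l)) (c * c')"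
  proof (rule op_bound_compose)
    show "finite A" "finite J" "finite O1" "finite I2" "finite B" using fin by (auto simp: defs)
    show "A \<inter> J = {}" "A \<inter> O1 = {}" "A \<inter> I2 = {}" "A \<inter> B = {}" "J \<inter> O1 = {}" "J \<inter> I2 = {}" "J \<inter> B = {}"
       "O1 \<inter> I2 = {}" "O1 \<inter> B = {}" "I2 \<inter> B = {}" using I unfolding E defs by auto
    show "op_bound m A (J \<union> O1) (net_tensor U) c" using BU eqs(3) by (simp add: net_bound_def A_def)
    show "op_bound m (J \<union> I2) B (net_tensor V) c'" using BV eqs by (simp add: net_bound_def)
    show "indep (net_tensor U) (I2 \<union> B)" by (rule indep_mono[OF indep_tens[OF U]]) (use I in \<open>auto simp: defs E\<close>)
    show "indep (net_tensor V) (A \<union> O1)" by (rule indep_mono[OF indep_tens[OF V]]) (use I in \<open>auto simp: defs E\<close>)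
  qed
  then show ?thesis unfolding net_bound_def net_tensor_Un[OF UV] eqs(2) J_def[symmetric] using eqs(1) by simp
qed


lemma single_inj:
  assumes "u \<in> V0" "inj_on (\<eta> u) {..<4}"
  shows "outer {u} = \<eta> u ` {..<4}" "inner {u} = {}" "net_tensor {u} = T u"
proof -
  have d: "deg {u} e = (if e \<in> \<eta> u ` {..<4} then 1 else 0)" for e
  proof (cases "e \<in> \<eta> u ` {..<4}")
    case True
    then obtain a where a: "a < 4" "e = \<eta> u a" by auto
    then have "hits {u} e = {(u, a)}" using assms(2) by (auto simp: hits_def inj_on_def)
    then show ?thesis using True by (simp add: deg_def)
  next
    case False
    then have "hits {u} e = {}" by (auto simp: hits_def)
    then show ?thesis using False by (simp add: deg_def)
  qed
  show "outer {u} = \<eta> u ` {..<4}" "inner {u} = {}" using d by (auto simp: outer_def inner_def split: if_splits)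
  then show "net_tensor {u} = T u" by (simp add: net_tensor_def)
qed

lemma net_bound_single:
  assumes u: "u \<in> V0" "inj_on (\<eta> u) {..<4}" and I: "I \<subseteq> outer {u}" "I \<noteq> {}" "I \<noteq> outer {u}"
  shows "net_bound {u} I D"
proof -
  define A where "A = {a. a < 4 \<and> \<eta> u a \<in> I}"
  note E = single_inj[OF u]
  have IA: "I = \<eta> u ` A" using I(1) unfolding E A_def by auto
  have A: "A \<subseteq> {..<4}" by (auto simp: A_def)
  have "A \<noteq> {}" "A \<noteq> {..<4}" using I IA unfolding E by auto
  then have "op_bound m A ({..<4} - A) (\<tau> u) D" using \<tau>_split u A by blast
  moreover have "A \<union> ({..<4} - A) = {..<4}" using A by auto
  ultimately have "op_bound m (\<eta> u ` A) (\<eta> u ` ({..<4} - A)) (\<lambda>l. \<tau> u (\<lambda>x. l (\<eta> u x))) D"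
    using u \<tau>_indep[of u] A finite_subset[OF A] by (intro op_bound_transport) auto
  moreover have "\<eta> u ` ({..<4} - A) = outer {u} - I"
    unfolding E IA using u(2) A by (subst inj_on_image_set_diff[OF u(2)]) auto
  ultimately show ?thesis unfolding net_bound_def E(3) IA[symmetric] T_def[abs_def] by simp
qed

lemma contract_opB:
  assumes u: "u \<in> V0" and abcd: "{a, b, c, d} = {..<4}" and ab: "\<eta> u a \<noteq> \<eta> u b"
    and M: "mat_bound m M C" "0 \<le> C"
  shows "op_bound m {\<eta> u a} {\<eta> u b} (\<lambda>l. \<Sum>k<m. \<Sum>j<m. M k j * \<tau> u ((\<lambda>x. l (\<eta> u x))(c := k, d := j))) (D * C)"
proof -
  have "op_bound m {a} {b} (\<lambda>p. \<Sum>k<m. \<Sum>j<m. M k j * \<tau> u (p(c := k, d := j))) (D * C)"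
    by (rule \<tau>_contract[OF u abcd M])
  moreover have "indep (\<lambda>p. \<Sum>k<m. \<Sum>j<m. M k j * \<tau> u (p(c := k, d := j))) (- ({a} \<union> {b}))"
    unfolding indep_def
  proof (intro allI impI)
    fix l l' :: "nat \<Rightarrow> nat" assume *: "\<forall>x. x \<notin> - ({a} \<union> {b}) \<longrightarrow> l x = l' x"
    have "\<tau> u (l(c := k, d := j)) = \<tau> u (l'(c := k, d := j))" for k j
    proof (rule indepD[OF \<tau>_indep[OF u]])
      fix x :: nat assume "x \<notin> - {..<4}"
      then have "x \<in> {a, b, c, d}" using abcd by auto
      then show "(l(c := k, d := j)) x = (l'(c := k, d := j)) x" using * by auto
    qed
    then show "(\<Sum>k<m. \<Sum>j<m. M k j * \<tau> u (l(c := k, d := j))) = (\<Sum>k<m. \<Sum>j<m. M k j * \<tau> u (l'(c := k, d := j)))"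
      by simp
  qed
  ultimately have "op_bound m (\<eta> u ` {a}) (\<eta> u ` {b}) (\<lambda>l. \<Sum>k<m. \<Sum>j<m. M k j * \<tau> u ((\<lambda>x. l (\<eta> u x))(c := k, d := j))) (D * C)"
    using ab by (intro op_bound_transport[where t = "\<lambda>p. \<Sum>k<m. \<Sum>j<m. M k j * \<tau> u (p(c := k, d := j))"]) auto
  then show ?thesis by simp
qed

text \<open>A self-loop contracts two legs with the identity matrix. Its operator norm is 1, so the
  loop adds no cost to that of the vertex.\<close>

lemma net_bound_loop:
  assumes u: "u \<in> V0" and abcd: "{a, b, c, d} = {..<4}" 
    and E: "outer {u} = {\<eta> u a, \<eta> u b}" "\<eta> u a \<noteq> \<eta> u b" and cd: "\<eta> u c = \<eta> u d" "c \<noteq> d"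
  shows "net_bound {u} {\<eta> u a} D"
proof -
  have u': "{u} \<subseteq> V0" using u by simp
  have int: "inner {u} = {\<eta> u c}"
  proof
    have "c < 4" "d < 4" using abcd by auto
    then show "{\<eta> u c} \<subseteq> inner {u}" using deg2_slots[OF u', of u u c d] cd by (simp add: inner_def)
    show "inner {u} \<subseteq> {\<eta> u c}"
    proof
      fix e assume e: "e \<in> inner {u}"
      then have "e \<notin> outer {u}" by (simp add: inner_def outer_def)
      moreover obtain x where "x < 4" "e = \<eta> u x" using e deg_posD[of "{u}" e] by (auto simp: inner_def)
      moreover then have "x \<in> {a,b,c,d}" using abcd by auto
      ultimately show "e \<in> {\<eta> u c}" using E cd by auto
    qed
  qed
  have ne: "\<eta> u a \<noteq> \<eta> u c" "\<eta> u b \<noteq> \<eta> u c" 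
  proof -
    have "inner {u} \<inter> outer {u} = {}" by (auto simp: inner_def outer_def)
    then show "\<eta> u a \<noteq> \<eta> u c" "\<eta> u b \<noteq> \<eta> u c" unfolding int E by auto
  qed
  have "op_bound m {\<eta> u a} {\<eta> u b} (\<lambda>l. \<Sum>k<m. \<Sum>j<m. (if k = j then 1 else 0) * \<tau> u ((\<lambda>x. l (\<eta> u x))(c := k, d := j))) (D * 1)"
    by (rule contract_opB[OF u abcd E(2) mat_bound_diag]) simp
  also have "(\<lambda>l. \<Sum>k<m. \<Sum>j<m. (if k = j then 1 else 0) * \<tau> u ((\<lambda>x. l (\<eta> u x))(c := k, d := j))) = net_tensor {u}"
  proof
    fix l
    have 1: "(if k = j then 1 else 0) * \<tau> u ((\<lambda>x. l (\<eta> u x))(c := k, d := j)) = (if k = j then \<tau> u ((\<lambda>x. l (\<eta> u x))(c := k, d := j)) else 0)" for k j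
      by simp
    have "\<tau> u ((\<lambda>x. l (\<eta> u x))(c := k, d := k)) = T u (l(\<eta> u c := k))" for k
      unfolding T_def
    proof (rule indepD[OF \<tau>_indep[OF u]])
      fix x :: nat assume "x \<notin> - {..<4}"
      then have "x \<in> {a, b, c, d}" using abcd by auto
      then show "((\<lambda>x. l (\<eta> u x))(c := k, d := k)) x = (l(\<eta> u c := k)) (\<eta> u x)" using ne cd by auto
    qed
    then show "(\<Sum>k<m. \<Sum>j<m. (if k = j then 1 else 0) * \<tau> u ((\<lambda>x. l (\<eta> u x))(c := k, d := j))) = net_tensor {u} l"
      unfolding 1 net_tensor_def int sumE_single by simp
  qed
  also have "{\<eta> u b} = outer {u} - {\<eta> u a}" using E by auto
  finally show ?thesis by (simp add: net_bound_def)
qed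

text \<open>The subnetwork \<open>B\<close> enters only as a matrix on the legs \<open>c\<close> and
  \<open>d\<close>, and its bound \<open>C\<close> multiplies that of the vertex.\<close>

lemma net_bound_bubble:
  assumes u: "u \<in> V0" and B: "B \<subseteq> V0" "u \<notin> B" and abcd: "{a, b, c, d} = {..<4}" and inj: "inj_on (\<eta> u) {..<4}"
    and distinct: "distinct [a, b, c, d]"
    and E: "outer B = {\<eta> u c, \<eta> u d}"
    and BB: "net_bound B {\<eta> u c} C" "0 \<le> C"
  shows "net_bound (insert u B) {\<eta> u a} (D * C)"
proof -
  have lt: "a < 4" "b < 4" "c < 4" "d < 4" using abcd by auto
  have ne: "\<eta> u x \<noteq> \<eta> u y" if "x < 4" "y < 4" "x \<noteq> y" for x y using inj that by (auto simp: inj_on_def)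
  have ne': "\<eta> u c \<noteq> \<eta> u d" "\<eta> u a \<noteq> \<eta> u b" using ne lt distinct by auto
  note S = single_inj[OF u inj]
  have UV: "{u} \<union> B \<subseteq> V0" "{u} \<inter> B = {}" using u B by auto
  have Eu: "outer {u} = {\<eta> u a, \<eta> u b, \<eta> u c, \<eta> u d}" unfolding S(1) abcd[symmetric] by auto
  have EU: "outer (insert u B) = {\<eta> u a, \<eta> u b}"
    using ext_Un[OF UV] ne lt distinct unfolding Eu E by auto
  have J: "outer {u} \<inter> outer B = {\<eta> u c, \<eta> u d}" unfolding E Eu by auto
  \<comment> \<open>The tensor of \<open>B\<close> depends only on its two open legs, so any base
    labelling will do.\<close>
  define M where "M = (\<lambda>k j. net_tensor B ((\<lambda>_. 0)(\<eta> u c := k, \<eta> u d := j)))"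
  have EB: "outer B - {\<eta> u c} = {\<eta> u d}" using E ne' by auto
  have mb: "mat_bound m M C"
    unfolding M_def by (rule op_bound_imp_mat_bound) (use BB ne' EB in \<open>auto simp: net_bound_def\<close>)
  have MB: "net_tensor B (l(\<eta> u c := k, \<eta> u d := j)) = M k j" for l k j
    unfolding M_def by (rule indepD[OF indep_tens[OF B(1)]]) (auto simp: E)
  have "op_bound m {\<eta> u a} {\<eta> u b} (\<lambda>l. \<Sum>k<m. \<Sum>j<m. M k j * \<tau> u ((\<lambda>x. l (\<eta> u x))(c := k, d := j))) (D * C)"
    by (rule contract_opB[OF u abcd ne'(2) mb BB(2)])
  also have "(\<lambda>l. \<Sum>k<m. \<Sum>j<m. M k j * \<tau> u ((\<lambda>x. l (\<eta> u x))(c := k, d := j))) = net_tensor (insert u B)"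
  proof
    fix l
    have *: "\<tau> u ((\<lambda>x. l (\<eta> u x))(c := k, d := j)) = T u (l(\<eta> u c := k, \<eta> u d := j))" for k j
      unfolding T_def
    proof (rule indepD[OF \<tau>_indep[OF u]])
      fix x :: nat assume "x \<notin> - {..<4}"
      then have "x \<in> {a, b, c, d}" using abcd by auto
      then show "((\<lambda>x. l (\<eta> u x))(c := k, d := j)) x = (l(\<eta> u c := k, \<eta> u d := j)) (\<eta> u x)" 
        using ne lt distinct by auto
    qed
    have "net_tensor (insert u B) l = sumE m {\<eta> u c, \<eta> u d} (\<lambda>l. T u l * net_tensor B l) l"
      using net_tensor_Un[OF UV] unfolding J S(3) by simp
    also have "\<dots> = (\<Sum>k<m. \<Sum>j<m. M k j * \<tau> u ((\<lambda>x. l (\<eta> u x))(c := k, d := j)))"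
      using ne' by (simp add: sumE_insert * MB mult.commute)
    finally show "(\<Sum>k<m. \<Sum>j<m. M k j * \<tau> u ((\<lambda>x. l (\<eta> u x))(c := k, d := j))) = net_tensor (insert u B) l" ..
  qed
  also have "{\<eta> u b} = outer (insert u B) - {\<eta> u a}" using EU ne' by auto
  finally show ?thesis by (simp add: net_bound_def)
qed


text \<open>Reachability from both sides is what provides each vertex with an incoming and an
  outgoing leg. The induction hypothesis is applied twice: to the rest \<open>V'\<close>, whose
  inputs include the edges shared with the removed piece, and to the separated part
  \<open>B\<close>, with one of its two legs as input. Hence it ranges over all \<open>V\<close> and
  \<open>I\<close>.\<close>

theorem net_bound_network:
  assumes "V \<subseteq> V0" "I \<subseteq> outer V" "V \<subseteq> reach \<eta> V I" "V \<subseteq> reach \<eta> V (outer V - I)"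
  shows "net_bound V I (D ^ card V)"
  using assms
proof (induction "card V" arbitrary: V I rule: less_induct)
  case less
  note V = less.prems(1) and I = less.prems(2) and RI = less.prems(3) and RO = less.prems(4)
  define Ou where "Ou = outer V - I"
  show ?case
  proof (cases "V = {}")
    case True
    have "deg {} e = 0" for e by (simp add: deg_def hits_def)
    then have E: "outer {} = {}" "inner {} = {}" by (auto simp: outer_def inner_def)
    then have "I = {}" using True I by simp
    have "net_bound {} {} 1" unfolding net_bound_def op_bound_def net_tensor_def E by simp
    then show ?thesis using True \<open>I = {}\<close> by simp
  next
    case False
    define bad where "bad u = V - {u} - reach \<eta> (V - {u}) Ou" for u
    define cand where "cand u \<longleftrightarrow> u \<in> V \<and> (\<exists>a<4. \<eta> u a \<in> I)" for u
    have "\<exists>u. cand u"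
    proof -
      obtain v where "v \<in> V" using False by auto
      then have "v \<in> reach \<eta> V I" using RI by blast
      from reach_ex[OF this] show ?thesis unfolding cand_def by blast
    qed
    \<comment> \<open>By minimality the part \<open>bad u\<close>, which \<open>u\<close> separates from the outputs, carries no input edge.\<close>
    then obtain u where u: "cand u" and min: "\<And>w. cand w \<Longrightarrow> card (bad u) \<le> card (bad w)"
      using ex_has_least_nat[of cand _ "\<lambda>u. card (bad u)"] by blast
    have uV: "u \<in> V" and uV0: "u \<in> V0" using u V by (auto simp: cand_def)
    obtain a where a: "a < 4" "\<eta> u a \<in> I" using u by (auto simp: cand_def)
    define B where "B = bad u"
    define V' where "V' = V - insert u B"
    have finVV: "finite V" by (rule finV[OF V])
    have BV: "B \<subseteq> V" "u \<notin> B" by (auto simp: B_def bad_def)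
    have V'eq: "V' = reach \<eta> (V - {u}) Ou" using reach_sub[of \<eta> "V - {u}" Ou] by (auto simp: V'_def B_def bad_def)
    have BO: "\<eta> w b \<notin> Ou" if "w \<in> B" "b < 4" for w b
      using that reach.base[of w "V - {u}" b \<eta> Ou] by (auto simp: B_def bad_def)
    have nbr: "y \<in> B \<or> y = u" if "w \<in> B" "y \<in> V" "b < 4" "x < 4" "\<eta> w b = \<eta> y x" for w y b x
    proof (rule ccontr)
      assume "\<not> ?thesis"
      then have "y \<in> reach \<eta> (V - {u}) Ou" using that(2) by (auto simp: B_def bad_def)
      then have "w \<in> reach \<eta> (V - {u}) Ou" using that BV
        by (intro reach.step[of y \<eta> "V - {u}" Ou w x b]) auto
      then show False using that(1) by (auto simp: B_def bad_def)
    qed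
    have BI: "\<eta> w b \<notin> I" if w: "w \<in> B" and b: "b < 4" for w b
    proof
      assume wI: "\<eta> w b \<in> I"
      have wV: "w \<in> V" "w \<noteq> u" using w BV by auto
      then have "cand w" using wI b by (auto simp: cand_def)
      \<comment> \<open>A path from the outputs that avoids \<open>u\<close> also avoids
        \<open>w\<close>, since \<open>w\<close> lies in the part that \<open>u\<close> cuts
        off.\<close>
      have sub: "y \<in> reach \<eta> (V - {w}) Ou" if "y \<in> reach \<eta> (V - {u}) Ou" for y
        using that
      proof (induction rule: reach.induct)
        case (base v a)
        then have "v \<noteq> w" using w reach.base[of v "V - {u}" a \<eta> Ou] by (auto simp: B_def bad_def)
        then show ?case using base by (intro reach.base[of v _ a]) auto
      next
        case (step v y a b)
        then have "y \<noteq> w" using w reach.step[of v \<eta> "V - {u}" Ou y a b] by (auto simp: B_def bad_def)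
        then show ?case using step by (intro reach.step[of v _ _ _ y a b]) auto
      qed
      \<comment> \<open>Follow a path that starts at the outputs. Before it first meets
        \<open>u\<close> it runs where \<open>w\<close> cannot occur, so \<open>u\<close> is reached
        without \<open>w\<close>. Then \<open>bad w\<close> omits \<open>w\<close> and is strictly
        smaller than \<open>bad u\<close>.\<close>
      have "y \<in> reach \<eta> (V - {u}) Ou \<or> u \<in> reach \<eta> (V - {w}) Ou" if "y \<in> reach \<eta> V Ou" for y
        using that
      proof (induction rule: reach.induct)
        case (base v a)
        then show ?case using reach.base[of v "V - {u}" a \<eta> Ou] reach.base[of v "V - {w}" a \<eta> Ou] wV by auto
      next
        case (step v y a b)
        then show ?case using reach.step[of v \<eta> "V - {u}" Ou y a b] reach.step[of v \<eta> "V - {w}" Ou y a b] wV sub by auto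
      qed
      then have uR: "u \<in> reach \<eta> (V - {w}) Ou" using RO uV reach_sub[of \<eta> "V - {u}" Ou] unfolding Ou_def by blast
      have "bad w \<subset> bad u"
      proof
        show "bad w \<subseteq> bad u" using sub uR by (auto simp: bad_def)
        show "bad w \<noteq> bad u" using w by (auto simp: B_def bad_def)
      qed
      then have "card (bad w) < card (bad u)" using finVV by (intro psubset_card_mono) (auto simp: bad_def)
      then show False using min[OF \<open>cand w\<close>] by simp
    qed
    have Bext: "\<eta> w b \<notin> outer V" if "w \<in> B" "b < 4" for w b using BO BI that by (auto simp: Ou_def)
    define U where "U = insert u B"
    have UV: "U \<union> V' = V" "U \<inter> V' = {}" using uV BV by (auto simp: U_def V'_def)
    have UV0: "U \<union> V' \<subseteq> V0" "U \<subseteq> V0" "V' \<subseteq> V0" "B \<subseteq> V0" using UV V BV by auto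
    note dUn = deg_Un[OF UV0(1) UV(2), unfolded UV(1)]
    have exUV: "e \<in> outer U \<inter> outer V'" if "deg U e \<ge> 1" "deg V' e \<ge> 1" for e
      using that dUn[of e] deg_le2[OF V, of e] by (simp add: outer_def)
    have shared: "\<eta> y x \<in> outer U \<inter> outer V'" if "y \<in> U" "z \<in> V'" "x < 4" "b < 4" "\<eta> y x = \<eta> z b" for y z x b
    proof (rule exUV)
      show "1 \<le> deg U (\<eta> y x)" using deg_pos[OF UV0(2) that(1,3)] .
      show "1 \<le> deg V' (\<eta> y x)" using deg_pos[OF UV0(3) that(2,4)] that(5) by simp
    qed
    \<comment> \<open>The edges between the two pieces are handed on by \<open>U\<close> as inputs
      of \<open>V'\<close>.\<close>
    define I' where "I' = outer V' \<inter> (I \<union> outer U)"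
    have ext_own: "e \<in> outer V' - outer U" if "e \<in> outer V" "y \<in> V'" "x < 4" "e = \<eta> y x" for e y x
      using that(1) deg_pos[OF UV0(3) that(2,3)] dUn[of e] that(4) by (simp add: outer_def)
    have ext_own': "e \<in> outer U - outer V'" if "e \<in> outer V" "y \<in> U" "x < 4" "e = \<eta> y x" for e y x
      using that(1) deg_pos[OF UV0(2) that(2,3)] dUn[of e] that(4) by (simp add: outer_def)
    have R1: "y \<in> reach \<eta> V' (outer V' - I')" if "y \<in> reach \<eta> (V - {u}) Ou" for y
      using that
    proof (induction rule: reach.induct)
      case (base v x)
      then have vV': "v \<in> V'" unfolding V'eq by (intro reach.base)
      have "\<eta> v x \<in> outer V' - I'"
        using ext_own[of "\<eta> v x" v x] base vV' by (auto simp: Ou_def I'_def)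
      then show ?case using vV' base by (intro reach.base[of v _ x]) auto
    next
      case (step v y x b)
      then have "y \<in> V'" unfolding V'eq by (intro reach.step[of v _ _ _ y x b])
      then show ?case using step by (intro reach.step[of v _ _ _ y x b]) auto
    qed
    have R2: "y \<in> V' \<Longrightarrow> y \<in> reach \<eta> V' I'" if "y \<in> reach \<eta> V I" for y
      using that
    proof (induction rule: reach.induct)
      case (base v x)
      then have "\<eta> v x \<in> I'" using ext_own[of "\<eta> v x" v x] I by (auto simp: I'_def)
      then show ?case using base by (intro reach.base[of v _ x]) auto
    next
      case (step v y x b)
      show ?case
      proof (cases "v \<in> V'")
        case True
        then show ?thesis using step by (intro reach.step[of v _ _ _ y x b]) auto
      next
        case False
        then have "v \<in> U" using step UV reach_subset by blast
        then have "\<eta> y b \<in> I'" using shared[of v y x b] step by (auto simp: I'_def)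
        then show ?thesis using step by (intro reach.base[of y _ b]) auto
      qed
    qed
    have "card V' < card V" using finVV uV by (intro psubset_card_mono) (auto simp: V'_def)
    then have BdV': "net_bound V' I' (D ^ card V')"
    proof (rule less.hyps)
      show "V' \<subseteq> V0" by fact
      show "I' \<subseteq> outer V'" by (auto simp: I'_def)
      show "V' \<subseteq> reach \<eta> V' I'" using R2 RI UV by blast
      show "V' \<subseteq> reach \<eta> V' (outer V' - I')" using R1 V'eq by blast
    qed
    \<comment> \<open>Taken at \<open>y = u\<close>, which is outside \<open>V'\<close>, this yields
      a leg \<open>b\<close> of \<open>u\<close> on the outgoing side. The inputs of the removed
      piece are thus a proper subset of its open legs.\<close>
    have "y \<in> V' \<or> (\<exists>b<4. \<eta> u b \<in> Ou \<or> (\<exists>z\<in>V'. \<exists>x<4. \<eta> z x = \<eta> u b))" if "y \<in> reach \<eta> V Ou" for y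
      using that
    proof (induction rule: reach.induct)
      case (base v x)
      then show ?case using reach.base[of v "V - {u}" x \<eta> Ou] unfolding V'eq by (cases "v = u") auto
    next
      case (step v y x b)
      then show ?case using reach.step[of v \<eta> "V - {u}" Ou y x b] unfolding V'eq by (cases "y = u") auto
    qed
    then obtain b where b: "b < 4" "\<eta> u b \<in> Ou \<or> (\<exists>z\<in>V'. \<exists>x<4. \<eta> z x = \<eta> u b)"
      using RO uV unfolding Ou_def[symmetric] V'_def by blast
    have uU: "u \<in> U" by (simp add: U_def)
    have aE: "\<eta> u a \<in> outer U - outer V'" using ext_own'[OF _ uU a(1) refl] a(2) I by auto
    have bE: "\<eta> u b \<in> outer U" "\<eta> u b \<notin> I"
    proof -
      show "\<eta> u b \<in> outer U" 
        using b(2)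
      proof
        assume "\<eta> u b \<in> Ou"
        then show ?thesis using ext_own'[OF _ uU b(1) refl] by (simp add: Ou_def)
      next
        assume "\<exists>z\<in>V'. \<exists>x<4. \<eta> z x = \<eta> u b"
        then obtain z x where "z \<in> V'" "x < 4" "\<eta> u b = \<eta> z x" by metis
        then show ?thesis using shared[OF uU _ b(1)] by blast
      qed
      show "\<eta> u b \<notin> I" 
        using b(2)
      proof
        assume "\<eta> u b \<in> Ou"
        then show ?thesis by (simp add: Ou_def)
      next
        assume "\<exists>z\<in>V'. \<exists>x<4. \<eta> z x = \<eta> u b"
        then obtain z x where "z \<in> V'" "x < 4" "\<eta> u b = \<eta> z x" by metis
        then have "\<eta> u b \<in> outer V'" using shared[OF uU _ b(1)] by blast
        then show ?thesis using ext_own'[OF _ uU b(1) refl] I by blast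
      qed
    qed
    have ab: "\<eta> u a \<noteq> \<eta> u b" "a \<noteq> b" using a(2) bE(2) by auto
    have dU: "{u} \<union> B \<subseteq> V0" "{u} \<inter> B = {}" using UV0 BV by (auto simp: U_def)
    \<comment> \<open>The separated part carries no input edge, so every input of \<open>U\<close>
      is attached to \<open>u\<close> itself.\<close>
    have only: "I \<inter> outer U \<subseteq> outer {u}"
    proof
      fix e assume e: "e \<in> I \<inter> outer U"
      then have "deg V e = 1" "deg U e = 1" using I by (auto simp: outer_def)
      have "deg B e = 0"
      proof (rule ccontr)
        assume "deg B e \<noteq> 0"
        then obtain w x where "w \<in> B" "x < 4" "\<eta> w x = e" using deg_posD[of B e] by auto
        then show False using BI e by auto
      qed
      then show "e \<in> outer {u}" using deg_Un[OF dU, of e] \<open>deg U e = 1\<close> by (simp add: outer_def U_def)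
    qed
    \<comment> \<open>The removed piece is a plain vertex, a vertex with a self-loop, or a vertex
      with a subnetwork \<open>B\<close> attached. In the last two cases the edges at
      \<open>a\<close> and \<open>b\<close> are open in \<open>U\<close>, so only the legs
      \<open>c\<close> and \<open>d\<close> can be occupied.\<close>
    have BdU: "net_bound U (I \<inter> outer U) (D ^ card U)"
    proof (cases "B = {} \<and> inj_on (\<eta> u) {..<4}")
      case True
      then have "U = {u}" by (simp add: U_def)
      then show ?thesis using net_bound_single[OF uV0, of "I \<inter> outer U"] True a aE bE by (auto)
    next
      case nt: False
      have "\<exists>c d. {a,b,c,d} = {..<4::nat} \<and> distinct [a,b,c,d]"
      proof -
        have "card ({..<4} - {a,b}) = 2" using a b ab by (subst card_Diff_subset) auto
        then obtain c d where cd: "{..<4} - {a,b} = {c,d}" "c \<noteq> d" by (auto simp: card_2_iff)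
        then have "{a,b,c,d} = {..<4}" using a b by auto
        moreover have "distinct [a,b,c,d]" using cd ab by auto
        ultimately show ?thesis by blast
      qed
      then obtain c d where abcd: "{a,b,c,d} = {..<4::nat}" and dist: "distinct [a,b,c,d]" by blast
      have lt: "c < 4" "d < 4" using abcd by auto
      have a1: "\<eta> u x \<noteq> \<eta> u a" if "x < 4" "x \<noteq> a" for x
        using deg2_slots[OF UV0(2) uU uU that(1) a(1)] that aE by (auto simp: outer_def)
      have b1: "\<eta> u x \<noteq> \<eta> u b" if "x < 4" "x \<noteq> b" for x
        using deg2_slots[OF UV0(2) uU uU that(1) b(1)] that bE by (auto simp: outer_def)
      have a2: "\<eta> w x \<noteq> \<eta> u a" "\<eta> w x \<noteq> \<eta> u b" if "x < 4" "w \<in> B" for x w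
      proof -
        have "w \<in> U" "w \<noteq> u" using that BV by (auto simp: U_def)
        then show "\<eta> w x \<noteq> \<eta> u a" "\<eta> w x \<noteq> \<eta> u b"
          using deg2_slots[OF UV0(2) _ uU that(1) a(1)] deg2_slots[OF UV0(2) _ uU that(1) b(1)] aE bE 
          by (auto simp: outer_def)
      qed
      \<comment> \<open>Since \<open>B\<close> touches no input edge, a path from the inputs can
        enter it only through \<open>u\<close>.\<close>
      have att: "\<exists>w\<in>B. \<exists>x<4. \<exists>z<4. \<eta> w x = \<eta> u z" if "y \<in> reach \<eta> V I" "y \<in> B" for y
        using that
      proof (induction rule: reach.induct)
        case (base v x)
        then show ?case using BI by auto
      next
        case (step v y x z)
        then have "v \<in> B \<or> v = u" using nbr[of y v z x] reach_sub[of \<eta> V I] by auto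
        then show ?case using step by metis
      qed
      have IU: "I \<inter> outer U = {\<eta> u a}"
        if "\<And>z. z \<in> {c, d} \<Longrightarrow> \<eta> u z \<notin> I"
      proof
        show "{\<eta> u a} \<subseteq> I \<inter> outer U" using a aE by auto
        show "I \<inter> outer U \<subseteq> {\<eta> u a}"
        proof
          fix e assume e: "e \<in> I \<inter> outer U"
          then have "e \<in> outer {u}" using only by blast
          then have "deg {u} e \<ge> 1" by (simp add: outer_def)
          from deg_posD[OF this] obtain z where "z < 4" "e = \<eta> u z" by auto
          then have "z \<in> {a,b,c,d}" using abcd by auto
          then show "e \<in> {\<eta> u a}" using that bE e \<open>e = \<eta> u z\<close> by auto
        qed
      qed
      show ?thesis
      proof (cases "inj_on (\<eta> u) {..<4}")
        case False
        then obtain x y where xy: "x < 4" "y < 4" "x \<noteq> y" "\<eta> u x = \<eta> u y" by (auto simp: inj_on_def)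
        have "x \<notin> {a, b}" "y \<notin> {a, b}" using a1 b1 xy by (metis insertE singletonD)+
        moreover have "x \<in> {a,b,c,d}" "y \<in> {a,b,c,d}" using abcd xy by auto
        ultimately have cd: "\<eta> u c = \<eta> u d" using xy by auto
        have u1: "{u} \<subseteq> V0" using uV0 by simp
        have deg2: "deg {u} (\<eta> u c) = 2" using deg2_slots[OF u1, of u u c d] cd lt dist by auto
        \<comment> \<open>The loop uses up both remaining legs of \<open>u\<close>, so nothing else
          can be attached.\<close>
        have "B = {}"
        proof (rule ccontr)
          assume "B \<noteq> {}"
          then obtain w x z where w: "w \<in> B" "x < 4" "z < 4" "\<eta> w x = \<eta> u z" using att RI BV by blast
          then have "z \<in> {c, d}" using a2 abcd by (metis insertE lessThan_iff insert_iff)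
          then have "\<eta> w x = \<eta> u c" using w cd by auto
          then have "deg B (\<eta> u c) \<ge> 1" using deg_pos[OF UV0(4) w(1,2)] by simp
          then show False using deg2 deg_Un[OF dU, of "\<eta> u c"] deg_le2[OF UV0(2), of "\<eta> u c"] by (simp add: U_def)
        qed
        then have U: "U = {u}" by (simp add: U_def)
        have "\<eta> u c \<notin> outer {u}" using deg2 by (simp add: outer_def)
        then have cI: "\<eta> u z \<notin> outer {u}" if "z \<in> {c, d}" for z using that cd by auto
        have E: "outer {u} = {\<eta> u a, \<eta> u b}"
        proof
          show "{\<eta> u a, \<eta> u b} \<subseteq> outer {u}" using aE bE U by auto
          show "outer {u} \<subseteq> {\<eta> u a, \<eta> u b}"
          proof
            fix e assume e: "e \<in> outer {u}"
            then obtain z where z: "z < 4" "e = \<eta> u z" using deg_posD[of "{u}" e] by (auto simp: outer_def)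
            then have "z \<in> {a,b,c,d}" using abcd by auto
            then show "e \<in> {\<eta> u a, \<eta> u b}" using cI e z by auto
          qed
        qed
        have "I \<inter> outer U = {\<eta> u a}" using E bE a by (auto simp: U)
        then show ?thesis using net_bound_loop[OF uV0 abcd E ab(1) cd] dist by (simp add: U)
      next
        case inj: True
        then have Bne: "B \<noteq> {}" using nt by auto
        have cdI: "\<eta> w x \<notin> outer V" if "w \<in> B" "x < 4" for w x by (rule Bext[OF that])
        \<comment> \<open>An edge open in \<open>B\<close> is not open in \<open>V\<close>, so its
          other end lies outside \<open>B\<close>, and \<open>u\<close> is the only neighbour
          there.\<close>
        have extB: "\<exists>z\<in>{c,d}. e = \<eta> u z" if e: "e \<in> outer B" for e
        proof -
          have "deg B e \<ge> 1" using e by (simp add: outer_def)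
          then obtain w x where w: "w \<in> B" "x < 4" "\<eta> w x = e" using deg_posD by blast
          have "deg (V - B) e \<ge> 1"
          proof -
            have "deg V e = deg B e + deg (V - B) e" 
              using deg_Un[of B "V - B" e] V BV by (metis Diff_disjoint Diff_partition)
            moreover have "deg V e \<noteq> 1" using cdI[OF w(1,2)] w(3) by (simp add: outer_def)
            ultimately show ?thesis using e by (simp add: outer_def)
          qed
          then obtain y z where y: "y \<in> V - B" "z < 4" "\<eta> y z = e" using deg_posD by blast
          then have "y = u" using nbr[of w y x z] w by auto
          moreover have "z \<in> {c, d}" using a2[OF w(2,1)] w(3) y \<open>y = u\<close> abcd by (metis insertE lessThan_iff insert_iff)
          ultimately show ?thesis using y by auto
        qed
        have "outer B \<noteq> {}"
        proof -
          obtain w x z where w: "w \<in> B" "x < 4" "z < 4" "\<eta> w x = \<eta> u z" using att RI BV Bne by blast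
          have "deg B (\<eta> w x) \<ge> 1" using deg_pos[OF UV0(4) w(1,2)] .
          moreover have "deg {u} (\<eta> w x) \<ge> 1" using deg_pos[of "{u}" u z] w uV0 by simp
          ultimately have "\<eta> w x \<in> outer B" using deg_Un[OF dU, of "\<eta> w x"] deg_le2[OF UV0(2), of "\<eta> w x"] 
            by (simp add: U_def outer_def)
          then show ?thesis by auto
        qed
        have cdne: "\<eta> u c \<noteq> \<eta> u d" using inj lt dist by (auto simp: inj_on_def)
        \<comment> \<open>There is at least one open edge and there are at most two; parity leaves
          exactly two.\<close>
        have EB: "outer B = {\<eta> u c, \<eta> u d}"
        proof -
          have sub: "outer B \<subseteq> {\<eta> u c, \<eta> u d}" using extB by auto
          then have "card (outer B) \<le> 2" using cdne card_mono[OF _ sub] by simp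
          moreover have "card (outer B) > 0" using \<open>outer B \<noteq> {}\<close> fin_ext[OF UV0(4)] by (simp add: card_gt_0_iff)
          ultimately have "card (outer B) = 2" using even_ext[OF UV0(4)] by (auto elim!: evenE)
          then show ?thesis using sub cdne by (intro card_subset_eq) auto
        qed
        \<comment> \<open>The part of \<open>B\<close> not reached from the leg \<open>g\<close>
          could be open only at \<open>h\<close>. By parity it then has no open edge at all, so it
          would be a closed component and out of reach of the inputs.\<close>
        have conn: "B \<subseteq> reach \<eta> B {g}" if g: "{g, h} = {\<eta> u c, \<eta> u d}" "g \<noteq> h" for g h
        proof -
          define R where "R = reach \<eta> B {g}"
          define W where "W = B - R"
          have RB: "R \<subseteq> B" using reach_subset unfolding R_def by fast
          have W0: "W \<subseteq> V0" and WR: "R \<union> W \<subseteq> V0" "R \<inter> W = {}" "R \<union> W = B" using UV0 RB by (auto simp: W_def)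
          have "outer W \<subseteq> {h}"
          proof
            fix e assume e: "e \<in> outer W"
            then obtain w x where w: "w \<in> W" "x < 4" "\<eta> w x = e" using deg_posD[of W e] by (auto simp: outer_def)
            have "deg R e = 0"
            proof (rule ccontr)
              assume "deg R e \<noteq> 0"
              then obtain r y where r: "r \<in> R" "y < 4" "\<eta> r y = e" using deg_posD[of R e] by auto
              then have "w \<in> R" using w unfolding R_def W_def by (intro reach.step[of r _ _ _ w y x]) auto
              then show False using w by (simp add: W_def)
            qed
            then have "e \<in> outer B" using deg_Un[OF WR(1,2), of e] e WR(3) by (simp add: outer_def)
            then have "e \<in> {g, h}" using EB g by simp
            moreover have "e \<noteq> g" using w reach.base[of w B x \<eta> "{g}"] by (auto simp: W_def R_def)
            ultimately show "e \<in> {h}" by auto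
          qed
          moreover have "outer W \<noteq> {h}" using even_ext[OF W0] by auto
          ultimately have EW: "outer W = {}" by auto
          have "y \<notin> W" if "y \<in> reach \<eta> V I" for y
            using that
          proof (induction rule: reach.induct)
            case (base v x)
            then show ?case using BI by (auto simp: W_def)
          next
            case (step v y x b)
            show ?case
            proof
              assume yW: "y \<in> W"
              have vV: "v \<in> V" using step(1) reach_subset by fast
              have "deg W (\<eta> y b) \<ge> 1" using deg_pos[OF W0 yW] step by simp
              moreover have "deg (V - W) (\<eta> y b) \<ge> 1" using deg_pos[of "V - W" v x] V vV step by auto
              moreover have "deg V (\<eta> y b) = deg W (\<eta> y b) + deg (V - W) (\<eta> y b)"
              proof -
                have "W \<subseteq> V" using BV by (auto simp: W_def)
                then show ?thesis using deg_Un[of W "V - W"] V by (metis Diff_disjoint Diff_partition)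
              qed
              ultimately have "\<eta> y b \<in> outer W" using deg_le2[OF V, of "\<eta> y b"] by (simp add: outer_def)
              then show False using EW by simp
            qed
          qed
          then show ?thesis using RI BV by (auto simp: W_def R_def)
        qed
        have "card B < card V" using finVV BV uV by (intro psubset_card_mono) auto
        then have "net_bound B {\<eta> u c} (D ^ card B)"
        proof (rule less.hyps)
          show "B \<subseteq> V0" by fact
          show "{\<eta> u c} \<subseteq> outer B" using EB by simp
          show "B \<subseteq> reach \<eta> B {\<eta> u c}" using conn[of "\<eta> u c" "\<eta> u d"] cdne by simp
          have "outer B - {\<eta> u c} = {\<eta> u d}" using EB cdne by auto
          then show "B \<subseteq> reach \<eta> B (outer B - {\<eta> u c})" using conn[of "\<eta> u d" "\<eta> u c"] cdne by auto
        qed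
        from net_bound_bubble[OF uV0 UV0(4) BV(2) abcd inj dist EB this] D0
        have "net_bound U {\<eta> u a} (D * D ^ card B)" by (simp add: U_def)
        moreover have "card U = Suc (card B)" using BV finite_subset[OF BV(1) finVV] by (simp add: U_def)
        moreover have "I \<inter> outer U = {\<eta> u a}"
        proof (rule IU)
          fix z assume "z \<in> {c, d}"
          then have "\<eta> u z \<in> outer B" using EB by auto
          then obtain w x where "w \<in> B" "x < 4" "\<eta> w x = \<eta> u z" using deg_posD[of B "\<eta> u z"] by (auto simp: outer_def)
          then show "\<eta> u z \<notin> I" using BI by metis
        qed
        ultimately show ?thesis by simp
      qed
    qed
    have "net_bound (U \<union> V') I (D ^ card U * D ^ card V')"
      by (rule net_bound_compose[OF UV0(1) UV(2) _ BdU BdV'[unfolded I'_def]]) (use I UV in simp)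
    moreover have "card V = card U + card V'"
      using UV finVV by (metis card_Un_disjoint finite_Un)
    ultimately show ?thesis by (simp add: UV power_add)
  qed
qed

end

section \<open>Integration over the six variables of a vertex\<close>

lemma integral_Cauchy_Schwarz:
  fixes f g :: "'a \<Rightarrow> real"
  assumes f: "integrable M (\<lambda>x. (f x)\<^sup>2)" and g: "integrable M (\<lambda>x. (g x)\<^sup>2)" and fg: "integrable M (\<lambda>x. f x * g x)"
  shows "\<bar>\<integral>x. f x * g x \<partial>M\<bar> \<le> sqrt (\<integral>x. (f x)\<^sup>2 \<partial>M) * sqrt (\<integral>x. (g x)\<^sup>2 \<partial>M)"
proof -
  define a where "a = (\<integral>x. (f x)\<^sup>2 \<partial>M)"
  define b where "b = (\<integral>x. f x * g x \<partial>M)"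
  define c where "c = (\<integral>x. (g x)\<^sup>2 \<partial>M)"
  have q: "0 \<le> a - 2 * t * b + t\<^sup>2 * c" for t
  proof -
    have "0 \<le> (\<integral>x. (f x - t * g x)\<^sup>2 \<partial>M)" by simp
    also have "(\<lambda>x. (f x - t * g x)\<^sup>2) = (\<lambda>x. (f x)\<^sup>2 - 2 * t * (f x * g x) + t\<^sup>2 * (g x)\<^sup>2)"
      by (auto simp: power2_diff power_mult_distrib algebra_simps)
    also have "(\<integral>x. (f x)\<^sup>2 - 2 * t * (f x * g x) + t\<^sup>2 * (g x)\<^sup>2 \<partial>M) = a - 2 * t * b + t\<^sup>2 * c"
      using f g fg by (simp add: a_def b_def c_def)
    finally show ?thesis .
  qed
  have a0: "0 \<le> a" and c0: "0 \<le> c" by (auto simp: a_def c_def)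
  have "b\<^sup>2 \<le> a * c"
  proof (cases "c = 0")
    case True
    have "b = 0"
    proof (rule ccontr)
      assume "b \<noteq> 0"
      \<comment> \<open>For \<open>c = 0\<close> the expression in \<open>q\<close> is affine in
        \<open>t\<close>, and this value of \<open>t\<close> makes it equal to -1.\<close>
      then have "0 \<le> a - 2 * ((a + 1) / (2 * b)) * b" using q[of "(a + 1) / (2 * b)"] True by simp
      then show False using \<open>b \<noteq> 0\<close> by simp
    qed
    then show ?thesis using a0 c0 by simp
  next
    case False
    then have "c > 0" using c0 by simp
    then have "0 \<le> (a - 2 * (b / c) * b + (b / c)\<^sup>2 * c) * c" using q[of "b / c"] by simp
    also have "\<dots> = a * c - b\<^sup>2" using \<open>c > 0\<close> by (simp add: field_simps power2_eq_square)
    finally show ?thesis by simp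
  qed
  then have "sqrt (b\<^sup>2) \<le> sqrt (a * c)" by (rule real_sqrt_le_mono)
  then show ?thesis by (simp add: real_sqrt_mult a_def b_def c_def)
qed

abbreviation haar6 :: "(nat \<Rightarrow> cc) measure" where "haar6 \<equiv> PiM {..<6} (\<lambda>_. haar)"

interpretation prod_haar: product_prob_space "\<lambda>_. haar" UNIV ..

interpretation haar6: prob_space haar6
  by (rule prob_space_PiM) (rule prob_space_haar)

text \<open>A class closed under the operations used below, so that integrability over the six
  variables follows from the shape of the integrand.\<close>

definition bdd :: "((nat \<Rightarrow> cc) \<Rightarrow> 'b::{real_normed_field, banach, second_countable_topology}) \<Rightarrow> bool" where
  "bdd h \<longleftrightarrow> h \<in> borel_measurable haar6 \<and> (\<exists>B. \<forall>g\<in>space haar6. norm (h g) \<le> B)"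

lemma bmI: "h \<in> borel_measurable haar6 \<Longrightarrow> (\<And>g. g \<in> space haar6 \<Longrightarrow> norm (h g) \<le> B) \<Longrightarrow> bdd h"
  unfolding bdd_def by blast

lemma bdd_integrable: "bdd h \<Longrightarrow> integrable haar6 h"
  unfolding bdd_def using haar6.integrable_const_bound[of h] by (auto intro!: AE_I2)

lemma bdd_const: "bdd (\<lambda>_. c)" by (rule bmI[of _ "norm c"]) auto

lemma bdd_mult: assumes "bdd f" "bdd g" shows "bdd (\<lambda>x. f x * g x)"
proof -
  obtain A B where "\<forall>x\<in>space haar6. norm (f x) \<le> A" "\<forall>x\<in>space haar6. norm (g x) \<le> B"
    using assms by (auto simp: bdd_def)
  then have "norm (f x * g x) \<le> A * B" if "x \<in> space haar6" for x
    unfolding norm_mult using that by (intro mult_mono) (auto intro: order_trans[OF norm_ge_zero])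
  then show ?thesis using assms by (intro bmI[of _ "A * B"]) (auto simp: bdd_def)
qed

lemma bdd_add: assumes "bdd f" "bdd g" shows "bdd (\<lambda>x. f x + g x)"
proof -
  obtain A B where AB: "\<forall>x\<in>space haar6. norm (f x) \<le> A" "\<forall>x\<in>space haar6. norm (g x) \<le> B"
    using assms by (auto simp: bdd_def)
  have "norm (f x + g x) \<le> A + B" if "x \<in> space haar6" for x
    using AB that by (intro norm_triangle_le add_mono) auto
  then show ?thesis using assms by (intro bmI[of _ "A + B"]) (auto simp: bdd_def)
qed

lemma bdd_sum: "finite S \<Longrightarrow> (\<And>i. i \<in> S \<Longrightarrow> bdd (f i)) \<Longrightarrow> bdd (\<lambda>x. \<Sum>i\<in>S. f i x)"
  by (induction S rule: finite_induct) (auto intro: bdd_const bdd_add)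

lemma bdd_prod: "finite S \<Longrightarrow> (\<And>i. i \<in> S \<Longrightarrow> bdd (f i)) \<Longrightarrow> bdd (\<lambda>x. \<Prod>i\<in>S. f i x)"
  by (induction S rule: finite_induct) (auto intro: bdd_const bdd_mult)

lemma bdd_cnj: "bdd f \<Longrightarrow> bdd (\<lambda>x. cnj (f x))"
  unfolding bdd_def by (auto intro!: measurable_compose[of f _ borel cnj] borel_measurable_continuous_onI continuous_intros)

lemma bdd_norm: fixes f :: "_ \<Rightarrow> complex" shows "bdd f \<Longrightarrow> bdd (\<lambda>x. cmod (f x))"
  unfolding bdd_def by auto

lemma bdd_power: "bdd f \<Longrightarrow> bdd (\<lambda>x. (f x) ^ n)"
  by (induction n) (auto intro: bdd_const bdd_mult)

lemma bdd_sqrt: fixes f :: "_ \<Rightarrow> real" assumes "bdd f" shows "bdd (\<lambda>x. sqrt (f x))"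
proof -
  obtain A where A: "\<forall>x\<in>space haar6. norm (f x) \<le> A" using assms by (auto simp: bdd_def)
  have "norm (sqrt (f x)) \<le> sqrt A" if "x \<in> space haar6" for x
  proof -
    have "norm (sqrt (f x)) = sqrt \<bar>f x\<bar>" by (auto simp: abs_if real_sqrt_minus)
    then show ?thesis using A that by simp
  qed
  then show ?thesis using assms by (intro bmI[of _ "sqrt A"]) (auto simp: bdd_def)
qed

definition norm2 :: "((nat \<Rightarrow> cc) \<Rightarrow> complex) \<Rightarrow> real" where
  "norm2 h = (\<integral>g. (cmod (h g))\<^sup>2 \<partial>haar6)"

lemma norm2_nonneg: "0 \<le> norm2 h" by (simp add: norm2_def)

lemma bdd_Cauchy_Schwarz:
  assumes f: "bdd f" and g: "bdd g"
  shows "cmod (\<integral>x. f x * g x \<partial>haar6) \<le> sqrt (norm2 f) * sqrt (norm2 g)"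
proof -
  have "cmod (\<integral>x. f x * g x \<partial>haar6) \<le> (\<integral>x. cmod (f x) * cmod (g x) \<partial>haar6)"
    by (rule order_trans[OF integral_norm_bound]) (simp add: norm_mult)
  also have "\<dots> \<le> \<bar>\<dots>\<bar>" by simp
  also have "\<dots> \<le> sqrt (norm2 f) * sqrt (norm2 g)"
    unfolding norm2_def by (rule integral_Cauchy_Schwarz) (intro bdd_integrable bdd_power bdd_mult bdd_norm f g)+
  finally show ?thesis .
qed

text \<open>Conditional expectation given the other variables, kept as a function of all coordinates
  so that it stays on the same space.\<close>

definition int_out :: "nat \<Rightarrow> ((nat \<Rightarrow> cc) \<Rightarrow> 'b::{real_normed_field, banach, second_countable_topology}) \<Rightarrow> (nat \<Rightarrow> cc) \<Rightarrow> 'b" where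
  "int_out p h g = (\<integral>y. h (g(p := y)) \<partial>haar)"

definition not_dep :: "((nat \<Rightarrow> cc) \<Rightarrow> 'b) \<Rightarrow> nat \<Rightarrow> bool" where
  "not_dep h p \<longleftrightarrow> (\<forall>g y. h (g(p := y)) = h g)"

lemma nodepD: "not_dep h p \<Longrightarrow> h (g(p := y)) = h g" unfolding not_dep_def by blast

lemma haar_prob_SU2[simp]: "measure haar SU2 = 1"
  using haar.prob_space by simp

lemma space_haar6_upd: "g \<in> space haar6 \<Longrightarrow> p < 6 \<Longrightarrow> y \<in> SU2 \<Longrightarrow> g(p := y) \<in> space haar6"
  by (auto simp: space_PiM PiE_def extensional_def)

lemma space_haar6_nth: "g \<in> space haar6 \<Longrightarrow> p < 6 \<Longrightarrow> g p \<in> SU2"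
  by (auto simp: space_PiM)

lemma measurable_upd: "p < 6 \<Longrightarrow> (\<lambda>(g, y). g(p := y)) \<in> haar6 \<Otimes>\<^sub>M haar \<rightarrow>\<^sub>M haar6"
  using measurable_add_dim[of p "{..<6}" "\<lambda>_. haar"] by (simp add: insert_absorb)

lemma measurable_upd1: "p < 6 \<Longrightarrow> g \<in> space haar6 \<Longrightarrow> (\<lambda>y. g(p := y)) \<in> haar \<rightarrow>\<^sub>M haar6"
  using measurable_compose[OF measurable_Pair1' measurable_upd, of g p] by simp

lemma bdd_Ep: assumes h: "bdd h" and p: "p < 6" shows "bdd (int_out p h)"
proof -
  obtain B where B: "\<And>g. g \<in> space haar6 \<Longrightarrow> norm (h g) \<le> B" using h by (auto simp: bdd_def)
  have hm: "h \<in> borel_measurable haar6" using h by (simp add: bdd_def)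
  have m: "(\<lambda>(g, y). h (g(p := y))) \<in> borel_measurable (haar6 \<Otimes>\<^sub>M haar)"
    using measurable_compose[OF measurable_upd[OF p] hm] by (simp add: split_def)
  have m1: "int_out p h \<in> borel_measurable haar6"
    unfolding int_out_def[abs_def] using m by (rule haar.borel_measurable_lebesgue_integral)
  show ?thesis
  proof (rule bmI[OF m1])
    fix g assume g: "g \<in> space haar6"
    have int: "integrable haar (\<lambda>y. h (g(p := y)))"
      by (rule haar.integrable_const_bound[of _ B])
         (auto intro!: AE_I2 B space_haar6_upd g p measurable_compose[OF measurable_upd1[OF p g] hm])
    have "norm (int_out p h g) \<le> (\<integral>y. norm (h (g(p := y))) \<partial>haar)" unfolding int_out_def by (rule integral_norm_bound)
    also have "\<dots> \<le> (\<integral>y. B \<partial>haar)"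
      by (rule integral_mono) (use int in \<open>auto intro!: B space_haar6_upd g p\<close>)
    finally show "norm (int_out p h g) \<le> B" by simp
  qed
qed

lemma not_dep_Ep: "not_dep (int_out p h) p"
  by (simp add: not_dep_def int_out_def)

lemma not_dep_Ep': "not_dep h q \<Longrightarrow> not_dep (int_out p h) q"
  by (cases "p = q") (auto simp: not_dep_Ep not_dep_def int_out_def fun_upd_twist)

lemma integral_Ep:
  assumes h: "bdd h" and p: "p < 6"
  shows "(\<integral>g. int_out p h g \<partial>haar6) = (\<integral>g. h g \<partial>haar6)"
proof -
  have I: "insert p ({..<6} - {p}) = {..<6::nat}" using p by auto
  have *: "(\<integral>g. k g \<partial>haar6) = (\<integral>x. (\<integral>y. k (x(p := y)) \<partial>haar) \<partial>PiM ({..<6} - {p}) (\<lambda>_. haar))" 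
    if "bdd k" for k :: "(nat \<Rightarrow> cc) \<Rightarrow> 'a"
    using prod_haar.product_integral_insert[of "{..<6} - {p}" p k] bdd_integrable[OF that] unfolding I by simp
  show ?thesis
    unfolding *[OF h] *[OF bdd_Ep[OF h p]] by (simp add: nodepD[OF not_dep_Ep]) (simp add: int_out_def)
qed

lemma int_out_mult_left: "not_dep c p \<Longrightarrow> int_out p (\<lambda>g. c g * h g) g = c g * int_out p h g"
  unfolding int_out_def by (simp add: nodepD)

lemma int_out_mult_right: "not_dep c p \<Longrightarrow> int_out p (\<lambda>g. h g * c g) g = int_out p h g * c g"
  unfolding int_out_def by (simp add: nodepD)

lemma bdd_integral_mono:
  fixes h h' :: "(nat \<Rightarrow> cc) \<Rightarrow> real"
  assumes "bdd h" "bdd h'" "\<And>g. g \<in> space haar6 \<Longrightarrow> h g \<le> h' g" 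
  shows "(\<integral>g. h g \<partial>haar6) \<le> (\<integral>g. h' g \<partial>haar6)"
  by (rule integral_mono) (use assms bdd_integrable in auto)

definition pick :: "nat \<times> nat \<times> nat \<Rightarrow> (nat \<Rightarrow> cc) \<Rightarrow> triple" where
  "pick v g = (g (fst v), g (fst (snd v)), g (snd (snd v)))"

definition var_set :: "nat \<times> nat \<times> nat \<Rightarrow> nat set" where
  "var_set v = {fst v, fst (snd v), snd (snd v)}"

definition var_ok :: "nat \<times> nat \<times> nat \<Rightarrow> bool" where
  "var_ok v \<longleftrightarrow> var_set v \<subseteq> {..<6} \<and> distinct [fst v, fst (snd v), snd (snd v)]"

text \<open>The two evaluation estimates for linear combinations of the family, one for each choice
  of frozen arguments. They hold at every group element, because the remaining variables of a vertex
  are frozen at arbitrary points. A family is used instead of a space since one end of a line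
  carries the basis and the other its conjugate.\<close>

definition good_sys :: "nat \<Rightarrow> real \<Rightarrow> (nat \<Rightarrow> triple \<Rightarrow> complex) \<Rightarrow> bool" where
  "good_sys m d f \<longleftrightarrow> (\<forall>k<m. f k \<in> borel_measurable haar3) \<and>
    (\<forall>k<m. \<exists>B. \<forall>x\<in>SU2 \<times> SU2 \<times> SU2. cmod (f k x) \<le> B) \<and>
    (\<forall>c. \<forall>a\<in>SU2. \<forall>b\<in>SU2.
       (\<integral>y. (cmod (\<Sum>k<m. f k (y, a, b) * c k))\<^sup>2 \<partial>haar) \<le> d * (\<Sum>k<m. (cmod (c k))\<^sup>2) \<and>
       (\<integral>y. (cmod (\<Sum>k<m. f k (a, y, b) * c k))\<^sup>2 \<partial>haar) \<le> d * (\<Sum>k<m. (cmod (c k))\<^sup>2) \<and>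
       (\<integral>y. (cmod (\<Sum>k<m. f k (a, b, y) * c k))\<^sup>2 \<partial>haar) \<le> d * (\<Sum>k<m. (cmod (c k))\<^sup>2)) \<and>
    (\<forall>c. \<forall>a\<in>SU2.
       (\<integral>z. \<integral>y. (cmod (\<Sum>k<m. f k (a, y, z) * c k))\<^sup>2 \<partial>haar \<partial>haar) \<le> (\<Sum>k<m. (cmod (c k))\<^sup>2) \<and>
       (\<integral>z. \<integral>y. (cmod (\<Sum>k<m. f k (y, a, z) * c k))\<^sup>2 \<partial>haar \<partial>haar) \<le> (\<Sum>k<m. (cmod (c k))\<^sup>2) \<and>
       (\<integral>z. \<integral>y. (cmod (\<Sum>k<m. f k (y, z, a) * c k))\<^sup>2 \<partial>haar \<partial>haar) \<le> (\<Sum>k<m. (cmod (c k))\<^sup>2))"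

lemma good_sysD1:
  assumes "good_sys m d f" "a \<in> SU2" "b \<in> SU2"
  shows "(\<integral>y. (cmod (\<Sum>k<m. f k (y, a, b) * c k))\<^sup>2 \<partial>haar) \<le> d * (\<Sum>k<m. (cmod (c k))\<^sup>2)"
    "(\<integral>y. (cmod (\<Sum>k<m. f k (a, y, b) * c k))\<^sup>2 \<partial>haar) \<le> d * (\<Sum>k<m. (cmod (c k))\<^sup>2)"
    "(\<integral>y. (cmod (\<Sum>k<m. f k (a, b, y) * c k))\<^sup>2 \<partial>haar) \<le> d * (\<Sum>k<m. (cmod (c k))\<^sup>2)"
  using assms unfolding good_sys_def by blast+

lemma good_sysD2:
  assumes "good_sys m d f" "a \<in> SU2"
  shows "(\<integral>z. \<integral>y. (cmod (\<Sum>k<m. f k (a, y, z) * c k))\<^sup>2 \<partial>haar \<partial>haar) \<le> (\<Sum>k<m. (cmod (c k))\<^sup>2)"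
    "(\<integral>z. \<integral>y. (cmod (\<Sum>k<m. f k (y, a, z) * c k))\<^sup>2 \<partial>haar \<partial>haar) \<le> (\<Sum>k<m. (cmod (c k))\<^sup>2)"
    "(\<integral>z. \<integral>y. (cmod (\<Sum>k<m. f k (y, z, a) * c k))\<^sup>2 \<partial>haar \<partial>haar) \<le> (\<Sum>k<m. (cmod (c k))\<^sup>2)"
  using assms unfolding good_sys_def by blast+

lemma measurable_trip: "var_ok v \<Longrightarrow> pick v \<in> haar6 \<rightarrow>\<^sub>M haar3"
  unfolding pick_def[abs_def] haar3_def
  by (intro measurable_Pair measurable_component_singleton) (auto simp: var_ok_def var_set_def)

lemma bdd_trip:
  assumes "good_sys m d f" "k < m" "var_ok v"
  shows "bdd (\<lambda>g. f k (pick v g))"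
proof -
  obtain B where B: "\<forall>x\<in>SU2 \<times> SU2 \<times> SU2. cmod (f k x) \<le> B" and m: "f k \<in> borel_measurable haar3"
    using assms by (auto simp: good_sys_def)
  show ?thesis
  proof (rule bmI[of _ B])
    show "(\<lambda>g. f k (pick v g)) \<in> borel_measurable haar6"
      by (rule measurable_compose[OF measurable_trip[OF assms(3)] m])
    fix g assume "g \<in> space haar6"
    then have "pick v g \<in> SU2 \<times> SU2 \<times> SU2" using assms(3) space_haar6_nth by (auto simp: pick_def var_ok_def var_set_def)
    then show "norm (f k (pick v g)) \<le> B" using B by auto
  qed
qed

lemma not_dep_trip: "p \<notin> var_set v \<Longrightarrow> not_dep (\<lambda>g. f (pick v g)) p"
  by (auto simp: not_dep_def pick_def var_set_def)

text \<open>All variables other than \<open>p\<close> are frozen. The \<open>Y k\<close> then are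
  constant coefficients, and the estimate with two frozen arguments applies: a slot with one free
  variable costs \<open>d\<close>.\<close>

lemma norm2_step1:
  assumes f: "good_sys m d f" and v: "var_ok v" and p: "p \<in> var_set v"
    and Y: "\<And>k. k < m \<Longrightarrow> bdd (Y k)" "\<And>k. k < m \<Longrightarrow> not_dep (Y k) p"
  shows "norm2 (\<lambda>g. \<Sum>k<m. f k (pick v g) * Y k g) \<le> d * (\<Sum>k<m. norm2 (Y k))"
proof -
  have p6: "p < 6" using v p by (auto simp: var_ok_def)
  have b: "bdd (\<lambda>g. (cmod (\<Sum>k<m. f k (pick v g) * Y k g))\<^sup>2)"
    by (intro bdd_power bdd_norm bdd_sum bdd_mult bdd_trip[OF f _ v] Y) auto
  have b': "bdd (\<lambda>g. d * (\<Sum>k<m. (cmod (Y k g))\<^sup>2))"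
    by (intro bdd_mult bdd_const bdd_sum bdd_power bdd_norm Y) auto
  have "norm2 (\<lambda>g. \<Sum>k<m. f k (pick v g) * Y k g) = (\<integral>g. int_out p (\<lambda>g. (cmod (\<Sum>k<m. f k (pick v g) * Y k g))\<^sup>2) g \<partial>haar6)"
    unfolding norm2_def by (rule integral_Ep[OF b p6, symmetric])
  also have "\<dots> \<le> (\<integral>g. d * (\<Sum>k<m. (cmod (Y k g))\<^sup>2) \<partial>haar6)"
  proof (rule bdd_integral_mono[OF bdd_Ep[OF b p6] b'])
    fix g assume g: "g \<in> space haar6"
    have gn: "g q \<in> SU2" if "q \<in> var_set v" for q using v that space_haar6_nth[OF g] by (auto simp: var_ok_def)
    have Yg: "Y k (g(p := y)) = Y k g" if "k < m" for k y using Y(2)[OF that] by (rule nodepD)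
    have "int_out p (\<lambda>g. (cmod (\<Sum>k<m. f k (pick v g) * Y k g))\<^sup>2) g = 
        (\<integral>y. (cmod (\<Sum>k<m. f k (pick v (g(p := y))) * Y k g))\<^sup>2 \<partial>haar)"
      unfolding int_out_def by (simp add: Yg)
    also have "\<dots> \<le> d * (\<Sum>k<m. (cmod (Y k g))\<^sup>2)"
    proof -
      obtain i j k where ijk: "v = (i, j, k)" by (metis surj_pair)
      have S: "g i \<in> SU2" "g j \<in> SU2" "g k \<in> SU2" using gn by (auto simp: var_set_def ijk)
      have ne: "i \<noteq> j" "i \<noteq> k" "j \<noteq> k" using v by (auto simp: var_ok_def ijk)
      consider "p = i" | "p = j" | "p = k" using p by (auto simp: var_set_def ijk)
      then show ?thesis
        using ne good_sysD1(1)[OF f S(2,3), of "\<lambda>k. Y k g"] good_sysD1(2)[OF f S(1,3), of "\<lambda>k. Y k g"]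
          good_sysD1(3)[OF f S(1,2), of "\<lambda>k. Y k g"] 
        by cases (simp_all add: pick_def ijk)
    qed
    finally show "int_out p (\<lambda>g. (cmod (\<Sum>k<m. f k (pick v g) * Y k g))\<^sup>2) g \<le> d * (\<Sum>k<m. (cmod (Y k g))\<^sup>2)" .
  qed
  also have "\<dots> = d * (\<Sum>k<m. norm2 (Y k))"
    unfolding norm2_def by (simp add: bdd_integrable bdd_power bdd_norm Y)
  finally show ?thesis .
qed

text \<open>With two free variables only one argument is frozen, which costs nothing. The pair is
  ordered to match the iterated integrals in \<open>good_sys\<close>.\<close>

lemma norm2_step2_ordered:
  assumes f: "good_sys m d f" and v: "var_ok v" and pq: "(p, q) \<in> {(fst v, fst (snd v)), (fst v, snd (snd v)), (fst (snd v), snd (snd v))}"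
    and Y: "\<And>k. k < m \<Longrightarrow> bdd (Y k)" "\<And>k. k < m \<Longrightarrow> not_dep (Y k) p" "\<And>k. k < m \<Longrightarrow> not_dep (Y k) q"
  shows "norm2 (\<lambda>g. \<Sum>k<m. f k (pick v g) * Y k g) \<le> (\<Sum>k<m. norm2 (Y k))"
proof -
  obtain i j k where ijk: "v = (i, j, k)" by (metis surj_pair)
  have p6: "p < 6" "q < 6" "p \<noteq> q" using v pq by (auto simp: var_ok_def var_set_def ijk)
  let ?h = "\<lambda>g. (cmod (\<Sum>k<m. f k (pick v g) * Y k g))\<^sup>2"
  have b: "bdd ?h"
    by (intro bdd_power bdd_norm bdd_sum bdd_mult bdd_trip[OF f _ v] Y) auto
  have b': "bdd (\<lambda>g. (\<Sum>k<m. (cmod (Y k g))\<^sup>2))"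
    by (intro bdd_sum bdd_power bdd_norm Y) auto
  have "norm2 (\<lambda>g. \<Sum>k<m. f k (pick v g) * Y k g) = (\<integral>g. int_out q (int_out p ?h) g \<partial>haar6)"
    unfolding norm2_def using b p6 by (simp add: integral_Ep bdd_Ep)
  also have "\<dots> \<le> (\<integral>g. (\<Sum>k<m. (cmod (Y k g))\<^sup>2) \<partial>haar6)"
  proof (rule bdd_integral_mono[OF bdd_Ep[OF bdd_Ep[OF b p6(1)] p6(2)] b'])
    fix g assume g: "g \<in> space haar6"
    have gn: "g q \<in> SU2" if "q \<in> var_set v" for q using v that space_haar6_nth[OF g] by (auto simp: var_ok_def)
    have Yg: "Y k (g(q := z, p := y)) = Y k g" if "k < m" for k y z using Y(2,3)[OF that] by (simp add: nodepD)
    have "int_out q (int_out p ?h) g = 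
        (\<integral>z. \<integral>y. (cmod (\<Sum>k<m. f k (pick v (g(q := z, p := y))) * Y k g))\<^sup>2 \<partial>haar \<partial>haar)"
      unfolding int_out_def by (simp add: Yg)
    also have "\<dots> \<le> (\<Sum>k<m. (cmod (Y k g))\<^sup>2)"
    proof -
      have S: "g i \<in> SU2" "g j \<in> SU2" "g k \<in> SU2" using gn by (auto simp: var_set_def ijk)
      have ne: "i \<noteq> j" "i \<noteq> k" "j \<noteq> k" using v by (auto simp: var_ok_def ijk)
      consider "p = i" "q = j" | "p = i" "q = k" | "p = j" "q = k" using pq by (auto simp: ijk)
      then show ?thesis
        using ne good_sysD2(1)[OF f S(1), of "\<lambda>k. Y k g"] good_sysD2(2)[OF f S(2), of "\<lambda>k. Y k g"]
          good_sysD2(3)[OF f S(3), of "\<lambda>k. Y k g"] 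
        by cases (simp_all add: pick_def ijk)
    qed
    finally show "int_out q (int_out p ?h) g \<le> (\<Sum>k<m. (cmod (Y k g))\<^sup>2)" .
  qed
  also have "\<dots> = (\<Sum>k<m. norm2 (Y k))"
    unfolding norm2_def by (simp add: bdd_integrable bdd_power bdd_norm Y)
  finally show ?thesis .
qed

lemma norm2_step2:
  assumes f: "good_sys m d f" and v: "var_ok v" and pq: "p \<in> var_set v" "q \<in> var_set v" "p \<noteq> q"
    and Y: "\<And>k. k < m \<Longrightarrow> bdd (Y k)" "\<And>k. k < m \<Longrightarrow> not_dep (Y k) p" "\<And>k. k < m \<Longrightarrow> not_dep (Y k) q"
  shows "norm2 (\<lambda>g. \<Sum>k<m. f k (pick v g) * Y k g) \<le> (\<Sum>k<m. norm2 (Y k))"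
proof -
  let ?S = "{(fst v, fst (snd v)), (fst v, snd (snd v)), (fst (snd v), snd (snd v))}"
  have "(p, q) \<in> ?S \<or> (q, p) \<in> ?S" using pq by (auto simp: var_set_def)
  then show ?thesis
    using norm2_step2_ordered[OF f v, of p q Y] norm2_step2_ordered[OF f v, of q p Y] Y by blast
qed

section \<open>Operator bounds for the vertex tensors\<close>

definition slot_vars :: "bool \<Rightarrow> nat \<Rightarrow> nat \<times> nat \<times> nat" where
  "slot_vars tet a = (if a = 0 then (0, 1, 2) else if a = 1 then (2, 3, 4)
     else if a = 2 then (if tet then (4, 1, 5) else (4, 3, 5))
     else (if tet then (5, 3, 0) else (5, 1, 0)))"

lemma slotX_eq: "slotX tet a g = pick (slot_vars tet a) g"
  by (simp add: slotX_def slot_vars_def pick_def)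

lemma var_ok_sv: "var_ok (slot_vars tet a)"
  by (simp add: var_ok_def slot_vars_def var_set_def)

lemma not_dep_fun1: "not_dep f p \<Longrightarrow> not_dep (\<lambda>x. h (f x)) p"
  by (simp only: not_dep_def simp_thms)

lemma not_dep_fun2: "not_dep f p \<Longrightarrow> not_dep g p \<Longrightarrow> not_dep (\<lambda>x. h (f x) (g x)) p"
  by (simp only: not_dep_def simp_thms)

text \<open>The adjoint of \<open>norm2_step1\<close>. The sum of squared norms is paired against
  \<open>x\<close> with coefficients \<open>cnj (r k)\<close>; these no longer depend on
  \<open>p\<close>, so \<open>norm2_step1\<close> applies to them, and one square root of the sum
  cancels.\<close>

lemma norm2_Ep_le:
  assumes f: "good_sys m d f" and d: "0 \<le> d" and v: "var_ok v" and p: "p \<in> var_set v" and x: "bdd x"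
  shows "(\<Sum>k<m. norm2 (int_out p (\<lambda>g. f k (pick v g) * x g))) \<le> d * norm2 x"
proof -
  have p6: "p < 6" using v p by (auto simp: var_ok_def)
  define r where "r k = int_out p (\<lambda>g. f k (pick v g) * x g)" for k
  have bfx: "bdd (\<lambda>g. f k (pick v g) * x g)" if "k < m" for k
    using bdd_mult[OF bdd_trip[OF f that v] x] .
  have br: "bdd (r k)" if "k < m" for k unfolding r_def using bdd_Ep[OF bfx[OF that] p6] .
  have nr: "not_dep (\<lambda>g. cnj (r k g)) p" for k unfolding r_def by (rule not_dep_fun1[OF not_dep_Ep])
  define S where "S = (\<Sum>k<m. norm2 (r k))"
  have S0: "0 \<le> S" unfolding S_def by (intro sum_nonneg norm2_nonneg)
  have "complex_of_real (norm2 (r k)) = (\<integral>g. f k (pick v g) * cnj (r k g) * x g \<partial>haar6)" if "k < m" for k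
  proof -
    have "complex_of_real (norm2 (r k)) = (\<integral>g. complex_of_real ((cmod (r k g))\<^sup>2) \<partial>haar6)"
      unfolding norm2_def by (rule integral_complex_of_real[symmetric])
    also have "\<dots> = (\<integral>g. cnj (r k g) * r k g \<partial>haar6)"
      by (intro Bochner_Integration.integral_cong refl) (simp only: complex_norm_square mult.commute)
    also have "\<dots> = (\<integral>g. int_out p (\<lambda>g. cnj (r k g) * (f k (pick v g) * x g)) g \<partial>haar6)"
      by (simp add: int_out_mult_left[OF nr]) (simp add: r_def)
    also have "\<dots> = (\<integral>g. cnj (r k g) * (f k (pick v g) * x g) \<partial>haar6)"
      by (intro integral_Ep bdd_mult bdd_cnj br bfx p6 that)
    finally show ?thesis by (simp add: mult_ac)
  qed
  then have "complex_of_real S = (\<Sum>k<m. \<integral>g. f k (pick v g) * cnj (r k g) * x g \<partial>haar6)"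
    by (simp add: S_def)
  also have "\<dots> = (\<integral>g. (\<Sum>k<m. f k (pick v g) * cnj (r k g) * x g) \<partial>haar6)"
    by (rule Bochner_Integration.integral_sum[symmetric]) (auto intro!: bdd_integrable bdd_mult bdd_cnj br bdd_trip[OF f _ v] x)
  also have "\<dots> = (\<integral>g. (\<Sum>k<m. f k (pick v g) * cnj (r k g)) * x g \<partial>haar6)"
    by (simp add: sum_distrib_right)
  finally have "S = cmod (\<integral>g. (\<Sum>k<m. f k (pick v g) * cnj (r k g)) * x g \<partial>haar6)"
    using S0 by (metis norm_of_real abs_of_nonneg)
  also have "\<dots> \<le> sqrt (norm2 (\<lambda>g. \<Sum>k<m. f k (pick v g) * cnj (r k g))) * sqrt (norm2 x)"
    by (rule bdd_Cauchy_Schwarz) (auto intro!: bdd_sum bdd_mult bdd_cnj br bdd_trip[OF f _ v] x)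
  also have "\<dots> \<le> sqrt (d * S) * sqrt (norm2 x)"
  proof (rule mult_right_mono)
    have "norm2 (\<lambda>g. \<Sum>k<m. f k (pick v g) * cnj (r k g)) \<le> d * (\<Sum>k<m. norm2 (\<lambda>g. cnj (r k g)))"
      by (rule norm2_step1[OF f v p]) (auto intro: bdd_cnj br nr)
    then show "sqrt (norm2 (\<lambda>g. \<Sum>k<m. f k (pick v g) * cnj (r k g))) \<le> sqrt (d * S)"
      by (simp add: S_def norm2_def)
  qed (simp add: norm2_nonneg)
  also have "\<dots> = sqrt d * sqrt (norm2 x) * sqrt S" by (simp add: real_sqrt_mult)
  finally have "S \<le> (sqrt d)\<^sup>2 * norm2 x" by (rule square_le_of_le_sqrt) (use S0 d norm2_nonneg in auto)
  then show ?thesis using d by (simp add: S_def r_def)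
qed

text \<open>Integrating out \<open>p\<close> and \<open>q\<close> first turns the bilinear form into \<open>\<integral> \<Sum> M k j r\<^sub>k s\<^sub>j\<close>, where the
  square sums of \<open>r\<close> and of \<open>s\<close> cost one factor \<open>D\<close> each.\<close>

lemma contract_core:
  assumes fc: "good_sys m D fc" and fd: "good_sys m D fd" and D: "0 \<le> D" 
    and vc: "var_ok vc" and vd: "var_ok vd" and p: "p \<in> var_set vc" "p \<notin> var_set vd" and q: "q \<in> var_set vd" "q \<notin> var_set vc"
    and x: "bdd x" "not_dep x q" and y: "bdd y" "not_dep y p" and M: "mat_bound m M C" "0 \<le> C"
  shows "cmod (\<Sum>k<m. \<Sum>j<m. M k j * (\<integral>g. (fc k (pick vc g) * x g) * (fd j (pick vd g) * y g) \<partial>haar6))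
     \<le> C * D * sqrt (norm2 x) * sqrt (norm2 y)"
proof -
  have p6: "p < 6" "q < 6" using vc vd p q by (auto simp: var_ok_def)
  define r where "r k = int_out p (\<lambda>g. fc k (pick vc g) * x g)" for k
  define s where "s j = int_out q (\<lambda>g. fd j (pick vd g) * y g)" for j
  have bcx: "bdd (\<lambda>g. fc k (pick vc g) * x g)" if "k < m" for k using bdd_mult[OF bdd_trip[OF fc that vc] x(1)] .
  have bdy: "bdd (\<lambda>g. fd k (pick vd g) * y g)" if "k < m" for k using bdd_mult[OF bdd_trip[OF fd that vd] y(1)] .
  have br: "bdd (r k)" if "k < m" for k unfolding r_def using bdd_Ep[OF bcx[OF that] p6(1)] .
  have bs: "bdd (s k)" if "k < m" for k unfolding s_def using bdd_Ep[OF bdy[OF that] p6(2)] .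
  have ncx: "not_dep (\<lambda>g. fc k (pick vc g) * x g) q" for k
    by (rule not_dep_fun2[OF not_dep_trip[OF q(2)] x(2)])
  have ndy: "not_dep (\<lambda>g. fd k (pick vd g) * y g) p" for k
    by (rule not_dep_fun2[OF not_dep_trip[OF p(2)] y(2)])
  have rs: "(\<integral>g. (fc k (pick vc g) * x g) * (fd j (pick vd g) * y g) \<partial>haar6) = (\<integral>g. r k g * s j g \<partial>haar6)"
    if k: "k < m" and j: "j < m" for k j
  proof -
    have "(\<integral>g. (fc k (pick vc g) * x g) * (fd j (pick vd g) * y g) \<partial>haar6)
        = (\<integral>g. int_out p (\<lambda>g. (fc k (pick vc g) * x g) * (fd j (pick vd g) * y g)) g \<partial>haar6)"
      by (intro integral_Ep[symmetric] bdd_mult bcx bdy k j p6)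
    also have "\<dots> = (\<integral>g. r k g * (fd j (pick vd g) * y g) \<partial>haar6)"
      by (simp add: int_out_mult_right[OF ndy] r_def)
    also have "\<dots> = (\<integral>g. int_out q (\<lambda>g. r k g * (fd j (pick vd g) * y g)) g \<partial>haar6)"
      by (intro integral_Ep[symmetric] bdd_mult[OF br bdy] k j p6)
    also have "\<dots> = (\<integral>g. r k g * s j g \<partial>haar6)"
      using not_dep_Ep'[OF ncx, of p k] unfolding r_def[symmetric] by (simp add: int_out_mult_left s_def)
    finally show ?thesis .
  qed
  let ?R = "\<lambda>g. sqrt (\<Sum>k<m. (cmod (r k g))\<^sup>2)" and ?S = "\<lambda>g. sqrt (\<Sum>j<m. (cmod (s j g))\<^sup>2)"
  have bR: "bdd ?R" by (intro bdd_sqrt bdd_sum bdd_power bdd_norm br) auto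
  have bS: "bdd ?S" by (intro bdd_sqrt bdd_sum bdd_power bdd_norm bs) auto
  have R2: "(\<integral>g. (?R g)\<^sup>2 \<partial>haar6) \<le> D * norm2 x"
    using norm2_Ep_le[OF fc D vc p(1) x(1)] unfolding r_def[symmetric] norm2_def
    by (simp add: sum_nonneg bdd_integrable bdd_power bdd_norm br)
  have S2: "(\<integral>g. (?S g)\<^sup>2 \<partial>haar6) \<le> D * norm2 y"
    using norm2_Ep_le[OF fd D vd q(1) y(1)] unfolding s_def[symmetric] norm2_def
    by (simp add: sum_nonneg bdd_integrable bdd_power bdd_norm bs)
  have bsum: "bdd (\<lambda>g. \<Sum>k<m. \<Sum>j<m. M k j * r k g * s j g)"
    by (intro bdd_sum bdd_mult bdd_const br bs) auto
  have "(\<Sum>k<m. \<Sum>j<m. M k j * (\<integral>g. (fc k (pick vc g) * x g) * (fd j (pick vd g) * y g) \<partial>haar6))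
      = (\<Sum>k<m. \<Sum>j<m. M k j * (\<integral>g. r k g * s j g \<partial>haar6))" by (simp add: rs)
  also have "\<dots> = (\<Sum>k<m. \<Sum>j<m. \<integral>g. M k j * r k g * s j g \<partial>haar6)"
    by (simp add: mult.assoc)
  also have "\<dots> = (\<Sum>k<m. \<integral>g. (\<Sum>j<m. M k j * r k g * s j g) \<partial>haar6)"
    by (rule sum.cong[OF refl], rule Bochner_Integration.integral_sum[symmetric]) (auto intro!: bdd_integrable bdd_mult bdd_const br bs)
  also have "\<dots> = (\<integral>g. (\<Sum>k<m. \<Sum>j<m. M k j * r k g * s j g) \<partial>haar6)"
    by (intro Bochner_Integration.integral_sum[symmetric] bdd_integrable bdd_sum bdd_mult bdd_const br bs) auto
  also have "cmod \<dots> \<le> (\<integral>g. cmod (\<Sum>k<m. \<Sum>j<m. M k j * r k g * s j g) \<partial>haar6)"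
    by (rule integral_norm_bound)
  also have "\<dots> \<le> (\<integral>g. C * (?R g * ?S g) \<partial>haar6)"
    by (rule bdd_integral_mono[OF bdd_norm[OF bsum] bdd_mult[OF bdd_const bdd_mult[OF bR bS]]])
       (use M(1) in \<open>simp add: mat_bound_def mult.assoc\<close>)
  also have "\<dots> = C * (\<integral>g. ?R g * ?S g \<partial>haar6)" by simp
  also have "\<dots> \<le> C * (sqrt (D * norm2 x) * sqrt (D * norm2 y))"
  proof (rule mult_left_mono[OF _ M(2)])
    have "(\<integral>g. ?R g * ?S g \<partial>haar6) \<le> \<bar>\<integral>g. ?R g * ?S g \<partial>haar6\<bar>" by simp
    also have "\<dots> \<le> sqrt (\<integral>g. (?R g)\<^sup>2 \<partial>haar6) * sqrt (\<integral>g. (?S g)\<^sup>2 \<partial>haar6)"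
      by (rule integral_Cauchy_Schwarz) (intro bdd_integrable bdd_power bdd_mult bR bS)+
    also have "\<dots> \<le> sqrt (D * norm2 x) * sqrt (D * norm2 y)"
      by (intro mult_mono real_sqrt_le_mono R2 S2) (auto intro!: integral_nonneg_AE simp: D norm2_nonneg)
    finally show "(\<integral>g. ?R g * ?S g \<partial>haar6) \<le> sqrt (D * norm2 x) * sqrt (D * norm2 y)" .
  qed
  also have "\<dots> = C * D * sqrt (norm2 x) * sqrt (norm2 y)"
    using D by (simp add: real_sqrt_mult)
  finally show ?thesis .
qed

lemma mat_bound_transpose: "mat_bound m M C \<Longrightarrow> mat_bound m (\<lambda>k j. M j k) C"
  unfolding mat_bound_def
proof (intro allI)
  fix r s :: "nat \<Rightarrow> complex"
  assume "\<forall>r s. cmod (\<Sum>k<m. \<Sum>j<m. M k j * r k * s j) \<le> C * sqrt (\<Sum>k<m. (cmod (r k))\<^sup>2) * sqrt (\<Sum>j<m. (cmod (s j))\<^sup>2)"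
  then have "cmod (\<Sum>k<m. \<Sum>j<m. M k j * s k * r j) \<le> C * sqrt (\<Sum>k<m. (cmod (s k))\<^sup>2) * sqrt (\<Sum>j<m. (cmod (r j))\<^sup>2)" by blast
  then show "cmod (\<Sum>k<m. \<Sum>j<m. M j k * r k * s j) \<le> C * sqrt (\<Sum>k<m. (cmod (r k))\<^sup>2) * sqrt (\<Sum>j<m. (cmod (s j))\<^sup>2)"
    by (subst sum.swap) (simp add: mult_ac)
qed

text \<open>Every variable sits in exactly two slots. The claim thus says that the contracted slots
  \<open>c\<close> and \<open>e\<close> can be paired with \<open>a\<close> and \<open>b\<close> so
  that paired slots share a variable. In a tetrahedron any two slots share one; in a pillow the
  slots sharing variables are the neighbours in the cycle 0, 1, 2, 3. A finite check covers both
  types.\<close>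

lemma slots_share_list:
  "\<forall>ty\<in>set [True, False]. \<forall>a\<in>set [0..<4]. \<forall>b\<in>set [0..<4]. \<forall>c\<in>set [0..<4]. \<forall>e\<in>set [0..<4]. distinct [a, b, c, e] \<longrightarrow>
     (\<exists>p\<in>set [0..<6]. \<exists>q\<in>set [0..<6]. p \<in> var_set (slot_vars ty c) \<and> p \<notin> var_set (slot_vars ty e) \<and> p \<notin> var_set (slot_vars ty b) \<and>
            q \<in> var_set (slot_vars ty e) \<and> q \<notin> var_set (slot_vars ty c) \<and> q \<notin> var_set (slot_vars ty a)) \<or>
     (\<exists>p\<in>set [0..<6]. \<exists>q\<in>set [0..<6]. p \<in> var_set (slot_vars ty c) \<and> p \<notin> var_set (slot_vars ty e) \<and> p \<notin> var_set (slot_vars ty a) \<and>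
            q \<in> var_set (slot_vars ty e) \<and> q \<notin> var_set (slot_vars ty c) \<and> q \<notin> var_set (slot_vars ty b))"
  by code_simp

lemma slots_share:
  assumes "{a, b, c, e} = {..<4::nat}"
  shows "(\<exists>p q. p \<in> var_set (slot_vars ty c) \<and> p \<notin> var_set (slot_vars ty e) \<and> p \<notin> var_set (slot_vars ty b) \<and>
            q \<in> var_set (slot_vars ty e) \<and> q \<notin> var_set (slot_vars ty c) \<and> q \<notin> var_set (slot_vars ty a)) \<or>
         (\<exists>p q. p \<in> var_set (slot_vars ty c) \<and> p \<notin> var_set (slot_vars ty e) \<and> p \<notin> var_set (slot_vars ty a) \<and>
            q \<in> var_set (slot_vars ty e) \<and> q \<notin> var_set (slot_vars ty c) \<and> q \<notin> var_set (slot_vars ty b))"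
proof -
  have "card {a, b, c, e} = 4" using assms by simp
  then have dist: "distinct [a, b, c, e]"
    by (auto simp: card_insert_if split: if_splits)
  have "a < 4" "b < 4" "c < 4" "e < 4" using assms by auto
  then have "a \<in> set [0..<4]" "b \<in> set [0..<4]" "c \<in> set [0..<4]" "e \<in> set [0..<4]" by auto
  moreover have "ty \<in> set [True, False]" by simp
  ultimately show ?thesis using slots_share_list dist by blast
qed

text \<open>Each slot has its own family, because some slots of a vertex carry the basis and others
  its conjugate.\<close>

locale vertex_sys =
  fixes m :: nat and D :: real and ty :: bool and f :: "nat \<Rightarrow> nat \<Rightarrow> triple \<Rightarrow> complex"
  assumes good: "a < 4 \<Longrightarrow> good_sys m D (f a)" and D1: "1 \<le> D"
begin

definition Phi :: "nat set \<Rightarrow> (nat \<Rightarrow> nat) \<Rightarrow> (nat \<Rightarrow> cc) \<Rightarrow> complex" where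
  "Phi A p g = (\<Prod>a\<in>A. f a (p a) (pick (slot_vars ty a) g))"

definition S :: "nat set \<Rightarrow> ((nat \<Rightarrow> nat) \<Rightarrow> complex) \<Rightarrow> (nat \<Rightarrow> nat) \<Rightarrow> (nat \<Rightarrow> cc) \<Rightarrow> complex" where
  "S A F l g = sumE m A (\<lambda>p. F p * Phi A p g) l"

text \<open>\<open>S A\<close> synthesises a function of the six group variables from coefficients
  on the legs \<open>A\<close>, and \<open>k\<close> bounds the square of its norm. A bilinear
  estimate between two groups of legs therefore collects only square roots.\<close>

definition R :: "nat set \<Rightarrow> real \<Rightarrow> bool" where
  "R A k \<longleftrightarrow> (\<forall>F l. norm2 (S A F l) \<le> k * sumE m A (\<lambda>p. (cmod (F p))\<^sup>2) l)"

definition tau :: "(nat \<Rightarrow> nat) \<Rightarrow> complex" where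
  "tau p = (\<integral>g. Phi {..<4} p g \<partial>haar6)"

lemma bdd_Phi: "A \<subseteq> {..<4} \<Longrightarrow> (\<And>a. a \<in> A \<Longrightarrow> p a < m) \<Longrightarrow> bdd (Phi A p)"
  unfolding Phi_def[abs_def] by (intro bdd_prod bdd_trip[OF good _ var_ok_sv]) (auto intro: finite_subset)

lemma bdd_S: "A \<subseteq> {..<4} \<Longrightarrow> bdd (S A F l)"
  unfolding S_def[abs_def] sumE_def
  by (intro bdd_sum bdd_mult bdd_const bdd_Phi finite_PiE) (auto intro: finite_subset simp: PiE_iff)

lemma not_dep_S: "(\<And>a. a \<in> A \<Longrightarrow> p \<notin> var_set (slot_vars ty a)) \<Longrightarrow> not_dep (S A F l) p"
proof -
  assume *: "\<And>a. a \<in> A \<Longrightarrow> p \<notin> var_set (slot_vars ty a)"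
  have "Phi A l (g(p := y)) = Phi A l g" for l g y
    unfolding Phi_def by (intro prod.cong refl nodepD[OF not_dep_trip] *)
  then show ?thesis by (simp add: not_dep_def S_def)
qed

lemma indep_Phi: "indep (\<lambda>p. Phi A p g) (- A)"
  unfolding indep_def Phi_def by auto

lemma S_insert:
  assumes "c \<notin> A" "finite A"
  shows "S (insert c A) F l g = (\<Sum>k<m. f c k (pick (slot_vars ty c) g) * S A F (l(c := k)) g)"
proof -
  have "sumE m A (\<lambda>p. F p * Phi (insert c A) p g) (l(c := k)) = f c k (pick (slot_vars ty c) g) * S A F (l(c := k)) g" for k
  proof -
    have "sumE m A (\<lambda>p. F p * Phi (insert c A) p g) (l(c := k)) = sumE m A (\<lambda>p. f c k (pick (slot_vars ty c) g) * (F p * Phi A p g)) (l(c := k))"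
      by (intro sumE_cong) (use assms in \<open>simp add: Phi_def mult_ac\<close>)
    then show ?thesis by (simp add: sumE_cmult S_def)
  qed
  then show ?thesis using assms by (simp add: S_def[of "insert c A"] sumE_insert)
qed

lemma R_empty: "R {} 1"
  by (simp add: R_def S_def Phi_def norm2_def haar6.prob_space)

lemma R_mono: "R A k \<Longrightarrow> k \<le> k' \<Longrightarrow> R A k'"
  unfolding R_def by (meson mult_right_mono order_trans sumE_nonneg zero_le_power2)

text \<open>Attaches slot \<open>c\<close> to a group of slots. The hypothesis \<open>step\<close>
  stands for whichever evaluation estimate the fresh variables of \<open>c\<close> allow; the
  functions \<open>Y i\<close> may depend only on variables already in use.\<close>

lemma R_insert:
  assumes R: "R A k" and A: "A \<subseteq> {..<4}" "c < 4" "c \<notin> A"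
    and step: "\<And>Y. (\<And>i. i < m \<Longrightarrow> bdd (Y i)) \<Longrightarrow> (\<And>i p. i < m \<Longrightarrow> p \<notin> (\<Union>a\<in>A. var_set (slot_vars ty a)) \<Longrightarrow> not_dep (Y i) p) \<Longrightarrow>
       norm2 (\<lambda>g. \<Sum>i<m. f c i (pick (slot_vars ty c) g) * Y i g) \<le> k' * (\<Sum>i<m. norm2 (Y i))" and k': "0 \<le> k'"
  shows "R (insert c A) (k' * k)"
  unfolding R_def
proof (intro allI)
  fix F :: "(nat \<Rightarrow> nat) \<Rightarrow> complex" and l
  have fA: "finite A" using A(1) finite_subset by auto
  have "norm2 (S (insert c A) F l) = norm2 (\<lambda>g. \<Sum>i<m. f c i (pick (slot_vars ty c) g) * S A F (l(c := i)) g)"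
    by (simp add: S_insert[OF A(3) fA, abs_def])
  also have "\<dots> \<le> k' * (\<Sum>i<m. norm2 (S A F (l(c := i))))"
    by (rule step) (auto intro!: bdd_S A not_dep_S)
  also have "\<dots> \<le> k' * (\<Sum>i<m. k * sumE m A (\<lambda>p. (cmod (F p))\<^sup>2) (l(c := i)))"
    using R k' by (intro mult_left_mono sum_mono) (auto simp: R_def)
  also have "\<dots> = k' * k * sumE m (insert c A) (\<lambda>p. (cmod (F p))\<^sup>2) l"
    using A(3) by (simp add: sumE_insert sum_distrib_left mult.assoc)
  finally show "norm2 (S (insert c A) F l) \<le> k' * k * sumE m (insert c A) (\<lambda>p. (cmod (F p))\<^sup>2) l" .
qed

lemma R_insert1:
  assumes "R A k" "A \<subseteq> {..<4}" "c < 4" "c \<notin> A" "p \<in> var_set (slot_vars ty c)" "p \<notin> (\<Union>a\<in>A. var_set (slot_vars ty a))"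
  shows "R (insert c A) (D * k)"
  by (rule R_insert[OF assms(1-4)], rule norm2_step1[OF good var_ok_sv]) (use assms D1 in auto)

lemma R_insert2:
  assumes "R A k" "A \<subseteq> {..<4}" "c < 4" "c \<notin> A" 
    "p \<in> var_set (slot_vars ty c)" "p \<notin> (\<Union>a\<in>A. var_set (slot_vars ty a))" "q \<in> var_set (slot_vars ty c)" "q \<notin> (\<Union>a\<in>A. var_set (slot_vars ty a))" "p \<noteq> q"
  shows "R (insert c A) k"
proof -
  have "R (insert c A) (1 * k)"
    by (rule R_insert[OF assms(1-4)], simp, rule norm2_step2[OF good var_ok_sv assms(5,7,9)]) (use assms in auto)
  then show ?thesis by simp
qed

lemma R_single: 
  assumes c: "c < 4" shows "R {c} 1"
proof -
  have "\<exists>p q. p \<in> var_set (slot_vars ty c) \<and> q \<in> var_set (slot_vars ty c) \<and> p \<noteq> q"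
    using var_ok_sv[of ty c] unfolding var_ok_def var_set_def by auto
  then obtain p q where pq: "p \<in> var_set (slot_vars ty c)" "q \<in> var_set (slot_vars ty c)" "p \<noteq> q" by blast
  show ?thesis by (rule R_insert2[OF R_empty _ c _ pq(1) _ pq(2) _ pq(3)]) simp_all
qed

text \<open>Any two slots of a tetrahedron share exactly one variable. A second slot therefore
  brings two fresh variables and is free, while a third brings only one and costs
  \<open>D\<close>.\<close>

lemma R_tetrahedron:
  assumes T: "ty"
  shows "R {1, 0} 1" "R {2, 0} 1" "R {3, 0} 1" "R {2, 1} 1" "R {3, 1} 1" "R {3, 2} 1" "R {2, 1, 0} (D * 1)" "R {3, 1, 0} (D * 1)" "R {3, 2, 0} (D * 1)" "R {3, 2, 1} (D * 1)"
proof -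
  show "R {1, 0} 1" using R_insert2[OF R_single[of 0], of 1 3 4] T by (simp add: slot_vars_def var_set_def)
  show "R {2, 0} 1" using R_insert2[OF R_single[of 0], of 2 4 5] T by (simp add: slot_vars_def var_set_def)
  show "R {3, 0} 1" using R_insert2[OF R_single[of 0], of 3 5 3] T by (simp add: slot_vars_def var_set_def)
  show "R {2, 1} 1" using R_insert2[OF R_single[of 1], of 2 1 5] T by (simp add: slot_vars_def var_set_def)
  show "R {3, 1} 1" using R_insert2[OF R_single[of 1], of 3 5 0] T by (simp add: slot_vars_def var_set_def)
  show "R {3, 2} 1" using R_insert2[OF R_single[of 2], of 3 3 0] T by (simp add: slot_vars_def var_set_def)
  have *: "R {1, 0} 1" using R_insert2[OF R_single[of 0], of 1 3 4] T by (simp add: slot_vars_def var_set_def)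
  show "R {2, 1, 0} (D * 1)" using R_insert1[OF *, of 2 5] T by (simp add: slot_vars_def var_set_def)
  have *: "R {1, 0} 1" using R_insert2[OF R_single[of 0], of 1 3 4] T by (simp add: slot_vars_def var_set_def)
  show "R {3, 1, 0} (D * 1)" using R_insert1[OF *, of 3 5] T by (simp add: slot_vars_def var_set_def)
  have *: "R {2, 0} 1" using R_insert2[OF R_single[of 0], of 2 4 5] T by (simp add: slot_vars_def var_set_def)
  show "R {3, 2, 0} (D * 1)" using R_insert1[OF *, of 3 3] T by (simp add: slot_vars_def var_set_def)
  have *: "R {2, 1} 1" using R_insert2[OF R_single[of 1], of 2 1 5] T by (simp add: slot_vars_def var_set_def)
  show "R {3, 2, 1} (D * 1)" using R_insert1[OF *, of 3 0] T by (simp add: slot_vars_def var_set_def)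
qed

text \<open>Here the order matters. After the disjoint slots 0 and 2, slot 3 has no fresh variable
  left, so \<open>{0, 2, 3}\<close> is built by adding slot 3 to slot 0 at cost \<open>D\<close> and
  then slot 2 for free. The group \<open>{1, 2, 3}\<close> is treated in the same way.\<close>

lemma R_pillow:
  assumes T: "\<not> ty"
  shows "R {1, 0} 1" "R {2, 0} 1" "R {3, 0} (D * 1)" "R {2, 1} (D * 1)" "R {3, 1} 1" "R {3, 2} 1" "R {2, 1, 0} (D * 1)" "R {3, 1, 0} (D * 1)" "R {2, 3, 0} (D * 1)" "R {3, 2, 1} (D * 1)"
proof -
  show "R {1, 0} 1" using R_insert2[OF R_single[of 0], of 1 3 4] T by (simp add: slot_vars_def var_set_def)
  show "R {2, 0} 1" using R_insert2[OF R_single[of 0], of 2 4 3] T by (simp add: slot_vars_def var_set_def)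
  show "R {3, 0} (D * 1)" using R_insert1[OF R_single[of 0], of 3 5] T by (simp add: slot_vars_def var_set_def)
  show "R {2, 1} (D * 1)" using R_insert1[OF R_single[of 1], of 2 5] T by (simp add: slot_vars_def var_set_def)
  show "R {3, 1} 1" using R_insert2[OF R_single[of 1], of 3 5 1] T by (simp add: slot_vars_def var_set_def)
  show "R {3, 2} 1" using R_insert2[OF R_single[of 2], of 3 1 0] T by (simp add: slot_vars_def var_set_def)
  have *: "R {1, 0} 1" using R_insert2[OF R_single[of 0], of 1 3 4] T by (simp add: slot_vars_def var_set_def)
  show "R {2, 1, 0} (D * 1)" using R_insert1[OF *, of 2 5] T by (simp add: slot_vars_def var_set_def)
  have *: "R {1, 0} 1" using R_insert2[OF R_single[of 0], of 1 3 4] T by (simp add: slot_vars_def var_set_def)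
  show "R {3, 1, 0} (D * 1)" using R_insert1[OF *, of 3 5] T by (simp add: slot_vars_def var_set_def)
  have *: "R {3, 0} (D * 1)" using R_insert1[OF R_single[of 0], of 3 5] T by (simp add: slot_vars_def var_set_def)
  show "R {2, 3, 0} (D * 1)" using R_insert2[OF *, of 2 4 3] T by (simp add: slot_vars_def var_set_def)
  have *: "R {2, 1} (D * 1)" using R_insert1[OF R_single[of 1], of 2 5] T by (simp add: slot_vars_def var_set_def)
  show "R {3, 2, 1} (D * 1)" using R_insert2[OF *, of 3 1 0] T by (simp add: slot_vars_def var_set_def)
qed


text \<open>In a suitable order, at most one slot of a proper group has just one fresh variable,
  while all others have at least two. Hence the factor \<open>D\<close> is paid at most
  once.\<close>

lemma R_proper:
  assumes "A \<subseteq> {..<4}" "A \<noteq> {}" "A \<noteq> {..<4}"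
  shows "R A D"
proof -
  have mono: "R B 1 \<Longrightarrow> R B D" for B using R_mono[of B 1 D] D1 by simp
  have 4: "{..<4} = {0, 1, 2, 3 :: nat}" by auto
  have D: "R B (D * 1) \<Longrightarrow> R B D" for B by simp
  note T = R_tetrahedron R_pillow
  note S = R_single[of 0] R_single[of 1] R_single[of 2] R_single[of 3]
  have A: "A = (if 0 \<in> A then {0} else {}) \<union> (if 1 \<in> A then {1} else {}) \<union> (if 2 \<in> A then {2} else {}) \<union> (if 3 \<in> A then {3} else {})"
    using assms(1) unfolding 4 by auto
  have all: "R {0} D" "R {1} D" "R {2} D" "R {3} D" "R {0,1} D" "R {0,2} D" "R {0,3} D" "R {1,2} D" "R {1,3} D" "R {2,3} D"
     "R {0,1,2} D" "R {0,1,3} D" "R {0,2,3} D" "R {1,2,3} D"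
  proof -
    show "R {0} D" "R {1} D" "R {2} D" "R {3} D" using S mono by auto
    show "R {0,1} D" "R {0,2} D" "R {0,3} D" "R {1,2} D" "R {1,3} D" "R {2,3} D"
     "R {0,1,2} D" "R {0,1,3} D" "R {0,2,3} D" "R {1,2,3} D"
      by (cases ty; use T mono D in \<open>force simp: insert_commute\<close>)+
  qed
  show ?thesis
    by (subst A, cases "0 \<in> A"; cases "1 \<in> A"; cases "2 \<in> A"; cases "3 \<in> A")
       (use all assms 4 A in \<open>simp_all add: insert_commute\<close>)
qed

lemma integral_sumE:
  assumes "finite A" and "\<And>p. (\<And>a. a \<in> A \<Longrightarrow> p a < m) \<Longrightarrow> (\<And>a. a \<notin> A \<Longrightarrow> p a = l a) \<Longrightarrow> bdd (\<lambda>g. h p g)"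
  shows "sumE m A (\<lambda>p. \<integral>g. h p g \<partial>haar6) l = (\<integral>g. sumE m A (\<lambda>p. h p g) l \<partial>haar6)"
  unfolding sumE_def
  by (rule Bochner_Integration.integral_sum[symmetric], rule bdd_integrable, rule assms(2)) (auto simp: PiE_iff)

lemma tau_indep: "indep tau (- {..<4})"
  using indep_Phi[of "{..<4}"] by (auto simp: indep_def tau_def intro!: Bochner_Integration.integral_cong)

text \<open>Cauchy-Schwarz between the two groups of legs. Both are proper, so by
  \<open>R_proper\<close> each side contributes the square root of \<open>D\<close>.\<close>

lemma tau_split:
  assumes A: "A \<subseteq> {..<4}" "A \<noteq> {}" "A \<noteq> {..<4}"
  shows "op_bound m A ({..<4} - A) tau D"
proof -
  define B where "B = {..<4} - A"
  have AB: "A \<union> B = {..<4}" "A \<inter> B = {}" "finite A" "finite B" "B \<subseteq> {..<4}"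
    using A finite_subset[OF A(1)] by (auto simp: B_def)
  have "B \<noteq> {}" "B \<noteq> {..<4}" using A by (auto simp: B_def)
  then have RA: "R A D" and RB: "R B D" using R_proper A AB by auto
  have "op_bound m A B tau D"
  proof (rule op_bound_bilinearI)
    fix F H :: "(nat \<Rightarrow> nat) \<Rightarrow> complex" and l assume F: "indep F B" and H: "indep H A"
    have Phi: "Phi {..<4} p g = Phi B p g * Phi A p g" for p g
      unfolding AB(1)[symmetric] Phi_def using AB by (subst prod.union_disjoint) (auto simp: mult.commute)
    have "sumE m (B \<union> A) (\<lambda>p. H p * (F p * tau p)) l = sumE m (B \<union> A) (\<lambda>p. \<integral>g. H p * (F p * Phi {..<4} p g) \<partial>haar6) l"
      by (simp add: tau_def)
    also have "\<dots> = (\<integral>g. sumE m (B \<union> A) (\<lambda>p. H p * (F p * Phi {..<4} p g)) l \<partial>haar6)"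
      by (rule integral_sumE) (use AB in \<open>auto intro!: bdd_mult bdd_const bdd_Phi\<close>)
    also have "\<dots> = (\<integral>g. S B H l g * S A F l g \<partial>haar6)"
    proof (intro Bochner_Integration.integral_cong refl)
      fix g
      have iH: "indep (\<lambda>p. H p * Phi B p g) A"
        by (rule indep_fun2[OF H indep_mono[OF indep_Phi]]) (use AB in auto)
      have iF: "indep (\<lambda>p. F p * Phi A p g) B"
        by (rule indep_fun2[OF F indep_mono[OF indep_Phi]]) (use AB in auto)
      have "sumE m (B \<union> A) (\<lambda>p. H p * (F p * Phi {..<4} p g)) l = sumE m B (sumE m A (\<lambda>p. (H p * Phi B p g) * (F p * Phi A p g))) l"
      proof -
        have "(\<lambda>p. H p * (F p * Phi {..<4} p g)) = (\<lambda>p. (H p * Phi B p g) * (F p * Phi A p g))"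
          by (simp add: Phi fun_eq_iff mult_ac)
        then show ?thesis using AB by (simp only:) (rule sumE_Un, auto)
      qed
      also have "\<dots> = sumE m B (\<lambda>l. S A F l g * (H l * Phi B l g)) l"
        by (rule sumE_cong, subst sumE_mult_left[OF iH], simp only: S_def, rule mult.commute)
      also have "\<dots> = S A F l g * S B H l g"
        unfolding S_def[of B] by (rule sumE_mult_left) (unfold S_def, rule indep_sumE[OF iF])
      finally show "sumE m (B \<union> A) (\<lambda>p. H p * (F p * Phi {..<4} p g)) l = S B H l g * S A F l g"
        by (simp add: mult.commute)
    qed
    finally have "cmod (sumE m (B \<union> A) (\<lambda>p. H p * (F p * tau p)) l) = cmod (\<integral>g. S B H l g * S A F l g \<partial>haar6)"
      by (simp only:)
    also have "\<dots> \<le> sqrt (norm2 (S B H l)) * sqrt (norm2 (S A F l))"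
      by (rule bdd_Cauchy_Schwarz[OF bdd_S[OF AB(5)] bdd_S[OF A(1)]])
    also have "\<dots> \<le> sqrt (D * sumE m B (\<lambda>l. (cmod (H l))\<^sup>2) l) * sqrt (D * sumE m A (\<lambda>l. (cmod (F l))\<^sup>2) l)"
    proof -
      have 1: "norm2 (S B H l) \<le> D * sumE m B (\<lambda>l. (cmod (H l))\<^sup>2) l" using RB unfolding R_def by blast
      have 2: "norm2 (S A F l) \<le> D * sumE m A (\<lambda>l. (cmod (F l))\<^sup>2) l" using RA unfolding R_def by blast
      show ?thesis using order_trans[OF norm2_nonneg 1] order_trans[OF norm2_nonneg 2]
        by (intro mult_mono real_sqrt_le_mono 1 2 real_sqrt_ge_zero norm2_nonneg)
    qed
    also have "\<dots> = D * sqrt (sumE m A (\<lambda>l. (cmod (F l))\<^sup>2) l) * sqrt (sumE m B (\<lambda>l. (cmod (H l))\<^sup>2) l)"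
      using D1 by (simp add: real_sqrt_mult)
    finally show "cmod (sumE m (B \<union> A) (\<lambda>l. H l * (F l * tau l)) l)
       \<le> D * sqrt (sumE m A (\<lambda>l. (cmod (F l))\<^sup>2) l) * sqrt (sumE m B (\<lambda>l. (cmod (H l))\<^sup>2) l)" .
  qed (use D1 in simp, (rule AB)+)
  then show ?thesis unfolding B_def .
qed

text \<open>The legs \<open>a\<close> and \<open>b\<close> yield functions \<open>x\<close> and
  \<open>y\<close> whose norms are at most those of their coefficients, by \<open>R_single\<close>.
  The contraction with \<open>M\<close> then costs \<open>D * C\<close> through
  \<open>contract_core\<close>, where \<open>p\<close> and \<open>q\<close> are variables that a
  contracted slot shares with an open one.\<close>

lemma tau_contract:
  assumes abcd: "{a, b, c, e} = {..<4}" and M: "mat_bound m M C" "0 \<le> C"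
  shows "op_bound m {a} {b} (\<lambda>p. \<Sum>k<m. \<Sum>j<m. M k j * tau (p(c := k, e := j))) (D * C)"
proof (rule op_bound_bilinearI)
  have "card {a, b, c, e} = 4" using abcd by simp
  then have dist: "a \<noteq> b" "a \<noteq> c" "a \<noteq> e" "b \<noteq> c" "b \<noteq> e" "c \<noteq> e"
    by (auto simp: card_insert_if split: if_splits)
  have lt: "a < 4" "b < 4" "c < 4" "e < 4" using abcd by auto
  show "{a} \<inter> {b} = {}" using dist by simp
  fix F H :: "(nat \<Rightarrow> nat) \<Rightarrow> complex" and l assume F: "indep F {b}" and H: "indep H {a}"
  define xf where "xf i = F (l(a := i))" for i
  define yf where "yf j = H (l(b := j))" for j
  have FH: "F (l(b := j, a := i)) = xf i" "H (l(b := j, a := i)) = yf j" for i j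
    unfolding xf_def yf_def by (rule indepD[OF F], simp, rule indepD[OF H], simp)
  define x where "x g = (\<Sum>i<m. xf i * f a i (pick (slot_vars ty a) g))" for g
  define y where "y g = (\<Sum>j<m. yf j * f b j (pick (slot_vars ty b) g))" for g
  have bf: "bdd (\<lambda>g. f s i (pick (slot_vars ty s) g))" if "s < 4" "i < m" for s i
    by (rule bdd_trip[OF good[OF that(1)] that(2) var_ok_sv])
  have bx: "bdd x" and bY: "bdd y" unfolding x_def[abs_def] y_def[abs_def]
    by (intro bdd_sum bdd_mult bdd_const bf lt; simp)+
  have nx: "not_dep x p" if "p \<notin> var_set (slot_vars ty a)" for p
    using not_dep_trip[OF that] unfolding x_def[abs_def] not_dep_def by simp
  have ny: "not_dep y p" if "p \<notin> var_set (slot_vars ty b)" for p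
    using not_dep_trip[OF that] unfolding y_def[abs_def] not_dep_def by simp
  have xS: "x g = S {a} F l g" for g
    by (simp add: S_def sumE_single x_def xf_def Phi_def)
  have yS: "y g = S {b} H l g" for g
    by (simp add: S_def sumE_single y_def yf_def Phi_def)
  have n2x: "norm2 x \<le> sumE m {a} (\<lambda>p. (cmod (F p))\<^sup>2) l" using R_single[OF lt(1)] unfolding R_def xS[abs_def] by simp
  have n2y: "norm2 y \<le> sumE m {b} (\<lambda>p. (cmod (H p))\<^sup>2) l" using R_single[OF lt(2)] unfolding R_def yS[abs_def] by simp
  define Q where "Q k j = (\<integral>g. (f c k (pick (slot_vars ty c) g) * x g) * (f e j (pick (slot_vars ty e) g) * y g) \<partial>haar6)" for k j
  have Q: "(\<Sum>j'<m. \<Sum>i<m. yf j' * (xf i * tau (l(b := j', a := i, c := k, e := j)))) = Q k j" if kj: "k < m" "j < m" for k j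
  proof -
    have tau: "tau (l(b := j', a := i, c := k, e := j)) =
       (\<integral>g. f a i (pick (slot_vars ty a) g) * f b j' (pick (slot_vars ty b) g) * f c k (pick (slot_vars ty c) g) * f e j (pick (slot_vars ty e) g) \<partial>haar6)" for i j'
      unfolding tau_def Phi_def abcd[symmetric] using dist by (simp add: mult_ac)
    have "(\<Sum>j'<m. \<Sum>i<m. yf j' * (xf i * tau (l(b := j', a := i, c := k, e := j))))
       = (\<Sum>j'<m. \<Sum>i<m. \<integral>g. yf j' * (xf i * (f a i (pick (slot_vars ty a) g) * f b j' (pick (slot_vars ty b) g) * f c k (pick (slot_vars ty c) g) * f e j (pick (slot_vars ty e) g))) \<partial>haar6)"
      by (simp add: tau)
    also have "\<dots> = (\<integral>g. (\<Sum>j'<m. \<Sum>i<m. yf j' * (xf i * (f a i (pick (slot_vars ty a) g) * f b j' (pick (slot_vars ty b) g) * f c k (pick (slot_vars ty c) g) * f e j (pick (slot_vars ty e) g)))) \<partial>haar6)"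
      by (subst Bochner_Integration.integral_sum, (intro bdd_integrable bdd_sum bdd_mult bdd_const bf lt kj; simp),
          intro sum.cong refl Bochner_Integration.integral_sum[symmetric] bdd_integrable bdd_mult bdd_const bf lt kj) auto
    also have "\<dots> = Q k j"
      unfolding Q_def x_def y_def
    proof (intro Bochner_Integration.integral_cong refl)
      fix g
      have "f c k (pick (slot_vars ty c) g) * (\<Sum>i<m. xf i * f a i (pick (slot_vars ty a) g)) *
             (f e j (pick (slot_vars ty e) g) * (\<Sum>j<m. yf j * f b j (pick (slot_vars ty b) g)))
          = ((\<Sum>j<m. yf j * f b j (pick (slot_vars ty b) g)) * (\<Sum>i<m. xf i * f a i (pick (slot_vars ty a) g))) *
              (f c k (pick (slot_vars ty c) g) * f e j (pick (slot_vars ty e) g))"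
        by (simp only: mult_ac)
      also have "\<dots> = (\<Sum>j'<m. \<Sum>i<m. yf j' * (xf i * (f a i (pick (slot_vars ty a) g) * f b j' (pick (slot_vars ty b) g) * f c k (pick (slot_vars ty c) g) * f e j (pick (slot_vars ty e) g))))"
        by (subst sum_product, unfold sum_distrib_right, intro sum.cong refl, simp only: mult_ac)
      finally show "(\<Sum>j'<m. \<Sum>i<m. yf j' * (xf i * (f a i (pick (slot_vars ty a) g) * f b j' (pick (slot_vars ty b) g) * f c k (pick (slot_vars ty c) g) * f e j (pick (slot_vars ty e) g))))
          = f c k (pick (slot_vars ty c) g) * (\<Sum>i<m. xf i * f a i (pick (slot_vars ty a) g)) *
             (f e j (pick (slot_vars ty e) g) * (\<Sum>j<m. yf j * f b j (pick (slot_vars ty b) g)))" ..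
    qed
    finally show ?thesis .
  qed
  have "sumE m ({b} \<union> {a}) (\<lambda>l. H l * (F l * (\<Sum>k<m. \<Sum>j<m. M k j * tau (l(c := k, e := j))))) l
     = (\<Sum>j'<m. \<Sum>i<m. yf j' * (xf i * (\<Sum>k<m. \<Sum>j<m. M k j * tau (l(b := j', a := i, c := k, e := j)))))"
    using dist by (subst sumE_Un) (auto simp: sumE_single FH)
  also have "\<dots> = (\<Sum>j'<m. \<Sum>i<m. \<Sum>k<m. \<Sum>j<m. M k j * (yf j' * (xf i * tau (l(b := j', a := i, c := k, e := j)))))"
    by (simp add: sum_distrib_left mult_ac)
  also have "\<dots> = (\<Sum>j'<m. \<Sum>k<m. \<Sum>i<m. \<Sum>j<m. M k j * (yf j' * (xf i * tau (l(b := j', a := i, c := k, e := j)))))"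
    by (intro sum.cong refl sum.swap)
  also have "\<dots> = (\<Sum>k<m. \<Sum>j'<m. \<Sum>i<m. \<Sum>j<m. M k j * (yf j' * (xf i * tau (l(b := j', a := i, c := k, e := j)))))"
    by (rule sum.swap)
  also have "\<dots> = (\<Sum>k<m. \<Sum>j'<m. \<Sum>j<m. \<Sum>i<m. M k j * (yf j' * (xf i * tau (l(b := j', a := i, c := k, e := j)))))"
    by (intro sum.cong refl sum.swap)
  also have "\<dots> = (\<Sum>k<m. \<Sum>j<m. \<Sum>j'<m. \<Sum>i<m. M k j * (yf j' * (xf i * tau (l(b := j', a := i, c := k, e := j)))))"
    by (intro sum.cong refl sum.swap)
  also have "\<dots> = (\<Sum>k<m. \<Sum>j<m. M k j * Q k j)"
    by (intro sum.cong refl) (simp add: Q[symmetric] sum_distrib_left)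
  finally have eq: "sumE m ({b} \<union> {a}) (\<lambda>l. H l * (F l * (\<Sum>k<m. \<Sum>j<m. M k j * tau (l(c := k, e := j))))) l
     = (\<Sum>k<m. \<Sum>j<m. M k j * Q k j)" .
  have D0: "0 \<le> D" using D1 by simp
  have "cmod (\<Sum>k<m. \<Sum>j<m. M k j * Q k j) \<le> C * D * sqrt (norm2 x) * sqrt (norm2 y)"
    using slots_share[OF abcd, of ty]
  proof (elim disjE exE conjE)
    fix p q assume "p \<in> var_set (slot_vars ty c)" "p \<notin> var_set (slot_vars ty e)" "p \<notin> var_set (slot_vars ty b)"
       "q \<in> var_set (slot_vars ty e)" "q \<notin> var_set (slot_vars ty c)" "q \<notin> var_set (slot_vars ty a)"
    then show ?thesis unfolding Q_def
      by (intro contract_core[OF good good D0 var_ok_sv var_ok_sv, where p = p and q = q] lt bx bY nx ny M)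
  next
    \<comment> \<open>Now \<open>c\<close> is paired with \<open>b\<close> and \<open>e\<close> with
      \<open>a\<close>. Exchanging the roles of \<open>c\<close> and \<open>e\<close> transposes
      \<open>M\<close>.\<close>
    fix p q assume pq: "p \<in> var_set (slot_vars ty c)" "p \<notin> var_set (slot_vars ty e)" "p \<notin> var_set (slot_vars ty a)"
       "q \<in> var_set (slot_vars ty e)" "q \<notin> var_set (slot_vars ty c)" "q \<notin> var_set (slot_vars ty b)"
    have "(\<Sum>k<m. \<Sum>j<m. M k j * Q k j) = 
       (\<Sum>j<m. \<Sum>k<m. M k j * (\<integral>g. (f e j (pick (slot_vars ty e) g) * x g) * (f c k (pick (slot_vars ty c) g) * y g) \<partial>haar6))"
      unfolding Q_def by (subst sum.swap) (simp add: mult_ac)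
    also have "cmod \<dots> \<le> C * D * sqrt (norm2 x) * sqrt (norm2 y)"
      by (rule contract_core[OF good[OF lt(4)] good[OF lt(3)] D0 var_ok_sv var_ok_sv pq(4,5,1,2) bx nx[OF pq(3)] bY ny[OF pq(6)]
            mat_bound_transpose[OF M(1)] M(2)])
    finally show ?thesis .
  qed
  also have "\<dots> \<le> C * D * sqrt (sumE m {a} (\<lambda>p. (cmod (F p))\<^sup>2) l) * sqrt (sumE m {b} (\<lambda>p. (cmod (H p))\<^sup>2) l)"
    by (intro mult_mono mult_left_mono real_sqrt_le_mono n2x n2y mult_nonneg_nonneg M D0 real_sqrt_ge_zero norm2_nonneg sumE_nonneg) auto
  finally show "cmod (sumE m ({b} \<union> {a}) (\<lambda>l. H l * (F l * (\<Sum>k<m. \<Sum>j<m. M k j * tau (l(c := k, e := j))))) l)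
     \<le> D * C * sqrt (sumE m {a} (\<lambda>l. (cmod (F l))\<^sup>2) l) * sqrt (sumE m {b} (\<lambda>l. (cmod (H l))\<^sup>2) l)"
    unfolding eq by (simp add: mult.commute[of D C])
qed (use D1 M in auto)

end

section \<open>Matrix coefficients with bounded spin\<close>

lemma continuous_coeff_mult:
  fixes P Q :: "'b::topological_space \<Rightarrow> complex poly"
  assumes "\<And>i. continuous_on A (\<lambda>x. coeff (P x) i)" "\<And>i. continuous_on A (\<lambda>x. coeff (Q x) i)"
  shows "continuous_on A (\<lambda>x. coeff (P x * Q x) i)"
  unfolding coeff_mult by (intro continuous_intros assms)

lemma continuous_coeff_power:
  fixes P :: "'b::topological_space \<Rightarrow> complex poly"
  assumes "\<And>i. continuous_on A (\<lambda>x. coeff (P x) i)"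
  shows "continuous_on A (\<lambda>x. coeff (P x ^ n) i)"
proof (induction n arbitrary: i)
  case (Suc n)
  then show ?case unfolding power_Suc by (intro continuous_coeff_mult assms)
qed simp

lemma wigD_eq: "wigD k p q g = coeff ([:- cnj (snd g), fst g:] ^ q * [:cnj (fst g), snd g:] ^ (k - q)) p"
  by (simp add: wigD_def split_def)

lemma continuous_wigD: "continuous_on A (wigD k p q)"
proof -
  have 1: "continuous_on A (\<lambda>g. coeff [:- cnj (snd g), fst g:] i)" for i
    by (cases i; cases "i - 1") (auto intro!: continuous_intros)
  have 2: "continuous_on A (\<lambda>g. coeff [:cnj (fst g), snd g:] i)" for i
    by (cases i; cases "i - 1") (auto intro!: continuous_intros)
  show ?thesis unfolding wigD_eq[abs_def]
    by (intro continuous_coeff_mult continuous_coeff_power 1 2)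
qed

text \<open>\<open>homog n X Y P\<close> is the homogenisation \<open>y\<^sup>n P(x/y)\<close> of \<open>P\<close> evaluated at \<open>X\<close>, \<open>Y\<close>.\<close>

definition homog :: "nat \<Rightarrow> 'a::comm_ring_1 poly \<Rightarrow> 'a poly \<Rightarrow> 'a poly \<Rightarrow> 'a poly" where
  "homog n X Y P = (\<Sum>r\<le>n. smult (coeff P r) (X ^ r * Y ^ (n - r)))"

text \<open>Homogenisation turns a linear factor into the corresponding linear form in
  \<open>X\<close> and \<open>Y\<close>. The degree bound makes the coefficient of order
  \<open>Suc n\<close> vanish, which is where the two sums differ in length.\<close>

lemma homog_linear_mult:
  assumes "degree P \<le> n"
  shows "homog (Suc n) X Y ([:u, w:] * P) = (smult u Y + smult w X) * homog n X Y P"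
proof -
  have c: "coeff ([:u, w:] * P) r = u * coeff P r + (if r = 0 then 0 else w * coeff P (r - 1))" for r
    by (cases r) auto
  have z: "coeff P (Suc n) = 0" using assms by (intro coeff_eq_0) simp
  have "homog (Suc n) X Y ([:u, w:] * P) = 
      (\<Sum>r\<le>Suc n. smult (u * coeff P r) (X ^ r * Y ^ (Suc n - r))) + 
      (\<Sum>r\<le>Suc n. smult (if r = 0 then 0 else w * coeff P (r - 1)) (X ^ r * Y ^ (Suc n - r)))"
    unfolding homog_def c by (simp add: smult_add_left sum.distrib)
  also have "(\<Sum>r\<le>Suc n. smult (u * coeff P r) (X ^ r * Y ^ (Suc n - r))) = (\<Sum>r\<le>n. smult (u * coeff P r) (X ^ r * Y ^ (Suc n - r)))"
    using z by simp
  also have "\<dots> = smult u Y * homog n X Y P"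
    unfolding homog_def sum_distrib_left by (intro sum.cong refl) (simp add: Suc_diff_le mult_ac)
  also have "(\<Sum>r\<le>Suc n. smult (if r = 0 then 0 else w * coeff P (r - 1)) (X ^ r * Y ^ (Suc n - r)))
     = (\<Sum>r\<le>n. smult (w * coeff P r) (X ^ Suc r * Y ^ (n - r)))"
    by (subst sum.atMost_Suc_shift) simp
  also have "\<dots> = smult w X * homog n X Y P"
    unfolding homog_def sum_distrib_left by (intro sum.cong refl) (simp add: mult_ac)
  finally show ?thesis by (simp add: distrib_right)
qed

lemma degree_linear_power: "degree ([:u, w:] ^ j :: 'a::idom poly) \<le> j"
proof -
  have "degree ([:u, w:] ^ j) \<le> degree [:u, w:] * j" by (rule degree_power_le)
  also have "\<dots> \<le> 1 * j" by (rule mult_right_mono) simp_all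
  finally show ?thesis by simp
qed

lemma homog_powers:
  fixes u w u' w' :: "'a::idom"
  shows "homog (i + j) X Y ([:u, w:] ^ i * [:u', w':] ^ j) = (smult u Y + smult w X) ^ i * (smult u' Y + smult w' X) ^ j"
proof -
  note d1 = degree_linear_power[of u' w']
  have 1: "homog j X Y ([:u', w':] ^ j) = (smult u' Y + smult w' X) ^ j" for j
  proof (induction j)
    case 0
    then show ?case by (simp add: homog_def)
  next
    case (Suc j)
    then show ?case using homog_linear_mult[OF d1[of j], of X Y u' w'] by simp
  qed
  show ?thesis
  proof (induction i)
    case 0
    then show ?case using 1 by simp
  next
    case (Suc i)
    have "degree ([:u, w:] ^ i * [:u', w':] ^ j) \<le> i + j"
      by (rule order_trans[OF degree_mult_le]) (intro add_mono degree_linear_power)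
    from homog_linear_mult[OF this, of X Y u w] show ?case by (simp only: Suc power_Suc mult.assoc add_Suc)
  qed
qed

text \<open>The linear forms belonging to the product are those of \<open>h\<close> with the two
  variables replaced by the forms of \<open>g\<close>. Expanding this substitution by
  \<open>homog\<close> and comparing coefficients gives the matrix product.\<close>

lemma wigD_mult:
  assumes "q \<le> k"
  shows "wigD k p q (su2_mult g h) = (\<Sum>r\<le>k. wigD k p r g * wigD k r q h)"
proof -
  obtain a b c d where gh: "g = (a, b)" "h = (c, d)" by (metis surj_pair)
  let ?X = "[:- cnj b, a:]" and ?Y = "[:cnj a, b:]"
  have "(smult (- cnj d) ?Y + smult c ?X) ^ q * (smult (cnj c) ?Y + smult d ?X) ^ (k - q)
     = homog k ?X ?Y ([:- cnj d, c:] ^ q * [:cnj c, d:] ^ (k - q))"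
    using homog_powers[of q "k - q" ?X ?Y "- cnj d" c "cnj c" d] assms by simp
  moreover have "wigD k p q (su2_mult g h) = coeff ([:- cnj (a * d + b * cnj c), a * c - b * cnj d:] ^ q * [:cnj (a * c - b * cnj d), a * d + b * cnj c:] ^ (k - q)) p"
    by (simp only: gh su2_mult_def wigD_def prod.case)
  moreover have "smult (- cnj d) ?Y + smult c ?X = [:- cnj (a * d + b * cnj c), a * c - b * cnj d:]"
    by (simp add: algebra_simps)
  moreover have "smult (cnj c) ?Y + smult d ?X = [:cnj (a * c - b * cnj d), a * d + b * cnj c:]"
    by (simp add: algebra_simps)
  ultimately have "wigD k p q (su2_mult g h) = coeff (homog k ?X ?Y ([:- cnj d, c:] ^ q * [:cnj c, d:] ^ (k - q))) p"
    by (simp only:)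
  also have "\<dots> = (\<Sum>r\<le>k. wigD k p r g * wigD k r q h)"
    by (simp add: homog_def coeff_sum gh wigD_def mult.commute)
  finally show ?thesis .
qed

section \<open>The span of the matrix coefficients up to a given spin\<close>

definition Idx :: "nat \<Rightarrow> (nat \<times> nat \<times> nat) set" where
  "Idx N = {(k, p, q). k \<le> N \<and> p \<le> k \<and> q \<le> k}"

definition wig :: "nat \<times> nat \<times> nat \<Rightarrow> cc \<Rightarrow> complex" where
  "wig t g = (case t of (k, p, q) \<Rightarrow> wigD k p q g)"

definition W :: "nat \<Rightarrow> (cc \<Rightarrow> complex) set" where
  "W N = {w. \<exists>c. w = (\<lambda>g. \<Sum>t\<in>Idx N. c t * wig t g)}"

lemma Idx_sub: "Idx N \<subseteq> {..N} \<times> {..N} \<times> {..N}"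
  by (auto simp: Idx_def)

lemma finite_Idx: "finite (Idx N)"
  by (rule finite_subset[OF Idx_sub]) auto

text \<open>A crude count by a cube; the exact sum of the squares of \<open>k + 1\<close> has the
  same order in \<open>N\<close>.\<close>

lemma card_Idx: "card (Idx N) \<le> (N + 1) ^ 3"
proof -
  have "card (Idx N) \<le> card ({..N} \<times> {..N} \<times> {..N})" by (rule card_mono[OF _ Idx_sub]) simp
  also have "\<dots> = (N + 1) ^ 3" by (simp only: card_cartesian_product card_atMost Suc_eq_plus1 power3_eq_cube mult.assoc)
  finally show ?thesis .
qed

lemma W_wig: "t \<in> Idx N \<Longrightarrow> wig t \<in> W N"
proof -
  assume t: "t \<in> Idx N"
  have "(\<Sum>s\<in>Idx N. (if s = t then 1 else 0) * wig s g) = wig t g" for g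
  proof -
    have "(if s = t then 1 else 0) * wig s g = (if s = t then wig s g else 0)" for s by simp
    then show ?thesis using t finite_Idx by simp
  qed
  then show ?thesis unfolding W_def by (intro CollectI exI[of _ "\<lambda>s. if s = t then 1 else 0"]) (simp add: fun_eq_iff)
qed

lemma W_zero: "(\<lambda>_. 0) \<in> W N"
  unfolding W_def by (intro CollectI exI[of _ "\<lambda>_. 0"]) simp

lemma W_add: "u \<in> W N \<Longrightarrow> v \<in> W N \<Longrightarrow> (\<lambda>g. u g + v g) \<in> W N"
proof -
  assume "u \<in> W N" "v \<in> W N"
  then obtain c d where "u = (\<lambda>g. \<Sum>t\<in>Idx N. c t * wig t g)" "v = (\<lambda>g. \<Sum>t\<in>Idx N. d t * wig t g)" by (auto simp: W_def)
  then show ?thesis unfolding W_def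
    by (intro CollectI exI[of _ "\<lambda>t. c t + d t"]) (simp add: distrib_right sum.distrib)
qed

lemma W_cmul: "u \<in> W N \<Longrightarrow> (\<lambda>g. c * u g) \<in> W N"
proof -
  assume "u \<in> W N"
  then obtain d where "u = (\<lambda>g. \<Sum>t\<in>Idx N. d t * wig t g)" by (auto simp: W_def)
  then show ?thesis unfolding W_def
    by (intro CollectI exI[of _ "\<lambda>t. c * d t"]) (simp add: sum_distrib_left mult.assoc)
qed

lemma W_sum: "finite S \<Longrightarrow> (\<And>i. i \<in> S \<Longrightarrow> u i \<in> W N) \<Longrightarrow> (\<lambda>g. \<Sum>i\<in>S. u i g) \<in> W N"
  by (induction S rule: finite_induct) (auto intro: W_zero W_add)

text \<open>By \<open>wigD_mult\<close> a translate mixes only coefficients of the same spin. Left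
  translation makes the evaluation norm constant on the group; its right-hand counterpart keeps
  slices in the span under \<open>rmul\<close>.\<close>

lemma W_left: "u \<in> W N \<Longrightarrow> (\<lambda>g. u (su2_mult h g)) \<in> W N"
proof -
  assume "u \<in> W N"
  then obtain d where u: "u = (\<lambda>g. \<Sum>t\<in>Idx N. d t * wig t g)" by (auto simp: W_def)
  have "(\<lambda>g. wig t (su2_mult h g)) \<in> W N" if t: "t \<in> Idx N" for t
  proof -
    obtain k p q where kpq: "t = (k, p, q)" by (metis surj_pair)
    have "(\<lambda>g. \<Sum>r\<le>k. wigD k p r h * wig (k, r, q) g) \<in> W N"
      by (intro W_sum W_cmul W_wig) (use t in \<open>auto simp: Idx_def kpq\<close>)
    then show ?thesis using t by (simp add: kpq wig_def wigD_mult Idx_def)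
  qed
  then show ?thesis unfolding u by (intro W_sum W_cmul finite_Idx)
qed

lemma W_right: "u \<in> W N \<Longrightarrow> (\<lambda>g. u (su2_mult g h)) \<in> W N"
proof -
  assume "u \<in> W N"
  then obtain d where u: "u = (\<lambda>g. \<Sum>t\<in>Idx N. d t * wig t g)" by (auto simp: W_def)
  have "(\<lambda>g. wig t (su2_mult g h)) \<in> W N" if t: "t \<in> Idx N" for t
  proof -
    obtain k p q where kpq: "t = (k, p, q)" by (metis surj_pair)
    have "(\<lambda>g. \<Sum>r\<le>k. wigD k r q h * wig (k, p, r) g) \<in> W N"
      by (intro W_sum W_cmul W_wig) (use t in \<open>auto simp: Idx_def kpq\<close>)
    then show ?thesis using t by (simp add: kpq wig_def wigD_mult Idx_def mult.commute)
  qed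
  then show ?thesis unfolding u by (intro W_sum W_cmul finite_Idx)
qed

lemma continuous_wig: "continuous_on A (wig t)"
  by (cases t) (auto simp: wig_def[abs_def] continuous_wigD)

lemma continuous_W: "u \<in> W N \<Longrightarrow> continuous_on A u"
  by (auto simp: W_def intro!: continuous_intros continuous_wig)

lemma compact_SU2: "compact SU2" by (simp add: SU2_sphere)

lemma haar_integrable_continuous:
  fixes f :: "cc \<Rightarrow> 'b::{banach, second_countable_topology}"
  assumes "continuous_on SU2 f" shows "integrable haar f"
proof -
  have "bounded (f ` SU2)" using compact_SU2 assms by (intro compact_imp_bounded compact_continuous_image)
  then obtain B where "\<And>y. y \<in> SU2 \<Longrightarrow> norm (f y) \<le> B" unfolding bounded_iff by auto
  then show ?thesis
    by (intro haar.integrable_const_bound[of _ B] haar_measurable_continuous assms AE_I2) auto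
qed

lemma haar_integral_left:
  fixes f :: "cc \<Rightarrow> 'b::{banach, second_countable_topology}"
  assumes "h \<in> SU2" "f \<in> borel_measurable haar" shows "(\<integral>x. f (su2_mult h x) \<partial>haar) = (\<integral>x. f x \<partial>haar)"
  using integral_distr[OF measurable_su2_haar(1)[OF assms(1)] assms(2)] by (simp add: haar_left assms)

lemma haar_integral_right:
  fixes f :: "cc \<Rightarrow> 'b::{banach, second_countable_topology}"
  assumes "h \<in> SU2" "f \<in> borel_measurable haar" shows "(\<integral>x. f (su2_mult x h) \<partial>haar) = (\<integral>x. f x \<partial>haar)"
  using integral_distr[OF measurable_su2_haar(2)[OF assms(1)] assms(2)] by (simp add: haar_right assms)

definition orthonormal :: "nat \<Rightarrow> (nat \<Rightarrow> cc \<Rightarrow> complex) \<Rightarrow> bool" where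
  "orthonormal r u \<longleftrightarrow> (\<forall>i<r. \<forall>j<r. (\<integral>x. u i x * cnj (u j x) \<partial>haar) = (if i = j then 1 else 0))"

lemma complex_integral_norm_sq:
  "complex_of_real (\<integral>x. (cmod (f x))\<^sup>2 \<partial>M) = (\<integral>x. f x * cnj (f x) \<partial>M)"
  unfolding integral_complex_of_real[symmetric] by (simp only: complex_norm_square)

lemma orthonormal_combination_inner:
  assumes u: "orthonormal r u" "\<And>i. i < r \<Longrightarrow> continuous_on SU2 (u i)" and j: "j < r"
  shows "(\<integral>x. (\<Sum>i<r. c i * u i x) * cnj (u j x) \<partial>haar) = c j"
proof -
  have "(\<integral>x. (\<Sum>i<r. c i * u i x) * cnj (u j x) \<partial>haar) = (\<integral>x. (\<Sum>i<r. c i * (u i x * cnj (u j x))) \<partial>haar)"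
    by (simp add: sum_distrib_right mult.assoc)
  also have "\<dots> = (\<Sum>i<r. \<integral>x. c i * (u i x * cnj (u j x)) \<partial>haar)"
    by (rule Bochner_Integration.integral_sum) (auto intro!: haar_integrable_continuous continuous_intros u j)
  also have "\<dots> = (\<Sum>i<r. if i = j then c i else 0)"
    using u(1) j by (intro sum.cong refl) (simp add: orthonormal_def)
  also have "\<dots> = c j" using j by simp
  finally show ?thesis .
qed

lemma orthonormal_norm_sq:
  assumes u: "orthonormal r u" "\<And>i. i < r \<Longrightarrow> continuous_on SU2 (u i)"
  shows "(\<integral>x. (cmod (\<Sum>i<r. c i * u i x))\<^sup>2 \<partial>haar) = (\<Sum>i<r. (cmod (c i))\<^sup>2)"
proof -
  have "complex_of_real (\<integral>x. (cmod (\<Sum>i<r. c i * u i x))\<^sup>2 \<partial>haar) = (\<integral>x. (\<Sum>i<r. c i * u i x) * cnj (\<Sum>j<r. c j * u j x) \<partial>haar)"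
    by (rule complex_integral_norm_sq)
  also have "\<dots> = (\<integral>x. (\<Sum>j<r. cnj (c j) * ((\<Sum>i<r. c i * u i x) * cnj (u j x))) \<partial>haar)"
    by (simp add: cnj_sum sum_distrib_left mult_ac)
  also have "\<dots> = (\<Sum>j<r. \<integral>x. cnj (c j) * ((\<Sum>i<r. c i * u i x) * cnj (u j x)) \<partial>haar)"
    by (rule Bochner_Integration.integral_sum) (auto intro!: haar_integrable_continuous continuous_intros u)
  also have "\<dots> = (\<Sum>j<r. cnj (c j) * c j)"
    by (intro sum.cong refl) (simp add: orthonormal_combination_inner[OF u])
  also have "\<dots> = complex_of_real (\<Sum>i<r. (cmod (c i))\<^sup>2)"
    by (simp only: of_real_sum complex_norm_square mult.commute)
  finally show ?thesis by (simp only: of_real_eq_iff)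
qed

text \<open>The new vectors are combinations of the old ones everywhere, so membership in a span of
  functions is preserved. The converse expansion holds on \<open>SU2\<close> only: there a vector of
  norm zero vanishes by \<open>haar_zero_continuous\<close> and is dropped, whence only an
  inequality for the length \<open>r\<close>.\<close>

lemma Gram_Schmidt:
  assumes "finite T" "\<And>t. t \<in> T \<Longrightarrow> continuous_on SU2 (\<phi> t :: cc \<Rightarrow> complex)"
  shows "\<exists>r u. r \<le> card T \<and> (\<forall>i<r. \<exists>c. \<forall>x. u i x = (\<Sum>t\<in>T. c t * \<phi> t x)) \<and> orthonormal r u \<and>
     (\<forall>t\<in>T. \<exists>c. \<forall>x\<in>SU2. \<phi> t x = (\<Sum>i<r. c i * u i x))"
  using assms
proof (induction T rule: finite_induct)
  case empty
  show ?case by (intro exI[of _ 0] exI[of _ "\<lambda>_ _. 0"]) (simp add: orthonormal_def)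
next
  case (insert s T)
  then obtain r u where r: "r \<le> card T" and uc: "\<forall>i<r. \<exists>c. \<forall>x. u i x = (\<Sum>t\<in>T. c t * \<phi> t x)" 
    and on: "orthonormal r u" and sp: "\<forall>t\<in>T. \<exists>c. \<forall>x\<in>SU2. \<phi> t x = (\<Sum>i<r. c i * u i x)" by auto
  have cs: "continuous_on SU2 (\<phi> s)" and cT: "\<And>t. t \<in> T \<Longrightarrow> continuous_on SU2 (\<phi> t)" using insert.prems by auto
  obtain C where C: "\<And>i x. i < r \<Longrightarrow> u i x = (\<Sum>t\<in>T. C i t * \<phi> t x)" using uc by metis
  have cu: "continuous_on SU2 (u i)" if "i < r" for i
  proof -
    have "u i = (\<lambda>x. \<Sum>t\<in>T. C i t * \<phi> t x)" using C[OF that] by auto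
    then show ?thesis by (auto intro!: continuous_intros cT)
  qed
  define a where "a i = (\<integral>x. \<phi> s x * cnj (u i x) \<partial>haar)" for i
  define v where "v x = \<phi> s x - (\<Sum>i<r. a i * u i x)" for x
  have cv: "continuous_on SU2 v" unfolding v_def[abs_def] by (intro continuous_intros cs cu) auto
  have vu: "(\<integral>x. v x * cnj (u j x) \<partial>haar) = 0" if j: "j < r" for j
  proof -
    have "(\<integral>x. v x * cnj (u j x) \<partial>haar) = (\<integral>x. \<phi> s x * cnj (u j x) - (\<Sum>i<r. a i * u i x) * cnj (u j x) \<partial>haar)"
      by (simp add: v_def left_diff_distrib)
    also have "\<dots> = (\<integral>x. \<phi> s x * cnj (u j x) \<partial>haar) - (\<integral>x. (\<Sum>i<r. a i * u i x) * cnj (u j x) \<partial>haar)"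
      by (rule Bochner_Integration.integral_diff) (auto intro!: haar_integrable_continuous continuous_intros cs cu j)
    finally show ?thesis by (simp add: orthonormal_combination_inner[OF on cu j] a_def)
  qed
  have Cs: "(\<Sum>t\<in>insert s T. (if t = s then c else d t) * \<phi> t x) = c * \<phi> s x + (\<Sum>t\<in>T. d t * \<phi> t x)" for c d x
    using insert.hyps by (simp add: sum.insert) (intro sum.cong refl, auto)
  have uc': "\<exists>c. \<forall>x. u i x = (\<Sum>t\<in>insert s T. c t * \<phi> t x)" if "i < r" for i
    using C[OF that] Cs[of 0 "C i"] by (intro exI[of _ "\<lambda>t. if t = s then 0 else C i t"]) simp
  define n where "n = (\<integral>x. (cmod (v x))\<^sup>2 \<partial>haar)"
  show ?case
  proof (cases "n = 0")
    case True
    have cv2: "continuous_on SU2 (\<lambda>x. (cmod (v x))\<^sup>2)" by (intro continuous_intros cv)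
    have "v x = 0" if "x \<in> SU2" for x
      using haar_zero_continuous[OF cv2 _ _ that] True by (simp add: n_def)
    then have "\<forall>x\<in>SU2. \<phi> s x = (\<Sum>i<r. a i * u i x)" by (auto simp: v_def)
    then show ?thesis using r uc' on sp insert.hyps
      by (intro exI[of _ r] exI[of _ u]) (auto simp: card_insert_if)
  next
    case False
    then have n: "n > 0" by (simp add: n_def less_le)
    define w where "w x = v x / complex_of_real (sqrt n)" for x
    define u' where "u' i = (if i = r then w else u i)" for i
    have sq: "complex_of_real (sqrt n) * complex_of_real (sqrt n) = complex_of_real n"
      using n by (simp flip: of_real_mult)
    have vv: "(\<integral>x. v x * cnj (v x) \<partial>haar) = complex_of_real n"
      unfolding n_def by (rule complex_integral_norm_sq[symmetric])
    have ww: "(\<integral>x. w x * cnj (w x) \<partial>haar) = 1"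
    proof -
      have "w x * cnj (w x) = (v x * cnj (v x)) / complex_of_real n" for x
        by (simp add: w_def sq)
      then show ?thesis using vv n by simp
    qed
    have wu: "(\<integral>x. w x * cnj (u j x) \<partial>haar) = 0" if "j < r" for j
      using vu[OF that] by (simp add: w_def)
    have uw: "(\<integral>x. u j x * cnj (w x) \<partial>haar) = 0" if "j < r" for j
    proof -
      have "(\<integral>x. u j x * cnj (w x) \<partial>haar) = (\<integral>x. cnj (w x * cnj (u j x)) \<partial>haar)" by (simp add: mult.commute)
      also have "\<dots> = cnj (\<integral>x. w x * cnj (u j x) \<partial>haar)" by (rule Bochner_Integration.integral_cnj)
      finally show ?thesis using wu[OF that] by simp
    qed
    have on': "orthonormal (Suc r) u'"
      using on ww wu uw by (auto simp: orthonormal_def u'_def less_Suc_eq)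
    have wc: "\<exists>c. \<forall>x. w x = (\<Sum>t\<in>insert s T. c t * \<phi> t x)"
    proof (intro exI allI)
      fix x
      let ?z = "complex_of_real (sqrt n)"
      define b where "b t = (\<Sum>i<r. a i * C i t)" for t
      have "(\<Sum>i<r. a i * u i x) = (\<Sum>i<r. \<Sum>t\<in>T. a i * C i t * \<phi> t x)"
        by (intro sum.cong refl) (simp add: C sum_distrib_left mult.assoc)
      also have "\<dots> = (\<Sum>t\<in>T. b t * \<phi> t x)"
        by (subst sum.swap) (simp add: sum_distrib_right b_def)
      finally have "w x = (1 / ?z) * \<phi> s x + (\<Sum>t\<in>T. (- b t / ?z) * \<phi> t x)"
        by (simp add: w_def v_def diff_divide_distrib sum_divide_distrib sum_negf)
      then show "w x = (\<Sum>t\<in>insert s T. (if t = s then 1 / ?z else - (\<Sum>i<r. a i * C i t) / ?z) * \<phi> t x)"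
        unfolding Cs b_def .
    qed
    have ext: "(\<Sum>i<Suc r. (if i = r then b else c i) * u' i x) = (\<Sum>i<r. c i * u i x) + b * w x" for b c x
      by (simp add: u'_def)
    have sp': "\<exists>c. \<forall>x\<in>SU2. \<phi> t x = (\<Sum>i<Suc r. c i * u' i x)" if t: "t \<in> insert s T" for t
    proof (cases "t = s")
      case True
      have "\<phi> s x = (\<Sum>i<r. a i * u i x) + complex_of_real (sqrt n) * w x" for x
        using n by (simp add: w_def v_def)
      then show ?thesis unfolding True ext[symmetric]
        by (intro exI[of _ "\<lambda>i. if i = r then complex_of_real (sqrt n) else a i"] ballI)
    next
      case False
      then obtain c where "\<forall>x\<in>SU2. \<phi> t x = (\<Sum>i<r. c i * u i x)" using sp t by blast
      then have "\<forall>x\<in>SU2. \<phi> t x = (\<Sum>i<r. c i * u i x) + 0 * w x" by simp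
      then show ?thesis unfolding ext[symmetric] by (rule exI[of _ "\<lambda>i. if i = r then 0 else c i"])
    qed
    show ?thesis
    proof (intro exI[of _ "Suc r"] exI[of _ u'] conjI)
      show "Suc r \<le> card (insert s T)" using r insert.hyps by simp
      show "\<forall>i<Suc r. \<exists>c. \<forall>x. u' i x = (\<Sum>t\<in>insert s T. c t * \<phi> t x)"
      proof (intro allI impI)
        fix i assume "i < Suc r"
        then show "\<exists>c. \<forall>x. u' i x = (\<Sum>t\<in>insert s T. c t * \<phi> t x)"
          using wc uc'[of i] by (cases "i = r") (simp_all only: u'_def if_True if_False less_Suc_eq simp_thms)
      qed
      show "orthonormal (Suc r) u'" by (rule on')
      show "\<forall>t\<in>insert s T. \<exists>c. \<forall>x\<in>SU2. \<phi> t x = (\<Sum>i<Suc r. c i * u' i x)" using sp' by blast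
    qed
  qed
qed

text \<open>The squared evaluation norm at \<open>g\<close> is the diagonal \<open>K g\<close> of
  the reproducing kernel. Translation invariance of \<open>W N\<close> makes it constant, so it
  equals its integral, which is the number of orthonormal vectors.\<close>

lemma W_pointwise_bound:
  assumes f: "f \<in> W N" and g: "g \<in> SU2"
  shows "(cmod (f g))\<^sup>2 \<le> real ((N + 1) ^ 3) * (\<integral>x. (cmod (f x))\<^sup>2 \<partial>haar)"
proof -
  obtain r u where r: "r \<le> card (Idx N)" and uc: "\<forall>i<r. \<exists>c. \<forall>x. u i x = (\<Sum>t\<in>Idx N. c t * wig t x)" 
    and on: "orthonormal r u" and sp: "\<forall>t\<in>Idx N. \<exists>c. \<forall>x\<in>SU2. wig t x = (\<Sum>i<r. c i * u i x)" 
    using Gram_Schmidt[OF finite_Idx, of N wig] continuous_wig by blast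
  have uW: "u i \<in> W N" if "i < r" for i using uc that unfolding W_def by (auto simp: fun_eq_iff)
  have cu: "continuous_on SU2 (u i)" if "i < r" for i by (rule continuous_W[OF uW[OF that]])
  define K where "K g = (\<Sum>i<r. (cmod (u i g))\<^sup>2)" for g
  have K0: "0 \<le> K g" for g unfolding K_def by (intro sum_nonneg) auto
  have comb: "\<exists>c. \<forall>x\<in>SU2. f x = (\<Sum>i<r. c i * u i x)" if fW: "f \<in> W N" for f
  proof -
    obtain d where d: "f = (\<lambda>g. \<Sum>t\<in>Idx N. d t * wig t g)" using fW by (auto simp: W_def)
    obtain C where C: "\<And>t x. t \<in> Idx N \<Longrightarrow> x \<in> SU2 \<Longrightarrow> wig t x = (\<Sum>i<r. C t i * u i x)" using sp by metis
    have "f x = (\<Sum>i<r. (\<Sum>t\<in>Idx N. d t * C t i) * u i x)" if "x \<in> SU2" for x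
    proof -
      have "f x = (\<Sum>t\<in>Idx N. \<Sum>i<r. d t * C t i * u i x)"
        unfolding d by (intro sum.cong refl) (simp add: C that sum_distrib_left mult.assoc)
      also have "\<dots> = (\<Sum>i<r. (\<Sum>t\<in>Idx N. d t * C t i) * u i x)"
        by (subst sum.swap) (simp add: sum_distrib_right)
      finally show ?thesis .
    qed
    then show ?thesis by (intro exI[of _ "\<lambda>i. \<Sum>t\<in>Idx N. d t * C t i"] ballI)
  qed
  have bound: "(cmod (f g))\<^sup>2 \<le> K g * (\<integral>x. (cmod (f x))\<^sup>2 \<partial>haar)" if "f \<in> W N" "g \<in> SU2" for f g
  proof -
    obtain c where c: "\<forall>x\<in>SU2. f x = (\<Sum>i<r. c i * u i x)" using comb[OF \<open>f \<in> W N\<close>] by blast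
    have "(\<integral>x. (cmod (f x))\<^sup>2 \<partial>haar) = (\<integral>x. (cmod (\<Sum>i<r. c i * u i x))\<^sup>2 \<partial>haar)"
      using c by (intro Bochner_Integration.integral_cong) auto
    also have "\<dots> = (\<Sum>i<r. (cmod (c i))\<^sup>2)" by (rule orthonormal_norm_sq[OF on cu])
    finally have I: "(\<integral>x. (cmod (f x))\<^sup>2 \<partial>haar) = (\<Sum>i<r. (cmod (c i))\<^sup>2)" .
    have "cmod (f g) \<le> sqrt (\<Sum>i<r. (cmod (c i))\<^sup>2) * sqrt (K g)"
      using c that(2) norm_sum_mult_le_sqrt[of c "\<lambda>i. u i g" "{..<r}"] by (simp add: K_def)
    then have "(cmod (f g))\<^sup>2 \<le> (sqrt (\<Sum>i<r. (cmod (c i))\<^sup>2) * sqrt (K g))\<^sup>2" by (rule power_mono) simp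
    also have "\<dots> = (\<Sum>i<r. (cmod (c i))\<^sup>2) * K g"
      using K0 by (simp add: power_mult_distrib sum_nonneg)
    finally show ?thesis unfolding I by (simp add: mult.commute)
  qed
  have mono: "K (su2_mult h g) \<le> K g" if hg: "h \<in> SU2" "g \<in> SU2" for h g
  proof -
    \<comment> \<open>The reproducing kernel at the point \<open>su2_mult h g\<close>: both its
      value there and its squared norm are \<open>K (su2_mult h g)\<close>. Evaluating its left
      translate at \<open>g\<close> compares the two values of \<open>K\<close>.\<close>
    define f where "f x = (\<Sum>i<r. cnj (u i (su2_mult h g)) * u i x)" for x
    have fW: "f \<in> W N" unfolding f_def[abs_def] by (intro W_sum W_cmul uW) auto
    have fg: "f (su2_mult h g) = complex_of_real (K (su2_mult h g))"
      unfolding f_def K_def by (simp only: of_real_sum complex_norm_square mult.commute)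
    have "(K (su2_mult h g))\<^sup>2 = (cmod (f (su2_mult h g)))\<^sup>2" using fg K0 by simp
    also have "\<dots> \<le> K g * (\<integral>x. (cmod (f (su2_mult h x)))\<^sup>2 \<partial>haar)"
      by (rule bound[OF W_left[OF fW] hg(2)])
    also have "(\<integral>x. (cmod (f (su2_mult h x)))\<^sup>2 \<partial>haar) = (\<integral>x. (cmod (f x))\<^sup>2 \<partial>haar)"
      by (rule haar_integral_left[OF hg(1)]) (intro haar_measurable_continuous continuous_intros continuous_W[OF fW])
    also have "\<dots> = K (su2_mult h g)"
      using orthonormal_norm_sq[OF on cu, of "\<lambda>i. cnj (u i (su2_mult h g))"] by (simp add: f_def K_def)
    finally have "K (su2_mult h g) * K (su2_mult h g) \<le> K g * K (su2_mult h g)" by (simp add: power2_eq_square)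
    then show ?thesis using K0[of "su2_mult h g"] K0[of g] by (cases "K (su2_mult h g) = 0") (auto simp: mult_le_cancel_right)
  qed
  have Kc: "K x = K g" if x: "x \<in> SU2" for x
  proof (rule antisym)
    have "su2_mult (su2_mult x (su2_inv g)) g = x" using g by (simp add: su2_mult_assoc su2_inv_mult su2_one)
    then show "K x \<le> K g" using mono[of "su2_mult x (su2_inv g)" g] x g by (simp add: su2_mult_closed su2_inv_SU2)
    have "su2_mult (su2_mult g (su2_inv x)) x = g" using x by (simp add: su2_mult_assoc su2_inv_mult su2_one)
    then show "K g \<le> K x" using mono[of "su2_mult g (su2_inv x)" x] x g by (simp add: su2_mult_closed su2_inv_SU2)
  qed
  have one: "(\<integral>x. (cmod (u i x))\<^sup>2 \<partial>haar) = 1" if "i < r" for i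
  proof -
    have "complex_of_real (\<integral>x. (cmod (u i x))\<^sup>2 \<partial>haar) = 1"
      using on that unfolding complex_integral_norm_sq orthonormal_def by simp
    then show ?thesis by (simp only: of_real_eq_1_iff)
  qed
  have "K g = (\<integral>x. K x \<partial>haar)"
  proof -
    have "(\<integral>x. K x \<partial>haar) = (\<integral>x. K g \<partial>haar)" by (rule Bochner_Integration.integral_cong) (auto intro: Kc)
    then show ?thesis by simp
  qed
  also have "\<dots> = (\<Sum>i<r. \<integral>x. (cmod (u i x))\<^sup>2 \<partial>haar)"
    unfolding K_def by (rule Bochner_Integration.integral_sum) (auto intro!: haar_integrable_continuous continuous_intros cu)
  also have "\<dots> = r" by (simp add: one)
  also have "\<dots> \<le> real ((N + 1) ^ 3)" using r card_Idx[of N] by (simp del: of_nat_power add: of_nat_le_iff)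
  finally have "K g \<le> real ((N + 1) ^ 3)" .
  then have "K g * (\<integral>x. (cmod (f x))\<^sup>2 \<partial>haar) \<le> real ((N + 1) ^ 3) * (\<integral>x. (cmod (f x))\<^sup>2 \<partial>haar)"
    by (rule mult_right_mono) simp
  with bound[OF f g] show ?thesis by (rule order_trans)
qed

section \<open>The right-invariant space\<close>

interpretation hh: pair_sigma_finite haar haar ..
interpretation hh_prob: pair_prob_space haar haar ..
interpretation hhh: pair_sigma_finite haar "haar \<Otimes>\<^sub>M haar" ..
interpretation hhh_prob: pair_prob_space haar "haar \<Otimes>\<^sub>M haar" ..

lemma haar_id_borel: "(\<lambda>x. x) \<in> haar \<rightarrow>\<^sub>M borel"
  by (rule haar_measurable_continuous) (intro continuous_intros)

lemma haar2_id_borel: "(\<lambda>x. x) \<in> haar \<Otimes>\<^sub>M haar \<rightarrow>\<^sub>M (borel :: (cc \<times> cc) measure)"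
proof -
  have "(\<lambda>x. (fst x, snd x)) \<in> haar \<Otimes>\<^sub>M haar \<rightarrow>\<^sub>M borel \<Otimes>\<^sub>M (borel :: cc measure)"
    by (intro measurable_Pair measurable_compose[OF measurable_fst haar_id_borel] measurable_compose[OF measurable_snd haar_id_borel])
  then show ?thesis by (simp add: borel_prod)
qed

lemma haar3_id_borel: "(\<lambda>x. x) \<in> haar3 \<rightarrow>\<^sub>M (borel :: triple measure)"
proof -
  have "(\<lambda>x. (fst x, snd x)) \<in> haar3 \<rightarrow>\<^sub>M borel \<Otimes>\<^sub>M (borel :: (cc \<times> cc) measure)" unfolding haar3_def
    by (intro measurable_Pair measurable_compose[OF measurable_fst haar_id_borel] measurable_compose[OF measurable_snd haar2_id_borel])
  then show ?thesis by (simp add: borel_prod)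
qed

lemma space_haar3: "space haar3 = SU2 \<times> SU2 \<times> SU2"
  by (simp add: haar3_def space_pair_measure)

lemma haar3_measurable: "f \<in> borel_measurable borel \<Longrightarrow> f \<in> borel_measurable haar3"
  by (rule measurable_compose[OF haar3_id_borel])

lemma haar2_measurable: "f \<in> borel_measurable borel \<Longrightarrow> f \<in> borel_measurable (haar \<Otimes>\<^sub>M haar)"
  by (rule measurable_compose[OF haar2_id_borel])

lemma prob_space_haar3: "prob_space haar3"
  unfolding haar3_def by (rule hhh_prob.prob_space_axioms)

interpretation haar3: prob_space haar3 by (rule prob_space_haar3)

lemma bounded_SU2_3: 
  fixes F :: "triple \<Rightarrow> 'b::real_normed_vector"
  assumes "continuous_on UNIV F" shows "\<exists>B. \<forall>x\<in>SU2 \<times> SU2 \<times> SU2. norm (F x) \<le> B"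
proof -
  have "compact (SU2 \<times> SU2 \<times> SU2)" by (intro compact_Times compact_SU2)
  then have "bounded (F ` (SU2 \<times> SU2 \<times> SU2))"
    using continuous_on_subset[OF assms] by (intro compact_imp_bounded compact_continuous_image) auto
  then show ?thesis unfolding bounded_iff by auto
qed

lemma haar3_integrable:
  fixes F :: "triple \<Rightarrow> 'b::{banach, second_countable_topology}"
  assumes "continuous_on UNIV F" shows "integrable haar3 F"
proof -
  obtain B where "\<forall>x\<in>SU2 \<times> SU2 \<times> SU2. norm (F x) \<le> B" using bounded_SU2_3[OF assms] by blast
  then show ?thesis
    by (intro haar3.integrable_const_bound[of _ B] haar3_measurable borel_measurable_continuous_onI assms AE_I2)
       (simp only: space_haar3)
qed

lemma continuous_slice:
  assumes "continuous_on UNIV (F :: triple \<Rightarrow> 'b::topological_space)" "continuous_on A p" "continuous_on A q" "continuous_on A r"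
  shows "continuous_on A (\<lambda>x. F (p x, q x, r x))"
  by (rule continuous_on_compose2[OF assms(1)]) (auto intro!: continuous_intros assms)

lemma haar2_integrable:
  fixes G :: "cc \<times> cc \<Rightarrow> real"
  assumes "G \<in> borel_measurable (haar \<Otimes>\<^sub>M haar)" "\<And>x y. x \<in> SU2 \<Longrightarrow> y \<in> SU2 \<Longrightarrow> \<bar>G (x, y)\<bar> \<le> B"
  shows "integrable (haar \<Otimes>\<^sub>M haar) G"
  by (rule hh_prob.integrable_const_bound[of _ B]) (use assms in \<open>auto intro!: AE_I2 simp: space_pair_measure\<close>)

lemma haar_swap:
  fixes G :: "cc \<times> cc \<Rightarrow> real"
  assumes "G \<in> borel_measurable (haar \<Otimes>\<^sub>M haar)" "\<And>x y. x \<in> SU2 \<Longrightarrow> y \<in> SU2 \<Longrightarrow> \<bar>G (x, y)\<bar> \<le> B"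
  shows "(\<integral>x. \<integral>y. G (x, y) \<partial>haar \<partial>haar) = (\<integral>y. \<integral>x. G (x, y) \<partial>haar \<partial>haar)"
  using hh.Fubini_integral[of "\<lambda>x y. G (x, y)"] haar2_integrable[OF assms] by simp

lemma haar_swap_slice:
  fixes F :: "triple \<Rightarrow> real"
  assumes F: "continuous_on UNIV F" and a: "a \<in> SU2"
  shows "(\<integral>x. \<integral>y. F (a, x, y) \<partial>haar \<partial>haar) = (\<integral>y. \<integral>x. F (a, x, y) \<partial>haar \<partial>haar)"
    "(\<integral>x. \<integral>y. F (x, a, y) \<partial>haar \<partial>haar) = (\<integral>y. \<integral>x. F (x, a, y) \<partial>haar \<partial>haar)"
    "(\<integral>x. \<integral>y. F (x, y, a) \<partial>haar \<partial>haar) = (\<integral>y. \<integral>x. F (x, y, a) \<partial>haar \<partial>haar)"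
proof -
  obtain B where B: "\<forall>x\<in>SU2 \<times> SU2 \<times> SU2. norm (F x) \<le> B" using bounded_SU2_3[OF F] by blast
  have m: "(\<lambda>z. F (a, fst z, snd z)) \<in> borel_measurable (haar \<Otimes>\<^sub>M haar)"
     "(\<lambda>z. F (fst z, a, snd z)) \<in> borel_measurable (haar \<Otimes>\<^sub>M haar)"
     "(\<lambda>z. F (fst z, snd z, a)) \<in> borel_measurable (haar \<Otimes>\<^sub>M haar)"
    by (intro haar2_measurable borel_measurable_continuous_onI continuous_slice[OF F] continuous_intros)+
  show "(\<integral>x. \<integral>y. F (a, x, y) \<partial>haar \<partial>haar) = (\<integral>y. \<integral>x. F (a, x, y) \<partial>haar \<partial>haar)"
    using haar_swap[OF m(1), of B] B a by simp
  show "(\<integral>x. \<integral>y. F (x, a, y) \<partial>haar \<partial>haar) = (\<integral>y. \<integral>x. F (x, a, y) \<partial>haar \<partial>haar)"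
    using haar_swap[OF m(2), of B] B a by simp
  show "(\<integral>x. \<integral>y. F (x, y, a) \<partial>haar \<partial>haar) = (\<integral>y. \<integral>x. F (x, y, a) \<partial>haar \<partial>haar)"
    using haar_swap[OF m(3), of B] B a by simp
qed

text \<open>Integrability is not assumed: the integral of a function that is not integrable is 0 by
  convention, and \<open>0 \<le> B\<close> covers this case.\<close>

lemma haar_integral_bound:
  fixes f :: "cc \<Rightarrow> real"
  assumes "\<And>x. x \<in> SU2 \<Longrightarrow> \<bar>f x\<bar> \<le> B" "0 \<le> B"
  shows "\<bar>\<integral>x. f x \<partial>haar\<bar> \<le> B"
proof (cases "integrable haar f")
  case True
  have "\<bar>\<integral>x. f x \<partial>haar\<bar> \<le> (\<integral>x. \<bar>f x\<bar> \<partial>haar)" by (rule integral_abs_bound)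
  also have "\<dots> \<le> (\<integral>x. B \<partial>haar)" by (rule integral_mono) (use True assms in auto)
  finally show ?thesis by simp
qed (use assms in \<open>simp add: not_integrable_integral_eq\<close>)

lemma haar3_integral:
  fixes F :: "triple \<Rightarrow> real"
  assumes F: "continuous_on UNIV F"
  shows "(\<integral>x. \<integral>y. \<integral>z. F (x, y, z) \<partial>haar \<partial>haar \<partial>haar) = (\<integral>x. F x \<partial>haar3)" (is ?t1)
    "(\<integral>y. \<integral>x. \<integral>z. F (x, y, z) \<partial>haar \<partial>haar \<partial>haar) = (\<integral>x. F x \<partial>haar3)" (is ?t2)
    "(\<integral>z. \<integral>x. \<integral>y. F (x, y, z) \<partial>haar \<partial>haar \<partial>haar) = (\<integral>x. F x \<partial>haar3)" (is ?t3)
proof -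
  obtain B where B: "\<forall>x\<in>SU2 \<times> SU2 \<times> SU2. norm (F x) \<le> B" using bounded_SU2_3[OF F] by blast
  have B': "\<bar>F (x, y, z)\<bar> \<le> B" if "x \<in> SU2" "y \<in> SU2" "z \<in> SU2" for x y z using B that by auto
  have B0: "0 \<le> B" using B'[OF su2_one(3) su2_one(3) su2_one(3)] by linarith
  have int: "integrable (haar \<Otimes>\<^sub>M haar \<Otimes>\<^sub>M haar) F" using haar3_integrable[OF F] by (simp add: haar3_def)
  have 1: "(\<integral>x. F x \<partial>haar3) = (\<integral>x. (\<integral>w. F (x, w) \<partial>(haar \<Otimes>\<^sub>M haar)) \<partial>haar)"
    unfolding haar3_def using hhh.integral_fst'[OF int] by simp
  have 2: "(\<integral>w. F (x, w) \<partial>(haar \<Otimes>\<^sub>M haar)) = (\<integral>y. \<integral>z. F (x, y, z) \<partial>haar \<partial>haar)" if x: "x \<in> SU2" for x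
  proof -
    have "continuous_on UNIV (\<lambda>w. F (x, fst w, snd w))" by (intro continuous_slice[OF F] continuous_intros)
    then have "(\<lambda>w. F (x, w)) \<in> borel_measurable (haar \<Otimes>\<^sub>M haar)"
      using haar2_measurable[OF borel_measurable_continuous_onI, of "\<lambda>w. F (x, w)"] by simp
    then have "integrable (haar \<Otimes>\<^sub>M haar) (\<lambda>w. F (x, w))" by (rule haar2_integrable) (rule B'[OF x])
    from hh.integral_fst'[OF this] show ?thesis by simp
  qed
  have t1: ?t1 unfolding 1 by (rule Bochner_Integration.integral_cong) (simp_all add: 2)
  then show ?t1 .
  have z: "(\<lambda>w. \<integral>z. F (fst w, snd w, z) \<partial>haar) \<in> borel_measurable (haar \<Otimes>\<^sub>M haar)"
  proof (rule haar.borel_measurable_lebesgue_integral)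
    have "(\<lambda>w. (fst (fst w), snd (fst w), snd w)) \<in> (haar \<Otimes>\<^sub>M haar) \<Otimes>\<^sub>M haar \<rightarrow>\<^sub>M haar3"
      unfolding haar3_def by (intro measurable_Pair measurable_compose[OF measurable_fst measurable_fst] measurable_compose[OF measurable_fst measurable_snd] measurable_snd)
    from measurable_compose[OF this haar3_measurable[OF borel_measurable_continuous_onI[OF F]]]
    show "(\<lambda>(w, z). F (fst w, snd w, z)) \<in> borel_measurable ((haar \<Otimes>\<^sub>M haar) \<Otimes>\<^sub>M haar)" by (simp add: split_def)
  qed
  have t2: ?t2
    using haar_swap[OF z, of B] haar_integral_bound[OF B' B0] t1 by simp
  then show ?t2 .
  have "(\<integral>z. \<integral>x. \<integral>y. F (x, y, z) \<partial>haar \<partial>haar \<partial>haar) = (\<integral>x. \<integral>z. \<integral>y. F (x, y, z) \<partial>haar \<partial>haar \<partial>haar)"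
  proof -
    have "(\<lambda>w. \<integral>y. F (fst w, y, snd w) \<partial>haar) \<in> borel_measurable (haar \<Otimes>\<^sub>M haar)"
    proof (rule haar.borel_measurable_lebesgue_integral)
      have "(\<lambda>w. (fst (fst w), snd w, snd (fst w))) \<in> (haar \<Otimes>\<^sub>M haar) \<Otimes>\<^sub>M haar \<rightarrow>\<^sub>M haar3"
        unfolding haar3_def by (intro measurable_Pair measurable_compose[OF measurable_fst measurable_fst] measurable_compose[OF measurable_fst measurable_snd] measurable_snd)
      from measurable_compose[OF this haar3_measurable[OF borel_measurable_continuous_onI[OF F]]]
      show "(\<lambda>(w, z). F (fst w, z, snd w)) \<in> borel_measurable ((haar \<Otimes>\<^sub>M haar) \<Otimes>\<^sub>M haar)" by (simp add: split_def)
    qed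
    from haar_swap[OF this, of B] show ?thesis using haar_integral_bound[OF B' B0] by simp
  qed
  also have "\<dots> = (\<integral>x. \<integral>y. \<integral>z. F (x, y, z) \<partial>haar \<partial>haar \<partial>haar)"
    by (rule Bochner_Integration.integral_cong) (use haar_swap_slice(1)[OF F] in auto)
  finally show ?t3 using t1 by simp
qed

section \<open>Right translations and one-variable slices\<close>

definition rmul :: "cc \<Rightarrow> triple \<Rightarrow> triple" where
  "rmul h x = (su2_mult (fst x) h, su2_mult (fst (snd x)) h, su2_mult (snd (snd x)) h)"

lemma distr_rmul: "h \<in> SU2 \<Longrightarrow> distr haar3 haar3 (rmul h) = haar3" and measurable_rmul: "h \<in> SU2 \<Longrightarrow> rmul h \<in> haar3 \<rightarrow>\<^sub>M haar3"
proof -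
  assume h: "h \<in> SU2"
  let ?r = "\<lambda>x. su2_mult x h"
  have m: "?r \<in> haar \<rightarrow>\<^sub>M haar" by (rule measurable_su2_haar(2)[OF h])
  have m2: "(\<lambda>(x, y). (?r x, ?r y)) \<in> haar \<Otimes>\<^sub>M haar \<rightarrow>\<^sub>M haar \<Otimes>\<^sub>M haar"
    unfolding split_def by (intro measurable_Pair measurable_compose[OF measurable_fst m] measurable_compose[OF measurable_snd m])
  have d2: "distr (haar \<Otimes>\<^sub>M haar) (haar \<Otimes>\<^sub>M haar) (\<lambda>(x, y). (?r x, ?r y)) = haar \<Otimes>\<^sub>M haar"
    using pair_measure_distr[OF m m] by (simp add: haar_right[OF h] haar.sigma_finite_measure_axioms)
  have sf: "sigma_finite_measure (haar \<Otimes>\<^sub>M haar)" by (rule prob_space_imp_sigma_finite[OF hh_prob.prob_space_axioms])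
  have r: "rmul h = (\<lambda>(x, y). (?r x, (\<lambda>(x, y). (?r x, ?r y)) y))" by (auto simp: rmul_def fun_eq_iff)
  show "distr haar3 haar3 (rmul h) = haar3"
    unfolding r haar3_def using pair_measure_distr[OF m m2] by (simp add: haar_right[OF h] d2 sf)
  show "rmul h \<in> haar3 \<rightarrow>\<^sub>M haar3"
    unfolding haar3_def rmul_def[abs_def]
    by (intro measurable_Pair measurable_compose[OF measurable_fst m] measurable_compose[OF measurable_compose[OF measurable_snd measurable_fst] m]
      measurable_compose[OF measurable_compose[OF measurable_snd measurable_snd] m])
qed

text \<open>Retains of \<open>Hcut\<close> what permits evaluation in one argument at a time:
  continuity and, for each argument, slices in the span.\<close>

definition slices_W :: "nat \<Rightarrow> (triple \<Rightarrow> complex) \<Rightarrow> bool" where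
  "slices_W N f \<longleftrightarrow> continuous_on UNIV f \<and> (\<forall>a b. (\<lambda>y. f (y, a, b)) \<in> W N \<and> (\<lambda>y. f (a, y, b)) \<in> W N \<and> (\<lambda>y. f (a, b, y)) \<in> W N)"

lemma sl3D: "slices_W N f \<Longrightarrow> continuous_on UNIV f" "slices_W N f \<Longrightarrow> (\<lambda>y. f (y, a, b)) \<in> W N" 
  "slices_W N f \<Longrightarrow> (\<lambda>y. f (a, y, b)) \<in> W N" "slices_W N f \<Longrightarrow> (\<lambda>y. f (a, b, y)) \<in> W N"
  unfolding slices_W_def by blast+

lemma slices_W_sum: "finite S \<Longrightarrow> (\<And>i. i \<in> S \<Longrightarrow> slices_W N (f i)) \<Longrightarrow> slices_W N (\<lambda>x. \<Sum>i\<in>S. f i x)"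
  unfolding slices_W_def by (intro conjI allI W_sum continuous_intros) auto

lemma slices_W_cmul: "slices_W N f \<Longrightarrow> slices_W N (\<lambda>x. c * f x)"
  unfolding slices_W_def by (intro conjI allI W_cmul continuous_intros) auto

lemma W_diff: "u \<in> W N \<Longrightarrow> v \<in> W N \<Longrightarrow> (\<lambda>g. u g - v g) \<in> W N"
  using W_add[of u N "\<lambda>g. (-1) * v g"] W_cmul[of v N "-1"] by simp

lemma slices_W_diff: "slices_W N f \<Longrightarrow> slices_W N g \<Longrightarrow> slices_W N (\<lambda>x. f x - g x)"
  unfolding slices_W_def by (intro conjI allI W_diff continuous_intros) auto

lemma continuous_rmul: "continuous_on UNIV (rmul h)"
  unfolding rmul_def[abs_def] by (intro continuous_intros)

lemma slices_W_rmul: assumes "slices_W N f" shows "slices_W N (\<lambda>x. f (rmul h x))"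
  unfolding slices_W_def
proof (intro conjI allI)
  show "continuous_on UNIV (\<lambda>x. f (rmul h x))"
    by (rule continuous_on_compose2[OF sl3D(1)[OF assms] continuous_rmul]) simp
  fix a b
  show "(\<lambda>y. f (rmul h (y, a, b))) \<in> W N" "(\<lambda>y. f (rmul h (a, y, b))) \<in> W N" "(\<lambda>y. f (rmul h (a, b, y))) \<in> W N"
    using W_right[OF sl3D(2)[OF assms]] W_right[OF sl3D(3)[OF assms]] W_right[OF sl3D(4)[OF assms]]
    by (simp_all add: rmul_def)
qed

lemma slices_W_Hcut: 
  assumes "f \<in> Hcut L" shows "slices_W (nat \<lfloor>2 * L\<rfloor>) f"
proof -
  obtain M :: nat and c :: "nat \<Rightarrow> complex" and k p q :: "nat \<Rightarrow> nat \<Rightarrow> nat" where k: "\<forall>i<M. \<forall>j<3. real (k i j) / 2 \<le> L \<and> p i j \<le> k i j \<and> q i j \<le> k i j" and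
     f: "f = (\<lambda>(x1, x2, x3). \<Sum>i<(M::nat). c i * wigD (k i 0) (p i 0) (q i 0) x1
               * wigD (k i 1) (p i 1) (q i 1) x2 * wigD (k i 2) (p i 2) (q i 2) x3)"
    using assms unfolding Hcut_def by blast
  let ?N = "nat \<lfloor>2 * L\<rfloor>"
  have wW: "wigD (k i j) (p i j) (q i j) \<in> W ?N" if "i < M" "j < 3" for i j
  proof -
    \<comment> \<open>The index of \<open>wigD\<close> is twice the spin, hence the floor of
      \<open>2 * L\<close>.\<close>
    have "real (k i j) \<le> 2 * L" using k that by force
    then have "k i j \<le> ?N" by (simp add: le_nat_iff le_floor_iff)
    then have "(k i j, p i j, q i j) \<in> Idx ?N" using k that by (auto simp: Idx_def)
    from W_wig[OF this] show ?thesis by (simp add: wig_def[abs_def])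
  qed
  have "slices_W ?N (\<lambda>x. c i * wigD (k i 0) (p i 0) (q i 0) (fst x) * wigD (k i 1) (p i 1) (q i 1) (fst (snd x)) * wigD (k i 2) (p i 2) (q i 2) (snd (snd x)))" 
    (is "slices_W _ (\<lambda>x. c i * ?u (fst x) * ?v (fst (snd x)) * ?w (snd (snd x)))")
    if i: "i < M" for i
    unfolding slices_W_def
  proof (intro conjI allI)
    show "continuous_on UNIV (\<lambda>x. c i * ?u (fst x) * ?v (fst (snd x)) * ?w (snd (snd x)))"
      by (intro continuous_intros continuous_on_compose2[OF continuous_wigD[of UNIV]]) auto
    fix a b :: cc
    have "(\<lambda>y. (c i * ?v a * ?w b) * ?u y) \<in> W ?N" "(\<lambda>y. (c i * ?u a * ?w b) * ?v y) \<in> W ?N" "(\<lambda>y. (c i * ?u a * ?v b) * ?w y) \<in> W ?N"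
      by (intro W_cmul wW i; simp)+
    then show "(\<lambda>y. c i * ?u (fst (y, a, b)) * ?v (fst (snd (y, a, b))) * ?w (snd (snd (y, a, b)))) \<in> W ?N"
        "(\<lambda>y. c i * ?u (fst (a, y, b)) * ?v (fst (snd (a, y, b))) * ?w (snd (snd (a, y, b)))) \<in> W ?N"
        "(\<lambda>y. c i * ?u (fst (a, b, y)) * ?v (fst (snd (a, b, y))) * ?w (snd (snd (a, b, y)))) \<in> W ?N"
      by (simp_all add: mult_ac)
  qed
  then have "slices_W ?N (\<lambda>x. \<Sum>i<M. c i * wigD (k i 0) (p i 0) (q i 0) (fst x) * wigD (k i 1) (p i 1) (q i 1) (fst (snd x)) * wigD (k i 2) (p i 2) (q i 2) (snd (snd x)))"
    by (intro slices_W_sum) auto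
  then show ?thesis unfolding f by (simp add: split_def)
qed

text \<open>The upper bound for the dimension of \<open>W N\<close> from \<open>card_Idx\<close>; it
  becomes the \<open>D\<close> of the vertex estimates.\<close>

definition dimW :: "nat \<Rightarrow> real" where "dimW N = real ((N + 1) ^ 3)"

lemma dimW_nonneg: "0 \<le> dimW N" by (simp add: dimW_def)

lemma slices_W_pointwise:
  assumes f: "slices_W N f" and S: "a \<in> SU2" "b \<in> SU2" "c \<in> SU2"
  shows "(cmod (f (a, b, c)))\<^sup>2 \<le> dimW N * (\<integral>x. (cmod (f (x, b, c)))\<^sup>2 \<partial>haar)"
    "(cmod (f (a, b, c)))\<^sup>2 \<le> dimW N * (\<integral>x. (cmod (f (a, x, c)))\<^sup>2 \<partial>haar)"
    "(cmod (f (a, b, c)))\<^sup>2 \<le> dimW N * (\<integral>x. (cmod (f (a, b, x)))\<^sup>2 \<partial>haar)"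
  using W_pointwise_bound[OF sl3D(2)[OF f] S(1)] W_pointwise_bound[OF sl3D(3)[OF f] S(2)] W_pointwise_bound[OF sl3D(4)[OF f] S(3)]
  unfolding dimW_def .

lemma slices_W_sq_continuous: "slices_W N f \<Longrightarrow> continuous_on UNIV (\<lambda>x. (cmod (f x))\<^sup>2)"
  by (intro continuous_intros sl3D(1))

lemma haar_integral_mono_dim:
  fixes F :: "cc \<Rightarrow> real"
  assumes "\<And>x. x \<in> SU2 \<Longrightarrow> F x \<le> d * G x" "integrable haar F" "integrable haar G"
  shows "(\<integral>x. F x \<partial>haar) \<le> d * (\<integral>x. G x \<partial>haar)"
proof -
  have "(\<integral>x. F x \<partial>haar) \<le> (\<integral>x. d * G x \<partial>haar)" by (rule integral_mono) (use assms in auto)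
  then show ?thesis by simp
qed

lemma haar_inner_integrable:
  fixes F :: "cc \<Rightarrow> cc \<Rightarrow> real"
  assumes F: "continuous_on UNIV (\<lambda>z. F (fst z) (snd z))"
  shows "integrable haar (\<lambda>x. \<integral>y. F x y \<partial>haar)" "integrable haar (\<lambda>y. \<integral>x. F x y \<partial>haar)"
proof -
  have "compact (SU2 \<times> SU2)" by (intro compact_Times compact_SU2)
  then have "bounded ((\<lambda>z. F (fst z) (snd z)) ` (SU2 \<times> SU2))"
    using continuous_on_subset[OF F] by (intro compact_imp_bounded compact_continuous_image) auto
  then obtain B where B: "\<And>x y. x \<in> SU2 \<Longrightarrow> y \<in> SU2 \<Longrightarrow> \<bar>F x y\<bar> \<le> B" unfolding bounded_iff by auto
  have "(\<lambda>z. F (fst z) (snd z)) \<in> borel_measurable (haar \<Otimes>\<^sub>M haar)"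
    by (intro haar2_measurable borel_measurable_continuous_onI F)
  then have int: "integrable (haar \<Otimes>\<^sub>M haar) (\<lambda>(x, y). F x y)" 
    unfolding split_def by (rule haar2_integrable[of _ B]) (simp add: B)
  show "integrable haar (\<lambda>x. \<integral>y. F x y \<partial>haar)" using hh.integrable_fst[OF int] .
  show "integrable haar (\<lambda>y. \<integral>x. F x y \<partial>haar)" using hh.integrable_snd[OF int] .
qed

text \<open>Three evaluation bounds, one per argument, estimate the squared value at any point by a
  constant times the squared norm. They turn almost-everywhere identities into pointwise
  ones.\<close>

lemma slices_W_zero:
  assumes f: "slices_W N f" and z: "AE x in haar3. f x = 0" and S: "a \<in> SU2" "b \<in> SU2" "c \<in> SU2"
  shows "f (a, b, c) = 0"
proof -
  let ?F = "\<lambda>x y z. (cmod (f (x, y, z)))\<^sup>2"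
  note C = continuous_slice[OF slices_W_sq_continuous[OF f]]
  note D0 = dimW_nonneg[of N]
  have I0: "(\<integral>x. (cmod (f x))\<^sup>2 \<partial>haar3) = 0"
    by (rule integral_eq_zero_AE) (use z in \<open>auto elim!: eventually_mono\<close>)
  have i1: "integrable haar (\<lambda>x. \<integral>y. \<integral>z. ?F x y z \<partial>haar \<partial>haar)"
  proof -
    have int: "integrable (haar \<Otimes>\<^sub>M haar \<Otimes>\<^sub>M haar) (\<lambda>x. (cmod (f x))\<^sup>2)" using haar3_integrable[OF slices_W_sq_continuous[OF f]] by (simp add: haar3_def)
    have "integrable haar (\<lambda>x. \<integral>w. (cmod (f (x, w)))\<^sup>2 \<partial>(haar \<Otimes>\<^sub>M haar))" 
      using hhh.integrable_fst'[OF int] .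
    moreover have "(\<integral>w. (cmod (f (x, w)))\<^sup>2 \<partial>(haar \<Otimes>\<^sub>M haar)) = (\<integral>y. \<integral>z. ?F x y z \<partial>haar \<partial>haar)" if "x \<in> SU2" for x
    proof -
      obtain B where B: "\<forall>x\<in>SU2 \<times> SU2 \<times> SU2. norm ((cmod (f x))\<^sup>2) \<le> B" using bounded_SU2_3[OF slices_W_sq_continuous[OF f]] by blast
      have "continuous_on UNIV (\<lambda>w. (cmod (f (x, fst w, snd w)))\<^sup>2)" by (intro C continuous_intros)
      then have "(\<lambda>w. (cmod (f (x, w)))\<^sup>2) \<in> borel_measurable (haar \<Otimes>\<^sub>M haar)"
        using haar2_measurable[OF borel_measurable_continuous_onI, of "\<lambda>w. (cmod (f (x, w)))\<^sup>2"] by simp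
      then have "integrable (haar \<Otimes>\<^sub>M haar) (\<lambda>w. (cmod (f (x, w)))\<^sup>2)" by (rule haar2_integrable[of _ B]) (use B that in auto)
      from hh.integral_fst'[OF this] show ?thesis by simp
    qed
    ultimately show ?thesis by (subst (asm) Bochner_Integration.integrable_cong[OF refl]) auto
  qed
  have "?F a b c \<le> dimW N * (\<integral>x. ?F x b c \<partial>haar)" by (rule slices_W_pointwise(1)[OF f S])
  also have "\<dots> \<le> dimW N * (dimW N * (\<integral>x. \<integral>y. ?F x y c \<partial>haar \<partial>haar))"
    by (intro mult_left_mono[OF _ D0] haar_integral_mono_dim slices_W_pointwise(2)[OF f] S haar_integrable_continuous C haar_inner_integrable continuous_intros)
  also have "\<dots> \<le> dimW N * (dimW N * (dimW N * (\<integral>x. \<integral>y. \<integral>z. ?F x y z \<partial>haar \<partial>haar \<partial>haar)))"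
    by (intro mult_left_mono[OF _ D0] haar_integral_mono_dim slices_W_pointwise(3)[OF f] S haar_integrable_continuous C haar_inner_integrable continuous_intros i1)
  also have "\<dots> = 0" using haar3_integral(1)[OF slices_W_sq_continuous[OF f]] I0 by simp
  finally show ?thesis by simp
qed

text \<open>By associativity \<open>h\<close> multiplies the averaged group element from the left,
  where invariance of the Haar measure absorbs it.\<close>

lemma Cphi_rmul:
  assumes \<phi>: "\<phi> \<in> borel_measurable haar3" and h: "h \<in> SU2" and x: "x \<in> SU2 \<times> SU2 \<times> SU2"
  shows "Cphi \<phi> (rmul h x) = Cphi \<phi> x"
proof -
  obtain a b c where abc: "x = (a, b, c)" "a \<in> SU2" "b \<in> SU2" "c \<in> SU2" using x by auto
  have inv: "(\<integral>k. \<phi> (su2_mult (su2_mult p h) k, su2_mult (su2_mult q h) k, su2_mult (su2_mult r h) k) \<partial>haar)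
      = (\<integral>k. \<phi> (su2_mult p k, su2_mult q k, su2_mult r k) \<partial>haar)"
    if S: "p \<in> SU2" "q \<in> SU2" "r \<in> SU2" for p q r
  proof -
    have "(\<lambda>k. (su2_mult p k, su2_mult q k, su2_mult r k)) \<in> haar \<rightarrow>\<^sub>M haar3"
      unfolding haar3_def by (intro measurable_Pair measurable_su2_haar S)
    from haar_integral_left[OF h measurable_compose[OF this \<phi>]]
    show ?thesis by (simp add: su2_mult_assoc)
  qed
  show ?thesis unfolding Cphi_def abc(1) rmul_def by (simp add: inv abc)
qed

text \<open>\<open>f\<close> agrees with an averaged function only almost everywhere, and
  \<open>rmul h\<close> preserves the measure. The difference of \<open>f\<close> and its translate
  is thus almost everywhere zero, and \<open>slices_W_zero\<close> makes it zero at every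
  point.\<close>

lemma H0_right_invariant:
  assumes f: "f \<in> H0 L" and h: "h \<in> SU2" and x: "x \<in> SU2 \<times> SU2 \<times> SU2"
  shows "f (rmul h x) = f x"
proof -
  have s: "slices_W (nat \<lfloor>2 * L\<rfloor>) f" using f slices_W_Hcut by (auto simp: H0_def)
  obtain \<phi> where \<phi>: "\<phi> \<in> borel_measurable haar3" and ae: "AE x in haar3. f x = Cphi \<phi> x"
    using f by (auto simp: H0_def ImCphi_def)
  have "AE x in distr haar3 haar3 (rmul h). f x = Cphi \<phi> x" by (subst distr_rmul[OF h]) (rule ae)
  then have ae2: "AE x in haar3. f (rmul h x) = Cphi \<phi> (rmul h x)" by (rule AE_distrD[OF measurable_rmul[OF h]])
  have sp: "AE x in haar3. x \<in> SU2 \<times> SU2 \<times> SU2" by (rule AE_I2) (simp only: space_haar3)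
  have z: "AE x in haar3. f (rmul h x) - f x = 0"
    using ae ae2 sp
  proof eventually_elim
    case (elim x)
    then show ?case using Cphi_rmul[OF \<phi> h elim(3)] by simp
  qed
  obtain a b c where "x = (a, b, c)" "a \<in> SU2" "b \<in> SU2" "c \<in> SU2" using x by auto
  then show ?thesis using slices_W_zero[OF slices_W_diff[OF slices_W_rmul[OF s] s] z, of a b c] by simp
qed

definition right_inv :: "(triple \<Rightarrow> complex) \<Rightarrow> bool" where
  "right_inv f \<longleftrightarrow> (\<forall>h\<in>SU2. \<forall>x\<in>SU2 \<times> SU2 \<times> SU2. f (rmul h x) = f x)"

lemma rinvD: "right_inv f \<Longrightarrow> h \<in> SU2 \<Longrightarrow> a \<in> SU2 \<Longrightarrow> b \<in> SU2 \<Longrightarrow> c \<in> SU2 \<Longrightarrow> f (su2_mult a h, su2_mult b h, su2_mult c h) = f (a, b, c)"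
  unfolding right_inv_def rmul_def by fastforce

lemma haar2_right:
  fixes F :: "cc \<Rightarrow> cc \<Rightarrow> real"
  assumes h: "h \<in> SU2" and F: "continuous_on UNIV (\<lambda>z. F (fst z) (snd z))"
  shows "(\<integral>z. \<integral>y. F (su2_mult y h) (su2_mult z h) \<partial>haar \<partial>haar) = (\<integral>z. \<integral>y. F y z \<partial>haar \<partial>haar)"
proof -
  have cz: "continuous_on UNIV (\<lambda>y. F y z)" for z
    using continuous_on_compose2[OF F, of UNIV "\<lambda>y. (y, z)"] by (simp add: continuous_intros)
  then have "(\<lambda>y. F y z) \<in> borel_measurable haar" for z
    by (intro haar_measurable_continuous) (rule continuous_on_subset[OF cz], simp)
  then have "(\<integral>z. \<integral>y. F (su2_mult y h) (su2_mult z h) \<partial>haar \<partial>haar) = (\<integral>z. \<integral>y. F y (su2_mult z h) \<partial>haar \<partial>haar)"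
    by (intro Bochner_Integration.integral_cong refl haar_integral_right h)
  also have "\<dots> = (\<integral>z. \<integral>y. F y z \<partial>haar \<partial>haar)"
    by (rule haar_integral_right[OF h, of "\<lambda>z. \<integral>y. F y z \<partial>haar"]) (rule borel_measurable_integrable[OF haar_inner_integrable(2)[OF F]])
  finally show ?thesis .
qed

lemma const_haar_integral:
  fixes J :: "cc \<Rightarrow> real"
  assumes "\<And>x y. x \<in> SU2 \<Longrightarrow> y \<in> SU2 \<Longrightarrow> J x = J y" "a \<in> SU2"
  shows "J a = (\<integral>x. J x \<partial>haar)"
proof -
  have "(\<integral>x. J x \<partial>haar) = (\<integral>x. J a \<partial>haar)" by (rule Bochner_Integration.integral_cong[OF refl]) (rule assms(1)[OF _ assms(2)], simp)
  then show ?thesis by simp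
qed

lemma su2_right_divide: "a \<in> SU2 \<Longrightarrow> b \<in> SU2 \<Longrightarrow> \<exists>h\<in>SU2. su2_mult a h = b"
proof (rule bexI[of _ "su2_mult (su2_inv a) b"])
  assume S: "a \<in> SU2" "b \<in> SU2"
  have "su2_mult a (su2_mult (su2_inv a) b) = su2_mult (su2_mult a (su2_inv a)) b" by (simp only: su2_mult_assoc)
  then show "su2_mult a (su2_mult (su2_inv a) b) = b" using S by (simp only: su2_inv_mult su2_one)
  show "su2_mult (su2_inv a) b \<in> SU2" using S by (intro su2_mult_closed su2_inv_SU2)
qed

lemma right_inv_slices:
  assumes f: "slices_W N f" and inv: "right_inv f" and a: "a \<in> SU2"
  shows "(\<integral>z. \<integral>y. (cmod (f (a, y, z)))\<^sup>2 \<partial>haar \<partial>haar) = (\<integral>x. (cmod (f x))\<^sup>2 \<partial>haar3)"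
    "(\<integral>z. \<integral>y. (cmod (f (y, a, z)))\<^sup>2 \<partial>haar \<partial>haar) = (\<integral>x. (cmod (f x))\<^sup>2 \<partial>haar3)"
    "(\<integral>z. \<integral>y. (cmod (f (y, z, a)))\<^sup>2 \<partial>haar \<partial>haar) = (\<integral>x. (cmod (f x))\<^sup>2 \<partial>haar3)"
proof -
  define F where "F x = (cmod (f x))\<^sup>2" for x
  have cF: "continuous_on UNIV F" unfolding F_def[abs_def] by (rule slices_W_sq_continuous[OF f])
  have Finv: "F (su2_mult p h, su2_mult q h, su2_mult r h) = F (p, q, r)" if "h \<in> SU2" "p \<in> SU2" "q \<in> SU2" "r \<in> SU2" for h p q r
    unfolding F_def using rinvD[OF inv that] by simp
  have J1: "(\<integral>z. \<integral>y. F (a, y, z) \<partial>haar \<partial>haar) = (\<integral>z. \<integral>y. F (b, y, z) \<partial>haar \<partial>haar)" if a: "a \<in> SU2" and b: "b \<in> SU2" for a b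
  proof -
    obtain h where h: "h \<in> SU2" "su2_mult a h = b" using su2_right_divide[OF a b] by blast
    have "(\<integral>z. \<integral>y. F (a, y, z) \<partial>haar \<partial>haar) = (\<integral>z. \<integral>y. F (b, su2_mult y h, su2_mult z h) \<partial>haar \<partial>haar)"
      by (intro Bochner_Integration.integral_cong refl) (simp add: Finv[OF h(1) a] flip: h(2))
    also have "\<dots> = (\<integral>z. \<integral>y. F (b, y, z) \<partial>haar \<partial>haar)"
      by (rule haar2_right[OF h(1), of "\<lambda>y z. F (b, y, z)"]) (intro continuous_slice[OF cF] continuous_intros)
    finally show ?thesis .
  qed
  have J2: "(\<integral>z. \<integral>y. F (y, a, z) \<partial>haar \<partial>haar) = (\<integral>z. \<integral>y. F (y, b, z) \<partial>haar \<partial>haar)" if a: "a \<in> SU2" and b: "b \<in> SU2" for a b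
  proof -
    obtain h where h: "h \<in> SU2" "su2_mult a h = b" using su2_right_divide[OF a b] by blast
    have "(\<integral>z. \<integral>y. F (y, a, z) \<partial>haar \<partial>haar) = (\<integral>z. \<integral>y. F (su2_mult y h, b, su2_mult z h) \<partial>haar \<partial>haar)"
      by (intro Bochner_Integration.integral_cong refl) (simp add: Finv[OF h(1) _ a] flip: h(2))
    also have "\<dots> = (\<integral>z. \<integral>y. F (y, b, z) \<partial>haar \<partial>haar)"
      by (rule haar2_right[OF h(1), of "\<lambda>y z. F (y, b, z)"]) (intro continuous_slice[OF cF] continuous_intros)
    finally show ?thesis .
  qed
  have J3: "(\<integral>z. \<integral>y. F (y, z, a) \<partial>haar \<partial>haar) = (\<integral>z. \<integral>y. F (y, z, b) \<partial>haar \<partial>haar)" if a: "a \<in> SU2" and b: "b \<in> SU2" for a b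
  proof -
    obtain h where h: "h \<in> SU2" "su2_mult a h = b" using su2_right_divide[OF a b] by blast
    have "(\<integral>z. \<integral>y. F (y, z, a) \<partial>haar \<partial>haar) = (\<integral>z. \<integral>y. F (su2_mult y h, su2_mult z h, b) \<partial>haar \<partial>haar)"
      by (intro Bochner_Integration.integral_cong refl) (simp add: Finv[OF h(1) _ _ a] flip: h(2))
    also have "\<dots> = (\<integral>z. \<integral>y. F (y, z, b) \<partial>haar \<partial>haar)"
      by (rule haar2_right[OF h(1), of "\<lambda>y z. F (y, z, b)"]) (intro continuous_slice[OF cF] continuous_intros)
    finally show ?thesis .
  qed
  have I1: "(\<integral>a. \<integral>z. \<integral>y. F (a, y, z) \<partial>haar \<partial>haar \<partial>haar) = (\<integral>x. F x \<partial>haar3)"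
  proof -
    have "(\<integral>a. \<integral>z. \<integral>y. F (a, y, z) \<partial>haar \<partial>haar \<partial>haar) = (\<integral>a. \<integral>y. \<integral>z. F (a, y, z) \<partial>haar \<partial>haar \<partial>haar)"
      by (rule Bochner_Integration.integral_cong) (use haar_swap_slice(1)[OF cF] in auto)
    then show ?thesis using haar3_integral(1)[OF cF] by simp
  qed
  have I2: "(\<integral>a. \<integral>z. \<integral>y. F (y, a, z) \<partial>haar \<partial>haar \<partial>haar) = (\<integral>x. F x \<partial>haar3)"
  proof -
    have "(\<integral>a. \<integral>z. \<integral>y. F (y, a, z) \<partial>haar \<partial>haar \<partial>haar) = (\<integral>a. \<integral>y. \<integral>z. F (y, a, z) \<partial>haar \<partial>haar \<partial>haar)"
      by (rule Bochner_Integration.integral_cong) (use haar_swap_slice(2)[OF cF] in auto)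
    then show ?thesis using haar3_integral(2)[OF cF] by simp
  qed
  have I3: "(\<integral>a. \<integral>z. \<integral>y. F (y, z, a) \<partial>haar \<partial>haar \<partial>haar) = (\<integral>x. F x \<partial>haar3)"
  proof -
    have "(\<integral>a. \<integral>z. \<integral>y. F (y, z, a) \<partial>haar \<partial>haar \<partial>haar) = (\<integral>a. \<integral>y. \<integral>z. F (y, z, a) \<partial>haar \<partial>haar \<partial>haar)"
      by (rule Bochner_Integration.integral_cong) (use haar_swap_slice(3)[OF cF] in auto)
    then show ?thesis using haar3_integral(3)[OF cF] by simp
  qed
  have "(\<integral>z. \<integral>y. F (a, y, z) \<partial>haar \<partial>haar) = (\<integral>x. F x \<partial>haar3)"
    using const_haar_integral[of "\<lambda>a. \<integral>z. \<integral>y. F (a, y, z) \<partial>haar \<partial>haar", OF J1 a] I1 by simp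
  then show "(\<integral>z. \<integral>y. (cmod (f (a, y, z)))\<^sup>2 \<partial>haar \<partial>haar) = (\<integral>x. (cmod (f x))\<^sup>2 \<partial>haar3)" by (simp add: F_def)
  have "(\<integral>z. \<integral>y. F (y, a, z) \<partial>haar \<partial>haar) = (\<integral>x. F x \<partial>haar3)"
    using const_haar_integral[of "\<lambda>a. \<integral>z. \<integral>y. F (y, a, z) \<partial>haar \<partial>haar", OF J2 a] I2 by simp
  then show "(\<integral>z. \<integral>y. (cmod (f (y, a, z)))\<^sup>2 \<partial>haar \<partial>haar) = (\<integral>x. (cmod (f x))\<^sup>2 \<partial>haar3)" by (simp add: F_def)
  have "(\<integral>z. \<integral>y. F (y, z, a) \<partial>haar \<partial>haar) = (\<integral>x. F x \<partial>haar3)"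
    using const_haar_integral[of "\<lambda>a. \<integral>z. \<integral>y. F (y, z, a) \<partial>haar \<partial>haar", OF J3 a] I3 by simp
  then show "(\<integral>z. \<integral>y. (cmod (f (y, z, a)))\<^sup>2 \<partial>haar \<partial>haar) = (\<integral>x. (cmod (f x))\<^sup>2 \<partial>haar3)" by (simp add: F_def)
qed

text \<open>One argument is frozen for free by \<open>right_inv_slices\<close>; the other costs one
  evaluation bound.\<close>

lemma right_inv_slices1:
  assumes f: "slices_W N f" and inv: "right_inv f" and a: "a \<in> SU2" and b: "b \<in> SU2"
  shows "(\<integral>y. (cmod (f (y, a, b)))\<^sup>2 \<partial>haar) \<le> dimW N * (\<integral>x. (cmod (f x))\<^sup>2 \<partial>haar3)"
    "(\<integral>y. (cmod (f (a, y, b)))\<^sup>2 \<partial>haar) \<le> dimW N * (\<integral>x. (cmod (f x))\<^sup>2 \<partial>haar3)"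
    "(\<integral>y. (cmod (f (a, b, y)))\<^sup>2 \<partial>haar) \<le> dimW N * (\<integral>x. (cmod (f x))\<^sup>2 \<partial>haar3)"
proof -
  note cF = slices_W_sq_continuous[OF f]
  note C = continuous_slice[OF cF]
  have "(\<integral>y. (cmod (f (y, a, b)))\<^sup>2 \<partial>haar) \<le> dimW N * (\<integral>y. \<integral>z. (cmod (f (y, a, z)))\<^sup>2 \<partial>haar \<partial>haar)"
    by (intro haar_integral_mono_dim slices_W_pointwise(3)[OF f] a b haar_integrable_continuous haar_inner_integrable C continuous_intros)
  then show "(\<integral>y. (cmod (f (y, a, b)))\<^sup>2 \<partial>haar) \<le> dimW N * (\<integral>x. (cmod (f x))\<^sup>2 \<partial>haar3)"
    using haar_swap_slice(2)[OF cF a] right_inv_slices(2)[OF f inv a] by simp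
  have "(\<integral>y. (cmod (f (a, y, b)))\<^sup>2 \<partial>haar) \<le> dimW N * (\<integral>y. \<integral>z. (cmod (f (a, y, z)))\<^sup>2 \<partial>haar \<partial>haar)"
    by (intro haar_integral_mono_dim slices_W_pointwise(3)[OF f] a b haar_integrable_continuous haar_inner_integrable C continuous_intros)
  then show "(\<integral>y. (cmod (f (a, y, b)))\<^sup>2 \<partial>haar) \<le> dimW N * (\<integral>x. (cmod (f x))\<^sup>2 \<partial>haar3)"
    using haar_swap_slice(1)[OF cF a] right_inv_slices(1)[OF f inv a] by simp
  have "(\<integral>y. (cmod (f (a, b, y)))\<^sup>2 \<partial>haar) \<le> dimW N * (\<integral>y. \<integral>z. (cmod (f (a, z, y)))\<^sup>2 \<partial>haar \<partial>haar)"
    by (intro haar_integral_mono_dim slices_W_pointwise(2)[OF f] a b haar_integrable_continuous haar_inner_integrable C continuous_intros)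
  then show "(\<integral>y. (cmod (f (a, b, y)))\<^sup>2 \<partial>haar) \<le> dimW N * (\<integral>x. (cmod (f x))\<^sup>2 \<partial>haar3)"
    using right_inv_slices(1)[OF f inv a] by simp
qed

section \<open>Orthonormal bases of the right-invariant space\<close>

lemma onb_norm_sq:
  assumes e: "is_onb_H0 L m e"
  shows "(\<integral>x. (cmod (\<Sum>k<m. e k x * c k))\<^sup>2 \<partial>haar3) = (\<Sum>k<m. (cmod (c k))\<^sup>2)"
proof -
  have ce: "continuous_on UNIV (e i)" if "i < m" for i
    using e that sl3D(1)[OF slices_W_Hcut] by (auto simp: is_onb_H0_def H0_def)
  have on: "(\<integral>x. e i x * cnj (e j x) \<partial>haar3) = (if i = j then 1 else 0)" if "i < m" "j < m" for i j
    using e that by (auto simp: is_onb_H0_def)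
  have "complex_of_real (\<integral>x. (cmod (\<Sum>k<m. e k x * c k))\<^sup>2 \<partial>haar3) = (\<integral>x. (\<Sum>i<m. e i x * c i) * cnj (\<Sum>j<m. e j x * c j) \<partial>haar3)"
    by (rule complex_integral_norm_sq)
  also have "\<dots> = (\<integral>x. (\<Sum>i<m. \<Sum>j<m. c i * cnj (c j) * (e i x * cnj (e j x))) \<partial>haar3)"
    by (simp add: cnj_sum sum_product mult_ac)
  also have "\<dots> = (\<Sum>i<m. \<integral>x. (\<Sum>j<m. c i * cnj (c j) * (e i x * cnj (e j x))) \<partial>haar3)"
    by (rule Bochner_Integration.integral_sum) (auto intro!: haar3_integrable continuous_intros ce)
  also have "\<dots> = (\<Sum>i<m. \<Sum>j<m. \<integral>x. c i * cnj (c j) * (e i x * cnj (e j x)) \<partial>haar3)"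
    by (rule sum.cong[OF refl], rule Bochner_Integration.integral_sum) (auto intro!: haar3_integrable continuous_intros ce)
  also have "\<dots> = (\<Sum>i<m. \<Sum>j<m. if i = j then c i * cnj (c i) else 0)"
    by (intro sum.cong refl) (simp add: on)
  also have "\<dots> = (\<Sum>i<m. c i * cnj (c i))" by simp
  also have "\<dots> = complex_of_real (\<Sum>k<m. (cmod (c k))\<^sup>2)"
    by (simp only: of_real_sum complex_norm_square)
  finally show ?thesis by (simp only: of_real_eq_iff)
qed

lemma onb_combination:
  assumes e: "is_onb_H0 L m e"
  shows "slices_W (nat \<lfloor>2 * L\<rfloor>) (\<lambda>x. \<Sum>k<m. e k x * c k)" "right_inv (\<lambda>x. \<Sum>k<m. e k x * c k)"
proof -
  have eH: "e i \<in> H0 L" if "i < m" for i using e that by (auto simp: is_onb_H0_def)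
  have "slices_W (nat \<lfloor>2 * L\<rfloor>) (\<lambda>x. \<Sum>k<m. c k * e k x)"
    by (intro slices_W_sum slices_W_cmul slices_W_Hcut) (use eH in \<open>auto simp: H0_def\<close>)
  then show "slices_W (nat \<lfloor>2 * L\<rfloor>) (\<lambda>x. \<Sum>k<m. e k x * c k)" by (simp add: mult.commute)
  show "right_inv (\<lambda>x. \<Sum>k<m. e k x * c k)"
    unfolding right_inv_def by (intro ballI sum.cong refl arg_cong2[where f = "(*)"] H0_right_invariant[OF eH]) auto
qed

lemma good_sys_onb:
  assumes e: "is_onb_H0 L m e"
  shows "good_sys m (dimW (nat \<lfloor>2 * L\<rfloor>)) e"
proof -
  have ce: "continuous_on UNIV (e i)" if "i < m" for i
    using e that sl3D(1)[OF slices_W_Hcut] by (auto simp: is_onb_H0_def H0_def)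
  note S1 = right_inv_slices1[OF onb_combination[OF e], unfolded onb_norm_sq[OF e]]
  note S2 = right_inv_slices[OF onb_combination[OF e], unfolded onb_norm_sq[OF e]]
  show ?thesis unfolding good_sys_def
  proof (intro conjI allI impI ballI)
    fix k assume k: "k < m"
    show "e k \<in> borel_measurable haar3" by (intro haar3_measurable borel_measurable_continuous_onI ce k)
    show "\<exists>B. \<forall>x\<in>SU2 \<times> SU2 \<times> SU2. cmod (e k x) \<le> B" by (rule bounded_SU2_3[OF ce[OF k]])
  qed (rule S1 S2[THEN eq_refl]; assumption)+
qed

text \<open>Conjugating the family amounts to conjugating the coefficients. It is needed for the
  second end of each line, where \<open>Ckern\<close> has the conjugate.\<close>

lemma good_sys_cnj: 
  assumes "good_sys m d f" shows "good_sys m d (\<lambda>k x. cnj (f k x))"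
proof -
  have c: "cmod (\<Sum>k<m. cnj (f k x) * c k) = cmod (\<Sum>k<m. f k x * cnj (c k))" for x c
  proof -
    have "(\<Sum>k<m. cnj (f k x) * c k) = cnj (\<Sum>k<m. f k x * cnj (c k))" by simp
    then show ?thesis by (simp only: complex_mod_cnj)
  qed
  have m: "(\<lambda>x. cnj (f k x)) \<in> borel_measurable haar3" if "k < m" for k
    using assms that unfolding good_sys_def
    by (intro measurable_compose[of "f k" haar3 borel cnj] borel_measurable_continuous_onI continuous_intros) auto
  note D = good_sysD1[OF assms, where c = "\<lambda>k. cnj (c k)" for c, unfolded complex_mod_cnj]
    good_sysD2[OF assms, where c = "\<lambda>k. cnj (c k)" for c, unfolded complex_mod_cnj]
  show ?thesis unfolding good_sys_def c
  proof (intro conjI allI impI ballI)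
    fix k assume k: "k < m"
    show "(\<lambda>x. cnj (f k x)) \<in> borel_measurable haar3" by (rule m[OF k])
    show "\<exists>B. \<forall>x\<in>SU2 \<times> SU2 \<times> SU2. cmod (cnj (f k x)) \<le> B" using assms k unfolding good_sys_def complex_mod_cnj by blast
  qed (rule D; assumption)+
qed

text \<open>The diagonal \<open>K\<close> of the reproducing kernel integrates to the dimension.
  Evaluating at a triple takes only two evaluation bounds, since right invariance gives one argument
  for free; this is the source of the exponent 6 of the cutoff.\<close>

lemma onb_card_le:
  assumes e: "is_onb_H0 L m e"
  shows "real m \<le> (dimW (nat \<lfloor>2 * L\<rfloor>))\<^sup>2"
proof -
  let ?D = "dimW (nat \<lfloor>2 * L\<rfloor>)"
  define K where "K x = (\<Sum>k<m. (cmod (e k x))\<^sup>2)" for x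
  have ce: "continuous_on UNIV (e i)" if "i < m" for i
    using e that sl3D(1)[OF slices_W_Hcut] by (auto simp: is_onb_H0_def H0_def)
  have K: "K x \<le> ?D\<^sup>2" if x: "x \<in> SU2 \<times> SU2 \<times> SU2" for x
  proof -
    obtain p q r where pqr: "x = (p, q, r)" "p \<in> SU2" "q \<in> SU2" "r \<in> SU2" using x by auto
    define c where "c k = cnj (e k x)" for k
    have K0: "0 \<le> K x" unfolding K_def by (intro sum_nonneg) simp
    have cK: "(\<Sum>k<m. (cmod (c k))\<^sup>2) = K x" by (simp add: c_def K_def)
    have Kx: "(\<Sum>k<m. e k x * c k) = complex_of_real (K x)"
      unfolding c_def K_def by (simp only: of_real_sum complex_norm_square)
    have "(K x)\<^sup>2 = (cmod (\<Sum>k<m. e k (p, q, r) * c k))\<^sup>2" using K0 Kx pqr by simp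
    also have "\<dots> \<le> ?D * (\<integral>y. (cmod (\<Sum>k<m. e k (p, q, y) * c k))\<^sup>2 \<partial>haar)"
      by (rule slices_W_pointwise(3)[OF onb_combination(1)[OF e] pqr(2-4)])
    also have "\<dots> \<le> ?D * (?D * K x)"
      by (rule mult_left_mono[OF _ dimW_nonneg])
         (use right_inv_slices1(3)[OF onb_combination[OF e] pqr(2,3), unfolded onb_norm_sq[OF e], of c] in \<open>simp add: cK\<close>)
    finally have "K x * K x \<le> ?D\<^sup>2 * K x" by (simp add: power2_eq_square mult.assoc)
    then show ?thesis using K0 by (cases "K x = 0") (auto simp: mult_le_cancel_right)
  qed
  have one: "(\<integral>x. (cmod (e k x))\<^sup>2 \<partial>haar3) = 1" if "k < m" for k
  proof -
    have "complex_of_real (\<integral>x. (cmod (e k x))\<^sup>2 \<partial>haar3) = 1"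
      using e that unfolding complex_integral_norm_sq is_onb_H0_def by auto
    then show ?thesis by (simp only: of_real_eq_1_iff)
  qed
  have "real m = (\<Sum>k<m. \<integral>x. (cmod (e k x))\<^sup>2 \<partial>haar3)" by (simp add: one)
  also have "\<dots> = (\<integral>x. K x \<partial>haar3)" unfolding K_def
    by (rule Bochner_Integration.integral_sum[symmetric]) (auto intro!: haar3_integrable continuous_intros ce)
  also have "\<dots> \<le> (\<integral>x. ?D\<^sup>2 \<partial>haar3)"
  proof (rule integral_mono)
    show "integrable haar3 K" unfolding K_def[abs_def] by (auto intro!: haar3_integrable continuous_intros ce)
  qed (use K in \<open>simp_all add: space_haar3\<close>)
  also have "\<dots> = ?D\<^sup>2" using haar3.prob_space by simp
  finally show ?thesis .
qed

section \<open>Amplitudes of connected graphs\<close>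

text \<open>The coordinates of different vertices form disjoint blocks, which are independent under
  the product measure, so the expectation of the product factorises. Each block is reindexed to
  \<open>haar6\<close>.\<close>

lemma integral_vertex_factorisation:
  fixes h :: "nat \<Rightarrow> (nat \<Rightarrow> cc) \<Rightarrow> complex"
  assumes n: "0 < n" and h: "\<And>v. v < n \<Longrightarrow> bdd (h v)"
  shows "(\<integral>g. (\<Prod>v<n. h v (\<lambda>i\<in>{..<6}. g (v, i))) \<partial>PiM ({..<n} \<times> {..<6}) (\<lambda>_. haar)) = (\<Prod>v<n. \<integral>g. h v g \<partial>haar6)"
    and "integrable (PiM ({..<n} \<times> {..<6}) (\<lambda>_. haar)) (\<lambda>g. \<Prod>v<n. h v (\<lambda>i\<in>{..<6}. g (v, i)))"
proof -
  let ?I = "{..<n} \<times> {..<6::nat}"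
  let ?M = "PiM ?I (\<lambda>_. haar)"
  interpret M: prob_space ?M by (rule prob_space_PiM) (rule prob_space_haar)
  have re: "distr ?M haar6 (\<lambda>g. \<lambda>i\<in>{..<6}. g (v, i)) = haar6" if "v < n" for v
    using distr_PiM_reindex[of ?I "\<lambda>_. haar" "Pair v" "{..<6}"] that by (auto simp: prob_space_haar inj_on_def)
  have mre: "(\<lambda>g. \<lambda>i\<in>{..<6}. g (v, i)) \<in> ?M \<rightarrow>\<^sub>M haar6" if "v < n" for v
    by (intro measurable_restrict measurable_component_singleton) (use that in auto)
  have hm: "h v \<in> borel_measurable haar6" if "v < n" for v using h[OF that] by (simp add: bdd_def)
  have int: "(\<integral>g. h v (\<lambda>i\<in>{..<6}. g (v, i)) \<partial>?M) = (\<integral>g. h v g \<partial>haar6)" if "v < n" for v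
    using integral_distr[OF mre[OF that] hm[OF that]] re[OF that] by simp
  have intg: "integrable ?M (\<lambda>g. h v (\<lambda>i\<in>{..<6}. g (v, i)))" if "v < n" for v
  proof -
    have "integrable (distr ?M haar6 (\<lambda>g. \<lambda>i\<in>{..<6}. g (v, i))) (h v)"
      unfolding re[OF that] by (rule bdd_integrable[OF h[OF that]])
    then show ?thesis by (rule integrable_distr[OF mre[OF that]])
  qed
  have ind: "M.indep_vars (\<lambda>_. borel) (\<lambda>v g. h v (\<lambda>i\<in>{..<6}. g (v, i))) {..<n}"
  proof -
    have "M.indep_vars (\<lambda>_. haar) (\<lambda>i g. g i) ?I"
    proof (subst M.indep_vars_iff_distr_eq_PiM')
      show "?I \<noteq> {}" using n by (auto simp: lessThan_empty_iff)
      show "M.random_variable haar (\<lambda>g. g i)" if "i \<in> ?I" for i by (rule measurable_component_singleton[OF that])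
      have "distr ?M ?M (\<lambda>x. restrict x ?I) = distr ?M ?M (\<lambda>x. x)"
        by (rule distr_cong) (auto simp: space_PiM PiE_def extensional_restrict)
      also have "\<dots> = ?M" by (rule distr_id)
      also have "\<dots> = (\<Pi>\<^sub>M i\<in>?I. distr ?M haar (\<lambda>x. x i))"
        by (intro PiM_cong refl distr_PiM_component[symmetric] prob_space_haar)
      finally show "distr ?M ?M (\<lambda>x. restrict x ?I) = (\<Pi>\<^sub>M i\<in>?I. distr ?M haar (\<lambda>x. x i))" .
    qed
    then have "M.indep_vars (\<lambda>v. PiM ({v} \<times> {..<6}) (\<lambda>_. haar)) (\<lambda>v g. restrict (\<lambda>i. g i) ({v} \<times> {..<6})) {..<n}"
      by (rule M.indep_vars_restrict) (auto simp: disjoint_family_on_def)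
    then have "M.indep_vars (\<lambda>_. borel) (\<lambda>v g. (\<lambda>w. h v (\<lambda>i\<in>{..<6}. w (v, i))) (restrict (\<lambda>i. g i) ({v} \<times> {..<6}))) {..<n}"
    proof (rule M.indep_vars_compose2)
      fix v assume "v \<in> {..<n}"
      then have v: "v < n" by simp
      have "(\<lambda>w. \<lambda>i\<in>{..<6}. w (v, i)) \<in> PiM ({v} \<times> {..<6}) (\<lambda>_. haar) \<rightarrow>\<^sub>M haar6"
        by (intro measurable_restrict measurable_component_singleton) auto
      from measurable_compose[OF this hm[OF v]]
      show "(\<lambda>w. h v (\<lambda>i\<in>{..<6}. w (v, i))) \<in> borel_measurable (PiM ({v} \<times> {..<6}) (\<lambda>_. haar))" .
    qed
    moreover have "(\<lambda>i\<in>{..<6}. restrict (\<lambda>i. g i) ({v} \<times> {..<6}) (v, i)) = (\<lambda>i\<in>{..<6}. g (v, i))" for g :: "nat \<times> nat \<Rightarrow> cc" and v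
      by (auto simp: restrict_def fun_eq_iff)
    ultimately show ?thesis by simp
  qed
  show "(\<integral>g. (\<Prod>v<n. h v (\<lambda>i\<in>{..<6}. g (v, i))) \<partial>?M) = (\<Prod>v<n. \<integral>g. h v g \<partial>haar6)"
    using M.indep_vars_lebesgue_integral[OF _ ind] intg by (simp add: int)
  show "integrable ?M (\<lambda>g. \<Prod>v<n. h v (\<lambda>i\<in>{..<6}. g (v, i)))"
    using M.indep_vars_integrable[OF _ ind] intg by simp
qed

lemma prod_lessThan_mult_4:
  fixes f :: "nat \<Rightarrow> 'a::comm_monoid_mult"
  shows "(\<Prod>s<4*n. f s) = (\<Prod>v<n. \<Prod>a<4. f (4 * v + a))"
proof (induction n)
  case (Suc n)
  have "(\<Prod>s<4 * Suc n. f s) = (\<Prod>s<4*n. f s) * (f (4*n) * f (4*n+1) * f (4*n+2) * f (4*n+3))"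
    by (simp add: numeral_eq_Suc lessThan_Suc mult_ac)
  also have "(f (4*n) * f (4*n+1) * f (4*n+2) * f (4*n+3)) = (\<Prod>a<4. f (4 * n + a))"
    by (simp add: numeral_eq_Suc lessThan_Suc mult_ac)
  finally show ?case by (simp add: Suc)
qed simp

locale bfl_graph =
  fixes L :: real and n :: nat and ty :: "nat \<Rightarrow> bool" and \<sigma> :: "nat \<Rightarrow> nat" and m :: nat and e :: "nat \<Rightarrow> triple \<Rightarrow> complex"
  assumes n1: "1 \<le> n" and matching: "bfl_matching n \<sigma>" and connected: "bfl_connected n \<sigma>" and onb: "is_onb_H0 L m e"
begin

definition D :: real where "D = dimW (nat \<lfloor>2 * L\<rfloor>)"

lemma D1: "1 \<le> D"
  by (simp add: D_def dimW_def)

lemma \<sigma>: "s < 4 * n \<Longrightarrow> \<sigma> s < 4 * n" "s < 4 * n \<Longrightarrow> \<sigma> s \<noteq> s" "s < 4 * n \<Longrightarrow> \<sigma> (\<sigma> s) = s"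
  using matching by (auto simp: bfl_matching_def)

text \<open>A line is named by the smaller of its two slots.\<close>

definition E :: "nat set" where "E = {s. s < 4 * n \<and> s < \<sigma> s}"

text \<open>Splits \<open>Ckern\<close> between the two ends of a line: the smaller slot carries the
  basis function, the larger one its conjugate.\<close>

definition slot_fun :: "nat \<Rightarrow> nat \<Rightarrow> triple \<Rightarrow> complex" where
  "slot_fun s k x = (if s < \<sigma> s then e k x else cnj (e k x))"

definition \<tau> :: "nat \<Rightarrow> (nat \<Rightarrow> nat) \<Rightarrow> complex" where
  "\<tau> v = vertex_sys.tau (ty v) (\<lambda>a. slot_fun (4 * v + a))"

lemma finite_E: "finite E" by (simp add: E_def)

lemma zero_in_E: "0 \<in> E"
  using \<sigma>(2)[of 0] n1 by (auto simp: E_def)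

lemma slots_split: "{..<4 * n} = E \<union> \<sigma> ` E" "E \<inter> \<sigma> ` E = {}" "inj_on \<sigma> E"
proof -
  show "{..<4 * n} = E \<union> \<sigma> ` E"
  proof
    show "{..<4 * n} \<subseteq> E \<union> \<sigma> ` E"
    proof
      fix s assume "s \<in> {..<4 * n}"
      then have s: "s < 4 * n" by simp
      show "s \<in> E \<union> \<sigma> ` E"
      proof (cases "s < \<sigma> s")
        case False
        then have "\<sigma> s \<in> E" using \<sigma>[OF s] by (simp add: E_def)
        then show ?thesis using \<sigma>(3)[OF s] by (metis UnI2 image_eqI)
      qed (use s in \<open>simp add: E_def\<close>)
    qed
  qed (use \<sigma>(1) in \<open>auto simp: E_def\<close>)
  show "E \<inter> \<sigma> ` E = {}" using \<sigma>(3) by (auto simp: E_def)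
  show "inj_on \<sigma> E" using \<sigma>(3) by (intro inj_on_inverseI[of _ \<sigma>]) (auto simp: E_def)
qed

lemma good_slot: "good_sys m D (slot_fun s)"
proof (cases "s < \<sigma> s")
  case True
  then have "slot_fun s = e" by (auto simp: slot_fun_def fun_eq_iff)
  then show ?thesis using good_sys_onb[OF onb] by (simp add: D_def)
next
  case False
  then have "slot_fun s = (\<lambda>k x. cnj (e k x))" by (auto simp: slot_fun_def fun_eq_iff)
  then show ?thesis using good_sys_cnj[OF good_sys_onb[OF onb]] by (simp add: D_def)
qed

lemma vertex: "vertex_sys m D (\<lambda>a. slot_fun (4 * v + a))"
  by unfold_locales (rule good_slot, rule D1)

text \<open>Expanding every kernel introduces one basis index per line, that is, a labelling of
  \<open>E\<close>. Regrouping the slots by vertices then lets the integral factorise.\<close>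

lemma amplitude_eq:
  "bfl_amp (Ckern m e) n ty \<sigma> = (\<Sum>l\<in>PiE E (\<lambda>_. {..<m}). \<Prod>v<n. \<tau> v (\<lambda>a. l (min (4 * v + a) (\<sigma> (4 * v + a)))))"
proof -
  let ?M = "PiM ({..<n} \<times> {..<6}) (\<lambda>_. haar)"
  define X where "X s g = slotX (ty (s div 4)) (s mod 4) (\<lambda>i. g (s div 4, i))" for s and g :: "nat \<times> nat \<Rightarrow> cc"
  define h where "h l v g = (\<Prod>a<4. slot_fun (4 * v + a) (l (min (4 * v + a) (\<sigma> (4 * v + a)))) (pick (slot_vars (ty v) a) g))" for l v g
  have pt: "(\<Prod>s\<in>E. Ckern m e (X s g) (X (\<sigma> s) g)) = (\<Sum>l\<in>PiE E (\<lambda>_. {..<m}). \<Prod>v<n. h l v (\<lambda>i\<in>{..<6}. g (v, i)))" for g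
  proof -
    have "(\<Prod>s\<in>E. Ckern m e (X s g) (X (\<sigma> s) g)) = (\<Sum>l\<in>PiE E (\<lambda>_. {..<m}). \<Prod>s\<in>E. e (l s) (X s g) * cnj (e (l s) (X (\<sigma> s) g)))"
      unfolding Ckern_def by (rule prod_sum_PiE) (auto simp: finite_E)
    also have "\<dots> = (\<Sum>l\<in>PiE E (\<lambda>_. {..<m}). \<Prod>v<n. h l v (\<lambda>i\<in>{..<6}. g (v, i)))"
    proof (rule sum.cong[OF refl])
      fix l
      have "(\<Prod>s\<in>E. e (l s) (X s g) * cnj (e (l s) (X (\<sigma> s) g)))
          = (\<Prod>s\<in>E. slot_fun s (l (min s (\<sigma> s))) (X s g)) * (\<Prod>s\<in>E. slot_fun (\<sigma> s) (l (min (\<sigma> s) (\<sigma> (\<sigma> s)))) (X (\<sigma> s) g))"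
        unfolding prod.distrib[symmetric] by (intro prod.cong refl) (auto simp: E_def slot_fun_def \<sigma>(3) min_def)
      also have "\<dots> = (\<Prod>s\<in>E. slot_fun s (l (min s (\<sigma> s))) (X s g)) * (\<Prod>s\<in>\<sigma> ` E. slot_fun s (l (min s (\<sigma> s))) (X s g))"
        by (simp add: prod.reindex[OF slots_split(3)] comp_def)
      also have "\<dots> = (\<Prod>s<4*n. slot_fun s (l (min s (\<sigma> s))) (X s g))"
        unfolding slots_split(1) by (rule prod.union_disjoint[symmetric]) (use finite_E slots_split(2) in auto)
      also have "\<dots> = (\<Prod>v<n. h l v (\<lambda>i\<in>{..<6}. g (v, i)))"
        unfolding prod_lessThan_mult_4 h_def
      proof (intro prod.cong refl)
        fix v a assume "a \<in> {..<4::nat}"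
        then have "X (4 * v + a) g = pick (slot_vars (ty v) a) (\<lambda>i. g (v, i))"
          by (simp add: X_def slotX_eq)
        also have "\<dots> = pick (slot_vars (ty v) a) (\<lambda>i\<in>{..<6}. g (v, i))"
          using var_ok_sv[of "ty v" a] by (simp add: pick_def var_ok_def var_set_def)
        finally show "slot_fun (4 * v + a) (l (min (4 * v + a) (\<sigma> (4 * v + a)))) (X (4 * v + a) g)
           = slot_fun (4 * v + a) (l (min (4 * v + a) (\<sigma> (4 * v + a)))) (pick (slot_vars (ty v) a) (\<lambda>i\<in>{..<6}. g (v, i)))" by simp
      qed
      finally show "(\<Prod>s\<in>E. e (l s) (X s g) * cnj (e (l s) (X (\<sigma> s) g))) = (\<Prod>v<n. h l v (\<lambda>i\<in>{..<6}. g (v, i)))" .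
    qed
    finally show ?thesis .
  qed
  have minE: "min s (\<sigma> s) \<in> E" if "s < 4 * n" for s
    using \<sigma>[OF that] that by (auto simp: E_def min_def)
  have bh: "bdd (h l v)" if "l \<in> PiE E (\<lambda>_. {..<m})" "v < n" for l v
    unfolding h_def[abs_def]
  proof (intro bdd_prod bdd_trip[OF good_slot _ var_ok_sv])
    fix a assume "a \<in> {..<4::nat}"
    then have "4 * v + a < 4 * n" using that(2) by auto
    then show "l (min (4 * v + a) (\<sigma> (4 * v + a))) < m" using minE that(1) by auto
  qed simp
  have "bfl_amp (Ckern m e) n ty \<sigma> = (\<integral>g. (\<Prod>s\<in>E. Ckern m e (X s g) (X (\<sigma> s) g)) \<partial>?M)"
    by (simp add: bfl_amp_def E_def X_def)
  also have "\<dots> = (\<Sum>l\<in>PiE E (\<lambda>_. {..<m}). \<integral>g. (\<Prod>v<n. h l v (\<lambda>i\<in>{..<6}. g (v, i))) \<partial>?M)"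
    unfolding pt by (rule Bochner_Integration.integral_sum, rule integral_vertex_factorisation(2)[OF _ bh], use n1 in simp)
  also have "\<dots> = (\<Sum>l\<in>PiE E (\<lambda>_. {..<m}). \<Prod>v<n. \<integral>g. h l v g \<partial>haar6)"
    by (rule sum.cong[OF refl], rule integral_vertex_factorisation(1)[OF _ bh], use n1 in simp)
  also have "\<dots> = (\<Sum>l\<in>PiE E (\<lambda>_. {..<m}). \<Prod>v<n. \<tau> v (\<lambda>a. l (min (4 * v + a) (\<sigma> (4 * v + a)))))"
    unfolding \<tau>_def vertex_sys.tau_def[OF vertex] vertex_sys.Phi_def[OF vertex] h_def ..
  finally show ?thesis .
qed

text \<open>The line through slot 0 is cut: its second end gets the fresh label \<open>4 * n\<close>.\<close>

definition lab :: "nat \<Rightarrow> nat" where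
  "lab s = (if s = \<sigma> 0 then 4 * n else min s (\<sigma> s))"

definition \<eta> :: "nat \<Rightarrow> nat \<Rightarrow> nat" where "\<eta> v a = lab (4 * v + a)"

definition slots :: "nat \<Rightarrow> nat set" where "slots l = {s. s < 4 * n \<and> lab s = l}"

lemma hits_eq: "{s \<in> {..<n} \<times> {..<4}. \<eta> (fst s) (snd s) = l} = (\<lambda>s. (s div 4, s mod 4)) ` slots l"
proof (intro set_eqI iffI)
  fix x assume "x \<in> {s \<in> {..<n} \<times> {..<4}. \<eta> (fst s) (snd s) = l}"
  then obtain v a where x: "x = (v, a)" "v < n" "a < 4" "lab (4 * v + a) = l" by (auto simp: \<eta>_def)
  then have "4 * v + a \<in> slots l" by (auto simp: slots_def)
  moreover have "x = ((4 * v + a) div 4, (4 * v + a) mod 4)" using x by simp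
  ultimately show "x \<in> (\<lambda>s. (s div 4, s mod 4)) ` slots l" by blast
next
  fix x assume "x \<in> (\<lambda>s. (s div 4, s mod 4)) ` slots l"
  then obtain s where "x = (s div 4, s mod 4)" "s < 4 * n" "lab s = l" by (auto simp: slots_def)
  then show "x \<in> {s \<in> {..<n} \<times> {..<4}. \<eta> (fst s) (snd s) = l}" by (auto simp: \<eta>_def)
qed

lemma card_hits: "card {s \<in> {..<n} \<times> {..<4}. \<eta> (fst s) (snd s) = l} = card (slots l)"
proof -
  have "inj_on (\<lambda>s::nat. (s div 4, s mod 4)) (slots l)"
    by (rule inj_onI) (metis div_mod_decomp fst_conv snd_conv)
  then show ?thesis unfolding hits_eq by (rule card_image)
qed

lemma \<sigma>0: "\<sigma> 0 < 4 * n" "\<sigma> 0 \<noteq> 0" "\<sigma> (\<sigma> 0) = 0"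
  using \<sigma>[of 0] n1 by auto

lemma slots_new: "slots (4 * n) = {\<sigma> 0}"
  using \<sigma>0 by (auto simp: slots_def lab_def min_def split: if_splits)

lemma slots_zero: "slots 0 = {0}"
proof
  show "slots 0 \<subseteq> {0}"
  proof
    fix s assume "s \<in> slots 0"
    then have s: "s < 4 * n" "lab s = 0" by (auto simp: slots_def)
    then have "s \<noteq> \<sigma> 0" using n1 by (auto simp: lab_def)
    then have "s = 0 \<or> \<sigma> s = 0" using s by (auto simp: lab_def min_def split: if_splits)
    then show "s \<in> {0}" using \<sigma>(3)[OF s(1)] \<open>s \<noteq> \<sigma> 0\<close> by auto
  qed
  show "{0} \<subseteq> slots 0" using \<sigma>0 n1 by (auto simp: slots_def lab_def)
qed

lemma slots_inner: 
  assumes l: "l \<in> E - {0}" shows "slots l = {l, \<sigma> l}"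
proof
  have l': "l < 4 * n" "l < \<sigma> l" "l \<noteq> 0" using l by (auto simp: E_def)
  have s1: "\<sigma> l \<noteq> \<sigma> 0" using \<sigma>(3)[OF l'(1)] \<sigma>0(3) l'(3) by metis
  have s2: "l \<noteq> \<sigma> 0" using l' \<sigma>0 by auto
  show "slots l \<subseteq> {l, \<sigma> l}"
  proof
    fix s assume "s \<in> slots l"
    then have s: "s < 4 * n" "lab s = l" by (auto simp: slots_def)
    then have "s = l \<or> \<sigma> s = l" using l' by (auto simp: lab_def min_def split: if_splits)
    then show "s \<in> {l, \<sigma> l}" using \<sigma>(3)[OF s(1)] by auto
  qed
  show "{l, \<sigma> l} \<subseteq> slots l" using l' s1 s2 \<sigma>[OF l'(1)] by (auto simp: slots_def lab_def)
qed

lemma slots_other: "l \<notin> E \<Longrightarrow> l \<noteq> 4 * n \<Longrightarrow> slots l = {}"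
proof (rule ccontr)
  assume l: "l \<notin> E" "l \<noteq> 4 * n" and "slots l \<noteq> {}"
  then obtain s where s: "s < 4 * n" "lab s = l" by (auto simp: slots_def)
  then have "l = min s (\<sigma> s)" using l(2) by (auto simp: lab_def split: if_splits)
  then show False using l(1) \<sigma>[OF s(1)] s(1) by (auto simp: E_def min_def split: if_splits)
qed

lemma card_slots: "card (slots l) = (if l = 0 \<or> l = 4 * n then 1 else if l \<in> E then 2 else 0)"
proof -
  have "card (slots l) = 2" if "l \<in> E" "l \<noteq> 0"
    using slots_inner[of l] that \<sigma>(2)[of l] by (auto simp: E_def)
  then show ?thesis using slots_zero slots_new slots_other[of l] zero_in_E by auto
qed

sublocale tensor_net m "{..<n}" \<eta> \<tau> D
proof
  show "finite {..<n}" by simp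
  show "0 \<le> D" using D1 by simp
  show "card {s \<in> {..<n} \<times> {..<4}. \<eta> (fst s) (snd s) = l} \<le> 2" for l
    unfolding card_hits card_slots by simp
  show "indep (\<tau> v) (- {..<4})" for v unfolding \<tau>_def by (rule vertex_sys.tau_indep[OF vertex])
  show "op_bound m A ({..<4} - A) (\<tau> v) D" if "A \<subseteq> {..<4}" "A \<noteq> {}" "A \<noteq> {..<4}" for A v
    unfolding \<tau>_def by (rule vertex_sys.tau_split[OF vertex that])
  show "op_bound m {a} {b} (\<lambda>p. \<Sum>k<m. \<Sum>j<m. M k j * \<tau> v (p(c := k, d := j))) (D * C)"
    if "{a, b, c, d} = {..<4}" "mat_bound m M C" "0 \<le> C" for a b c d M C v
    unfolding \<tau>_def by (rule vertex_sys.tau_contract[OF vertex that])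
qed

lemma deg_all: "deg {..<n} l = (if l = 0 \<or> l = 4 * n then 1 else if l \<in> E then 2 else 0)"
  unfolding deg_def hits_def card_hits card_slots ..

lemma outer_all: "outer {..<n} = {0, 4 * n}" and inner_all: "inner {..<n} = E - {0}"
proof -
  have "4 * n \<notin> E" by (simp add: E_def)
  then show "outer {..<n} = {0, 4 * n}" "inner {..<n} = E - {0}"
    using deg_all by (auto simp: outer_def inner_def split: if_splits)
qed

text \<open>A connected graph with even degrees has no bridge, so it stays connected when one line
  is cut. The part not reached from \<open>g\<close> could be open only at \<open>g'\<close>, which
  parity excludes; hence both ends of the cut line are reached, and connectedness of the graph does
  the rest.\<close>

lemma reach_all:
  assumes g: "{g, g'} = {0, 4 * n}" "g \<noteq> g'"
  shows "{..<n} \<subseteq> reach \<eta> {..<n} {g}"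
proof -
  define R where "R = reach \<eta> {..<n} {g}"
  define W where "W = {..<n} - R"
  have Rn: "R \<subseteq> {..<n}" unfolding R_def by (rule reach_sub)
  have WR: "R \<union> W \<subseteq> {..<n}" "R \<inter> W = {}" "R \<union> W = {..<n}" and Wn: "W \<subseteq> {..<n}" using Rn by (auto simp: W_def)
  have sep: "deg R l = 0 \<or> deg W l = 0" for l
  proof (rule ccontr)
    assume "\<not> ?thesis"
    then have "deg R l \<ge> 1" "deg W l \<ge> 1" by auto
    then obtain r a w b where "r \<in> R" "a < 4" "\<eta> r a = l" "w \<in> W" "b < 4" "\<eta> w b = l" using deg_posD by meson
    then have "w \<in> R" unfolding R_def W_def by (intro reach.step[of r _ _ _ w a b]) auto
    then show False using \<open>w \<in> W\<close> by (simp add: W_def)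
  qed
  have dW: "deg {..<n} l = deg R l + deg W l" for l using deg_Un[OF WR(1,2)] WR(3) by simp
  have "outer W \<subseteq> {g'}"
  proof
    fix l assume l: "l \<in> outer W"
    then have "deg W l = 1" by (simp add: outer_def)
    then have "deg {..<n} l = 1" using sep[of l] dW[of l] by auto
    then have "l \<in> {g, g'}" unfolding g(1) using outer_all by (auto simp: outer_def)
    moreover obtain w b where "w \<in> W" "b < 4" "\<eta> w b = l" using deg_posD[of W l] \<open>deg W l = 1\<close> by auto
    then have "l \<noteq> g" using reach.base[of w "{..<n}" b \<eta> "{g}"] by (auto simp: W_def R_def)
    ultimately show "l \<in> {g'}" by simp
  qed
  moreover have "outer W \<noteq> {g'}" using even_ext[OF Wn] by auto
  ultimately have EW: "outer W = {}" by auto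
  have notW: "v \<notin> W" if v: "v < n" "a < 4" "\<eta> v a \<in> {0, 4 * n}" for v a
  proof
    assume "v \<in> W"
    then have "deg W (\<eta> v a) \<ge> 1" using deg_pos[OF Wn _ v(2)] by simp
    moreover have "deg {..<n} (\<eta> v a) = 1" using v(3) deg_all by auto
    ultimately have "\<eta> v a \<in> outer W" using dW[of "\<eta> v a"] by (simp add: outer_def)
    then show False using EW by simp
  qed
  have z: "\<eta> 0 0 = 0" using \<sigma>0 by (simp add: \<eta>_def lab_def)
  have s0: "\<eta> (\<sigma> 0 div 4) (\<sigma> 0 mod 4) = 4 * n" by (simp add: \<eta>_def lab_def)
  have R0: "0 \<in> R" using notW[of 0 0] z n1 by (auto simp: W_def)
  have Rs: "\<sigma> 0 div 4 \<in> R" using notW[of "\<sigma> 0 div 4" "\<sigma> 0 mod 4"] s0 \<sigma>0(1) by (auto simp: W_def)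
  have step: "w \<in> R" if u: "u \<in> R" and adj: "bfl_adj \<sigma> u w" for u w
  proof -
    obtain i j where ij: "i < 4" "j < 4" "\<sigma> (4 * u + i) = 4 * w + j" using adj by (auto simp: bfl_adj_def)
    have "u < n" using u Rn by auto
    then have s: "4 * u + i < 4 * n" using ij by auto
    have w: "w < n" using \<sigma>(1)[OF s] ij by auto
    show ?thesis
    proof (cases "4 * u + i \<in> {0, \<sigma> 0}")
      case True
      \<comment> \<open>The cut line no longer gives a shared edge, but both of its ends are already
        known to lie in \<open>R\<close>.\<close>
      then have "4 * w + j \<in> {0, \<sigma> 0}" using ij(3) \<sigma>0 by auto
      then have "w = 0 \<or> w = \<sigma> 0 div 4" using ij(2) by auto
      then show ?thesis using R0 Rs by auto
    next
      case False
      have "4 * w + j \<noteq> \<sigma> 0" using False ij(3) \<sigma>(3)[OF s] \<sigma>0(3) by auto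
      then have "\<eta> u i = \<eta> w j" using False ij(3) \<sigma>(3)[OF s] by (auto simp: \<eta>_def lab_def min.commute)
      then show ?thesis using u w ij unfolding R_def by (intro reach.step[of u _ _ _ w i j]) auto
    qed
  qed
  have "v \<in> R" if "v < n" for v
  proof -
    have "(bfl_adj \<sigma>)\<^sup>*\<^sup>* 0 v" using connected that n1 by (auto simp: bfl_connected_def)
    then show ?thesis by (induction rule: rtranclp_induct) (use R0 step in auto)
  qed
  then show ?thesis unfolding R_def by auto
qed

lemma network_bound: "op_bound m {0} {4 * n} (net_tensor {..<n}) (D ^ n)"
proof -
  have n0: "4 * n \<noteq> 0" using n1 by simp
  have d: "outer {..<n} - {0} = {4 * n}" using outer_all n0 by auto
  have "net_bound {..<n} {0} (D ^ card {..<n})"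
  proof (rule net_bound_network)
    show "{0} \<subseteq> outer {..<n}" using outer_all by simp
    show "{..<n} \<subseteq> reach \<eta> {..<n} {0}" using reach_all[of 0 "4 * n"] n0 by auto
    show "{..<n} \<subseteq> reach \<eta> {..<n} (outer {..<n} - {0})" unfolding d using reach_all[of "4 * n" 0] n0 by auto
  qed simp
  then show ?thesis by (simp add: net_bound_def d)
qed

text \<open>Setting the fresh label \<open>4 * n\<close> equal to the label of edge 0 glues the cut
  line back together, and the sum over this common label is a trace of the opened network.\<close>

lemma amplitude_trace:
  "bfl_amp (Ckern m e) n ty \<sigma> = (\<Sum>k<m. net_tensor {..<n} ((\<lambda>_. 0)(0 := k, 4 * n := k)))"
proof -
  define G where "G l = (\<Prod>v<n. T v l)" for l
  have G: "G (l(4 * n := l 0)) = (\<Prod>v<n. \<tau> v (\<lambda>a. l (min (4 * v + a) (\<sigma> (4 * v + a)))))" for l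
    unfolding G_def T_def
  proof (intro prod.cong refl)
    fix v assume "v \<in> {..<n}"
    then have v: "v < n" by simp
    show "\<tau> v (\<lambda>x. (l(4 * n := l 0)) (\<eta> v x)) = \<tau> v (\<lambda>a. l (min (4 * v + a) (\<sigma> (4 * v + a))))"
    proof (rule indepD[OF \<tau>_indep])
      show "v \<in> {..<n}" using v by simp
      fix x :: nat assume "x \<notin> - {..<4}"
      then have s: "4 * v + x < 4 * n" using v by auto
      have "min (4 * v + x) (\<sigma> (4 * v + x)) \<noteq> 4 * n" using s by auto
      then show "(l(4 * n := l 0)) (\<eta> v x) = l (min (4 * v + x) (\<sigma> (4 * v + x)))"
        using \<sigma>0 by (auto simp: \<eta>_def lab_def)
    qed
  qed
  have nE: "4 * n \<notin> E" by (simp add: E_def)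
  have minE: "min s (\<sigma> s) \<in> E" if "s < 4 * n" for s
    using \<sigma>[OF that] that by (auto simp: E_def min_def)
  have "bfl_amp (Ckern m e) n ty \<sigma> = sumE m E (\<lambda>l. G (l(4 * n := l 0))) (\<lambda>_. 0)"
    unfolding amplitude_eq sumE_def G
  proof (rule sum.cong)
    show "PiE E (\<lambda>_. {..<m}) = PiE E (\<lambda>_. {..<m})" ..
    fix l
    show "(\<Prod>v<n. \<tau> v (\<lambda>a. l (min (4 * v + a) (\<sigma> (4 * v + a))))) = (\<Prod>v<n. \<tau> v (\<lambda>a. override_on (\<lambda>_. 0) l E (min (4 * v + a) (\<sigma> (4 * v + a)))))"
    proof (rule prod.cong[OF refl])
    fix v assume "v \<in> {..<n}"
    then have v: "v < n" by simp
    show "\<tau> v (\<lambda>a. l (min (4 * v + a) (\<sigma> (4 * v + a)))) = \<tau> v (\<lambda>a. override_on (\<lambda>_. 0) l E (min (4 * v + a) (\<sigma> (4 * v + a))))"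
    proof (rule indepD[OF \<tau>_indep])
      show "v \<in> {..<n}" using v by simp
      fix x :: nat assume "x \<notin> - {..<4}"
      then have s: "4 * v + x < 4 * n" using v by auto
      show "l (min (4 * v + x) (\<sigma> (4 * v + x))) = override_on (\<lambda>_. 0) l E (min (4 * v + x) (\<sigma> (4 * v + x)))"
        using minE[OF s] by (simp add: override_on_def)
    qed
    qed
  qed
  also have "\<dots> = sumE m (insert 0 (E - {0})) (\<lambda>l. G (l(4 * n := l 0))) (\<lambda>_. 0)"
    using zero_in_E by (simp add: insert_absorb)
  also have "\<dots> = (\<Sum>k<m. sumE m (E - {0}) (\<lambda>l. G (l(4 * n := l 0))) ((\<lambda>_. 0)(0 := k)))"
    by (rule sumE_insert) simp
  also have "\<dots> = (\<Sum>k<m. sumE m (E - {0}) G ((\<lambda>_. 0)(0 := k, 4 * n := k)))"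
    unfolding sumE_def using nE n1
    by (intro sum.cong refl arg_cong[where f = G]) (auto simp: override_on_def fun_eq_iff)
  finally show ?thesis unfolding net_tensor_def inner_all G_def .
qed

lemma amplitude_bound: "cmod (bfl_amp (Ckern m e) n ty \<sigma>) \<le> D ^ (n + 2)"
proof -
  have "cmod (bfl_amp (Ckern m e) n ty \<sigma>) \<le> m * D ^ n"
    unfolding amplitude_trace using D1 n1 by (intro op_bound_trace_bound[OF network_bound]) auto
  also have "\<dots> \<le> D\<^sup>2 * D ^ n"
    using onb_card_le[OF onb] D1 by (intro mult_right_mono) (auto simp: D_def)
  finally show ?thesis by (simp only: power_add mult.commute)
qed

end

theorem theorem2:
  shows "\<exists>K::real>0. \<forall>(\<Lambda>::real) (n::nat) (ty::nat \<Rightarrow> bool) (\<sigma>::nat \<Rightarrow> nat)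
           (m::nat) (e::nat \<Rightarrow> triple \<Rightarrow> complex).
     1 \<le> \<Lambda> \<longrightarrow> 1 \<le> n \<longrightarrow> bfl_matching n \<sigma> \<longrightarrow> bfl_connected n \<sigma> \<longrightarrow>
     is_onb_H0 \<Lambda> m e \<longrightarrow>
     cmod (bfl_amp (Ckern m e) n ty \<sigma>) \<le> K ^ n * \<Lambda> ^ (6 + 3 * n)"
proof (intro exI[of _ "27 ^ 3"] conjI allI impI)
  fix \<Lambda> :: real and n ty \<sigma> m e
  assume L: "1 \<le> \<Lambda>" and n: "1 \<le> n" and "bfl_matching n \<sigma>" "bfl_connected n \<sigma>" "is_onb_H0 \<Lambda> m e"
  then interpret bfl_graph \<Lambda> n ty \<sigma> m e by unfold_locales
  \<comment> \<open>For a cutoff of at least 1 the quantity \<open>2 * \<Lambda> + 1\<close> is at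
    most \<open>3 * \<Lambda>\<close>, and its cube gives the constant 27.\<close>
  have "real (nat \<lfloor>2 * \<Lambda>\<rfloor>) \<le> 2 * \<Lambda>" using L by (simp add: of_nat_floor)
  then have "real (nat \<lfloor>2 * \<Lambda>\<rfloor> + 1) \<le> 3 * \<Lambda>" unfolding of_nat_add of_nat_1 using L by linarith
  then have "real (nat \<lfloor>2 * \<Lambda>\<rfloor> + 1) ^ 3 \<le> (3 * \<Lambda>) ^ 3" by (rule power_mono) simp
  then have D: "D \<le> 27 * \<Lambda> ^ 3" unfolding D_def dimW_def by (simp add: power_mult_distrib)
  have "cmod (bfl_amp (Ckern m e) n ty \<sigma>) \<le> D ^ (n + 2)" by (rule amplitude_bound)
  also have "\<dots> \<le> (27 * \<Lambda> ^ 3) ^ (n + 2)" using D D1 by (intro power_mono) auto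
  also have "\<dots> = 27 ^ (n + 2) * \<Lambda> ^ (6 + 3 * n)"
    by (simp only: power_mult_distrib power_mult[symmetric]) (simp add: algebra_simps)
  \<comment> \<open>The surplus factor from the trace goes into the constant: \<open>n + 2\<close>
    is at most \<open>3 * n\<close> because \<open>n\<close> is at least 1.\<close>
  also have "\<dots> \<le> 27 ^ (3 * n) * \<Lambda> ^ (6 + 3 * n)"
    using n L by (intro mult_right_mono power_increasing) auto
  finally show "cmod (bfl_amp (Ckern m e) n ty \<sigma>) \<le> (27 ^ 3) ^ n * \<Lambda> ^ (6 + 3 * n)"
    by (simp only: power_mult)
qed simp

end
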